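(* Let $M$ be a locally complete metric space, and let $X$ and $Y$ be arc fields on $M$ which satisfy Conditions E1 and E2, are such that $X$ & $Y$ close, and are (locally uniformly) transverse. Let $F$ and $G$ be the local flows of $X$ and $Y$, respectively. If $[F,G]\sim aX+bY$ (local uniform tangency) for some Lipschitz functions $a,b:M\to\mathbb{R}$, then for each $x_0\in M$ there exists an integral surface $S$ of $X$ and $Y$ through $x_0$ (i.e. with $x_0\in S$).
   Context: $(M,d)$ is locally complete if each point of $M$ has a complete neighborhood. $B(x,r)=\{y\in M: d(x,y)<r\}$. An arc field on $M$ is a continuous map $X:M\times[-1,1]\to M$ with $X(x,0)=x$ for all $x$, such that $\rho(x):=\sup_{s\ne t} d(X(x,s),X(x,t))/|s-t|<\infty$ for each $x$ and $\rho$ is locally bounded: $\sup_{y\in B(x,r)}\rho(y)<\infty$ for $r>0$ sufficiently small. Write $X(x,t)=X_x(t)=X_t(x)$; compositions are written $Y_tX_s(x)=Y_t(X_s(x))$. Only the behavior of an arc field for $t$ near $0$ is of concern. Condition E1: for each $x_0\in M$ there are $r,\delta,\Lambda_X>0$ such that $d(X_t(x),X_t(y))\le d(x,y)(1+|t|\Lambda_X)$ for all $x,y\in B(x_0,r)$, $t\in(-\delta,\delta)$. Condition E2: for each $x_0\in M$ there are $r,\delta,\Omega_X>0$ such that $d(X_{s+t}(x),X_t(X_s(x)))\le |st|\,\Omega_X$ for all $x\in B(x_0,r)$, $s,t\in(-\delta,\delta)$. A solution curve to $X$ is a continuous $\sigma:(\alpha,\beta)\to M$ with $\lim_{h\to0}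 d(\sigma(t+h),X(\sigma(t),h))/h=0$ for each $t\in(\alpha,\beta)$. If $X$ satisfies E1 and E2 on a locally complete $M$, it is known that for each $x$ there is a unique maximal solution $\sigma_x:(\alpha_x,\beta_x)\to M$ with $\sigma_x(0)=x$; the local flow of $X$ is $F_t(x)=F(x,t):=\sigma_x(t)$. A local flow is regarded as an arc field by using $F(x,t)$ for $t\in(\alpha_x/2,\beta_x/2)$ and extending to all other $t\in[-1,1]$ by the constant values $F(x,\alpha_x/2)$, $F(x,\beta_x/2)$. $X$ & $Y$ close if for each $x_0\in M$ there are $C_{XY},\delta,r>0$ such that $d(Y_sX_t(x),X_tY_s(x))\le C_{XY}|st|$ for all $x\in B(x_0,r)$, $|s|,|t|<\delta$. Bracket: $[X,Y](x,t):=Y_{-\sqrt t}X_{-\sqrt t}Y_{\sqrt t}X_{\sqrt t}(x)$ for $t\ge0$, and $[X,Y](x,t):=X_{-\sqrt{|t|}}Y_{-\sqrt{|t|}}X_{\sqrt{|t|}}Y_{\sqrt{|t|}}(x)$ for $t<0$. Linear operations: $(X+Y)_t(x):=Y_tX_t(x)$; for $a:M\to\mathbb{R}$, $(aX)(x,t):=X(x,a(x)t)$ (with the time $a(x)t$ replaced by $1$ or $-1$ when $t>1/|a(x)|$, respectively $t<-1/|a(x)|$). Local uniform tangency $X\sim Y$ of maps $X,Y:M\times[-1,1]\to M$: $d(X_t(x),Y_t(x))=o(t)$ locally uniformly in $x$, i.e. for each $x_0$ there is $r>0$ such that for every $\varepsilon>0$ there is $\delta>0$ with $d(X_t(x),Y_t(x))<\varepsilon|t|$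 for all $x\in B(x_0,r)$, $0<|t|<\delta$. $X$ and $Y$ are (locally uniformly) transverse if for each $x_0\in M$ there is $\delta>0$ such that $d(X_s(x),Y_t(x))\ge\delta(|s|+|t|)$ for all $|s|,|t|<\delta$ and all $x\in B(x_0,\delta)$. A surface is a 2-dimensional topological manifold. With $d(x,N):=\inf\{d(x,y):y\in N\}$, a surface $S\subset M$ is an integral surface of $X$ and $Y$ if for any Lipschitz functions $a,b:M\to\mathbb{R}$, $d((aX+bY)_t(x),S)=o(t)$ locally uniformly in $x\in S$. *)

theory Defs
  imports "HOL-Analysis.Analysis"
begin

text \<open>
  The metric space is the carrier of a type of class \<^class>\<open>metric_space\<close>. A map
  \<open>M \<times> [-1, 1] \<rightarrow> M\<close> is rendered as a curried function \<open>X :: 'a \<Rightarrow> real \<Rightarrow> 'a\<close> of which only the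
  values at times in \<open>[-1, 1]\<close> are meaningful. The conditions below that quantify existentially
  over a time bound \<open>\<delta>\<close> without requiring \<open>\<delta> \<le> 1\<close> are preserved when \<open>\<delta>\<close> is decreased, so
  they do not depend on the values at other times.
\<close>

type_synonym 'a curve_family = "'a \<Rightarrow> real \<Rightarrow> 'a"

definition speed :: "'a::metric_space curve_family \<Rightarrow> 'a \<Rightarrow> ereal" where
  "speed X x =
     (SUP (s, t) \<in> {(s, t). s \<in> {-1..1} \<and> t \<in> {-1..1} \<and> s \<noteq> t}.
        ereal (dist (X x s) (X x t) / \<bar>s - t\<bar>))"

definition arc_field :: "'a::metric_space curve_family \<Rightarrow> bool" where
  "arc_field X \<longleftrightarrow>
     continuous_on (UNIV \<times> {-1..1}) (\<lambda>(x, t). X x t) \<and>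
     (\<forall>x. X x 0 = x) \<and>
     (\<forall>x. speed X x < \<infinity>) \<and>
     (\<forall>x. \<forall>\<^sub>F r in at_right 0. (SUP y \<in> ball x r. speed X y) < \<infinity>)"

definition cond_E1 :: "'a::metric_space curve_family \<Rightarrow> bool" where
  "cond_E1 X \<longleftrightarrow>
     (\<forall>x0. \<exists>r>0. \<exists>\<delta>>0. \<exists>\<Lambda>>0. \<forall>x\<in>ball x0 r. \<forall>y\<in>ball x0 r. \<forall>t\<in>{-\<delta><..<\<delta>}.
        dist (X x t) (X y t) \<le> dist x y * (1 + \<bar>t\<bar> * \<Lambda>))"

definition cond_E2 :: "'a::metric_space curve_family \<Rightarrow> bool" where
  "cond_E2 X \<longleftrightarrow>
     (\<forall>x0. \<exists>r>0. \<exists>\<delta>>0. \<exists>\<Omega>>0. \<forall>x\<in>ball x0 r. \<forall>s\<in>{-\<delta><..<\<delta>}. \<forall>t\<in>{-\<delta><..<\<delta>}.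
        dist (X x (s + t)) (X (X x s) t) \<le> \<bar>s * t\<bar> * \<Omega>)"

text \<open>
  The endpoints of the interval of definition of a solution may be infinite. Only the values of
  \<open>\<sigma>\<close> on \<^term>\<open>einterval \<alpha> \<beta>\<close> are meaningful.
\<close>

definition solution_curve ::
  "'a::metric_space curve_family \<Rightarrow> ereal \<Rightarrow> ereal \<Rightarrow> (real \<Rightarrow> 'a) \<Rightarrow> bool" where
  "solution_curve X \<alpha> \<beta> \<sigma> \<longleftrightarrow>
     continuous_on (einterval \<alpha> \<beta>) \<sigma> \<and>
     (\<forall>t \<in> einterval \<alpha> \<beta>. ((\<lambda>h. dist (\<sigma> (t + h)) (X (\<sigma> t) h) / h) \<longlongrightarrow> 0) (at 0))"

definition solution_from ::
  "'a::metric_space curve_family \<Rightarrow> 'a \<Rightarrow> ereal \<Rightarrow> ereal \<Rightarrow> (real \<Rightarrow> 'a) \<Rightarrow> bool" where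
  "solution_from X x \<alpha> \<beta> \<sigma> \<longleftrightarrow>
     0 \<in> einterval \<alpha> \<beta> \<and> solution_curve X \<alpha> \<beta> \<sigma> \<and> \<sigma> 0 = x"

definition maximal_solution ::
  "'a::metric_space curve_family \<Rightarrow> 'a \<Rightarrow> ereal \<Rightarrow> ereal \<Rightarrow> (real \<Rightarrow> 'a) \<Rightarrow> bool" where
  "maximal_solution X x \<alpha> \<beta> \<sigma> \<longleftrightarrow>
     solution_from X x \<alpha> \<beta> \<sigma> \<and>
     (\<forall>\<alpha>' \<beta>' \<tau>. solution_from X x \<alpha>' \<beta>' \<tau> \<and> \<alpha>' \<le> \<alpha> \<and> \<beta> \<le> \<beta>' \<and>
        (\<forall>t \<in> einterval \<alpha> \<beta>. \<tau> t = \<sigma> t) \<longrightarrow> \<alpha>' = \<alpha> \<and> \<beta>' = \<beta>)"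

definition local_flow ::
  "'a::metric_space curve_family \<Rightarrow> ('a \<Rightarrow> ereal) \<Rightarrow> ('a \<Rightarrow> ereal) \<Rightarrow> 'a curve_family \<Rightarrow> bool" where
  "local_flow X \<alpha> \<beta> F \<longleftrightarrow> (\<forall>x. maximal_solution X x (\<alpha> x) (\<beta> x) (F x))"

text \<open>
  A local flow as an arc field. When an endpoint is infinite, the corresponding case does not
  occur, so \<^const>\<open>real_of_ereal\<close> is only applied to finite values.
\<close>

definition flow_field ::
  "('a \<Rightarrow> ereal) \<Rightarrow> ('a \<Rightarrow> ereal) \<Rightarrow> 'a curve_family \<Rightarrow> 'a curve_family" where
  "flow_field \<alpha> \<beta> F x t =
     (if ereal t \<le> \<alpha> x / 2 then F x (real_of_ereal (\<alpha> x / 2))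
      else if \<beta> x / 2 \<le> ereal t then F x (real_of_ereal (\<beta> x / 2))
      else F x t)"

definition fields_close :: "'a::metric_space curve_family \<Rightarrow> 'a curve_family \<Rightarrow> bool" where
  "fields_close X Y \<longleftrightarrow>
     (\<forall>x0. \<exists>C>0. \<exists>\<delta>>0. \<exists>r>0. \<forall>x\<in>ball x0 r. \<forall>s t. \<bar>s\<bar> < \<delta> \<and> \<bar>t\<bar> < \<delta> \<longrightarrow>
        dist (Y (X x t) s) (X (Y x s) t) \<le> C * \<bar>s * t\<bar>)"

definition bracket :: "'a curve_family \<Rightarrow> 'a curve_family \<Rightarrow> 'a curve_family" where
  "bracket X Y x t =
     (if 0 \<le> t
      then Y (X (Y (X x (sqrt t)) (sqrt t)) (- sqrt t)) (- sqrt t)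
      else X (Y (X (Y x (sqrt \<bar>t\<bar>)) (sqrt \<bar>t\<bar>)) (- sqrt \<bar>t\<bar>)) (- sqrt \<bar>t\<bar>))"

definition add_field :: "'a curve_family \<Rightarrow> 'a curve_family \<Rightarrow> 'a curve_family" where
  "add_field X Y x t = Y (X x t) t"

text \<open>
  The cases \<open>t > 1 / \<bar>a x\<bar>\<close> and \<open>t < - 1 / \<bar>a x\<bar>\<close> are written without division, so that they do
  not occur when \<open>a x = 0\<close>.
\<close>

definition scale_field :: "('a \<Rightarrow> real) \<Rightarrow> 'a curve_family \<Rightarrow> 'a curve_family" where
  "scale_field a X x t =
     X x (if \<bar>a x\<bar> * t > 1 then 1 else if \<bar>a x\<bar> * t < -1 then -1 else a x * t)"

definition tangent :: "'a::metric_space curve_family \<Rightarrow> 'a curve_family \<Rightarrow> bool" where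
  "tangent X Y \<longleftrightarrow>
     (\<forall>x0. \<exists>r>0. \<forall>\<epsilon>>0. \<exists>\<delta>>0. \<forall>x\<in>ball x0 r. \<forall>t. 0 < \<bar>t\<bar> \<and> \<bar>t\<bar> < \<delta> \<longrightarrow>
        dist (X x t) (Y x t) < \<epsilon> * \<bar>t\<bar>)"

definition transverse :: "'a::metric_space curve_family \<Rightarrow> 'a curve_family \<Rightarrow> bool" where
  "transverse X Y \<longleftrightarrow>
     (\<forall>x0. \<exists>\<delta>>0. \<forall>s t. \<bar>s\<bar> < \<delta> \<and> \<bar>t\<bar> < \<delta> \<longrightarrow>
        (\<forall>x\<in>ball x0 \<delta>. \<delta> * (\<bar>s\<bar> + \<bar>t\<bar>) \<le> dist (X x s) (Y x t)))"

definition lipschitz_function :: "('a::metric_space \<Rightarrow> real) \<Rightarrow> bool" where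
  "lipschitz_function f \<longleftrightarrow> (\<exists>L. L-lipschitz_on UNIV f)"

definition surface :: "'a::topological_space set \<Rightarrow> bool" where
  "surface S \<longleftrightarrow>
     Hausdorff_space (top_of_set S) \<and> second_countable (top_of_set S) \<and>
     (\<forall>p\<in>S. \<exists>U. \<exists>V :: (real^2) set.
        openin (top_of_set S) U \<and> p \<in> U \<and> open V \<and> U homeomorphic V)"

definition integral_surface ::
  "'a::metric_space curve_family \<Rightarrow> 'a curve_family \<Rightarrow> 'a set \<Rightarrow> bool" where
  "integral_surface X Y S \<longleftrightarrow>
     surface S \<and>
     (\<forall>a b. lipschitz_function a \<and> lipschitz_function b \<longrightarrow>
        (\<forall>x0\<in>S. \<exists>r>0. \<forall>\<epsilon>>0. \<exists>\<delta>>0. \<forall>x \<in> S \<inter> ball x0 r. \<forall>t. 0 < \<bar>t\<bar> \<and> \<bar>t\<bar> < \<delta> \<longrightarrow>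
           infdist (add_field (scale_field a X) (scale_field b Y) x t) S < \<epsilon> * \<bar>t\<bar>))"

definition locally_complete :: "'a::metric_space set \<Rightarrow> bool" where
  "locally_complete M \<longleftrightarrow>
     (\<forall>x\<in>M. \<exists>U\<subseteq>M. complete U \<and> (\<exists>r>0. ball x r \<inter> M \<subseteq> U))"

end

theory Submission
  imports Defs
begin

text \<open>
  The surface is the set of points \<open>F\<^sub>t G\<^sub>s (x0)\<close> with \<open>t\<close> and \<open>s\<close> in a small interval around 0.
  Transversality of the fields makes this parametrization bi-Lipschitz, so the set is a surface
  (\<open>surface_chart\<close>). It contains short trajectories of \<open>F\<close> through its points, and what has to be shown
  is that it is also tangent to \<open>G\<close>.

  For smooth vector fields this is a computation with the pull-back \<open>W\<^sub>t\<close> of \<open>G\<close> along \<open>F\<^sub>t\<close>: its derivative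
  in \<open>t\<close> is the pull-back of the bracket \<open>a F + b G\<close>, so \<open>W\<^sub>t = A(t) F + B(t) G\<close> where \<open>A\<close> and \<open>B\<close> solve
  a linear differential equation. Hence \<open>G\<^sub>k F\<^sub>t (y)\<close> agrees with \<open>F\<^sub>t\<^sub>+\<^sub>A G\<^sub>k\<^sub>' (y)\<close> up to \<open>o(k)\<close>, with \<open>A\<close> and
  \<open>k'\<close> of order \<open>k\<close>; at \<open>y = G\<^sub>s (x0)\<close> the latter point lies on the surface. The metric version of
  this computation is \<open>pull_through\<close>. The bracket hypothesis says that \<open>G\<^sub>k\<close> and \<open>F\<^sub>h\<close> with
  \<open>\<bar>h\<bar> = \<bar>k\<bar>\<close> can be interchanged up to \<open>o(k\<^sup>2)\<close> if both times are corrected by \<open>O(k\<^sup>2)\<close>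
  (\<open>commutator_step\<close>). Cutting \<open>F\<^sub>t\<close> into roughly \<open>\<bar>t\<bar> / \<bar>k\<bar>\<close> such steps and moving \<open>G\<close> through them one after
  another accumulates an error \<open>o(k)\<close>. The closeness of the fields enters when the corrections, of
  size \<open>k\<^sup>2\<close>, are moved past a flow of time \<open>k\<close>: this is harmless if it costs the product of the two
  times (\<open>commute_product\<close>).

  Before that, the flows are brought under control. Comparison of Dini derivatives shows that solutions
  are stable, hence unique, and that the flow differs from its arc field by \<open>O(t\<^sup>2)\<close>; local completeness
  shows that the maximal solutions near \<open>x0\<close> share a common interval of existence
  (\<open>flow_exists_forward\<close>).
\<close>

section \<open>Comparison by Dini derivatives\<close>

text \<open>
  The set where \<open>\<phi>\<close> lies below the line through its initial value with slope \<open>e\<close> is compact. Its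
  largest point cannot lie before \<open>b\<close>, since the hypothesis allows a further step to the right.
\<close>
lemma dini_nonincreasing:
  fixes \<phi> :: "real \<Rightarrow> real"
  assumes ab: "a \<le> b" and cont: "continuous_on {a..b} \<phi>"
    and dini: "\<And>t e. t \<in> {a..<b} \<Longrightarrow> e > 0 \<Longrightarrow> \<forall>\<^sub>F h in at_right 0. \<phi> (t + h) \<le> \<phi> t + e * h"
  shows "\<phi> b \<le> \<phi> a"
proof (rule field_le_epsilon)
  fix e' :: real assume e': "e' > 0"
  define e where "e = e' / (b - a + 1)"
  have e: "e > 0" "e * (b - a) \<le> e'"
    using e' ab by (auto simp: e_def field_simps)
  define S where "S = {a..b} \<inter> (\<lambda>t. \<phi> t - e * (t - a)) -` {..\<phi> a}"
  have "closed S"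
    unfolding S_def by (intro continuous_closed_preimage continuous_intros cont closed_atMost closed_atLeastAtMost)
  then have "compact S"
    by (auto simp: compact_eq_bounded_closed S_def intro: bounded_subset[of "{a..b}"])
  moreover have "a \<in> S"
    using ab by (auto simp: S_def)
  ultimately obtain c where c: "c \<in> S" "\<And>t. t \<in> S \<Longrightarrow> t \<le> c"
    using compact_attains_sup[of S] by blast
  have "c = b"
  proof (rule ccontr)
    assume "c \<noteq> b"
    then have cab: "c \<in> {a..<b}"
      using c by (auto simp: S_def)
    have "\<forall>\<^sub>F h in at_right 0. h < b - c"
      using cab by (intro eventually_at_rightI[of 0 "b - c"]) auto
    with dini[OF cab e(1)] have "\<forall>\<^sub>F h in at_right 0. \<phi> (c + h) \<le> \<phi> c + e * h \<and> h < b - c \<and> 0 < h"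
      using eventually_at_right_less[of 0] by eventually_elim auto
    then obtain h where h: "\<phi> (c + h) \<le> \<phi> c + e * h" "h < b - c" "0 < h"
      using eventually_happens' trivial_limit_at_right_real by (metis (no_types, lifting))
    then have "c + h \<in> S"
      using c(1) cab by (auto simp: S_def algebra_simps)
    then show False
      using c(2) h by fastforce
  qed
  then show "\<phi> b \<le> \<phi> a + e'"
    using c(1) e by (auto simp: S_def)
qed

text \<open>
  Multiplying by \<open>exp (- \<Lambda> t)\<close> absorbs the linear term, and subtracting \<open>\<Omega> t\<^sup>2\<close>, whose derivative
  dominates \<open>\<Omega> t\<close>, absorbs the inhomogeneous one. What remains cannot increase.
\<close>
lemma gronwall_dini:
  fixes f :: "real \<Rightarrow> real"
  assumes b: "0 \<le> b" and cont: "continuous_on {0..b} f"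
    and nonneg: "\<And>t. f t \<ge> 0" and \<Lambda>: "\<Lambda> \<ge> 0" and \<Omega>: "\<Omega> \<ge> 0"
    and dini: "\<And>t e. t \<in> {0..<b} \<Longrightarrow> e > 0 \<Longrightarrow>
      \<forall>\<^sub>F h in at_right 0. f (t + h) \<le> f t * (1 + \<Lambda> * h) + (\<Omega> * t + e) * h"
  shows "f b \<le> exp (\<Lambda> * b) * (f 0 + \<Omega> * b\<^sup>2)"
proof -
  define \<phi> where "\<phi> t = exp (- (\<Lambda> * t)) * f t - \<Omega> * t\<^sup>2" for t
  have "\<phi> b \<le> \<phi> 0"
  proof (rule dini_nonincreasing[OF b])
    show "continuous_on {0..b} \<phi>"
      unfolding \<phi>_def by (intro continuous_intros cont)
    fix t e :: real assume t: "t \<in> {0..<b}" and e: "e > 0"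
    from dini[OF t e] eventually_at_right_less[of 0]
    show "\<forall>\<^sub>F h in at_right 0. \<phi> (t + h) \<le> \<phi> t + e * h"
    proof eventually_elim
      case (elim h)
      have nn: "0 \<le> h" "0 \<le> \<Omega> * t + e" "0 \<le> 1 + \<Lambda> * h" "0 \<le> \<Lambda> * t" "0 \<le> \<Lambda> * h" "0 \<le> \<Omega> * t * h" "0 \<le> \<Omega> * h\<^sup>2"
        using t e elim \<Omega> \<Lambda> by auto
      have "exp (- (\<Lambda> * (t + h))) * f (t + h)
          \<le> exp (- (\<Lambda> * (t + h))) * (f t * (1 + \<Lambda> * h) + (\<Omega> * t + e) * h)"
        using elim by simp
      also have "\<dots> = exp (- (\<Lambda> * t)) * f t * (exp (- (\<Lambda> * h)) * (1 + \<Lambda> * h))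
          + exp (- (\<Lambda> * (t + h))) * ((\<Omega> * t + e) * h)"
        by (simp add: ring_distribs exp_add exp_diff exp_minus field_simps)
      also have "\<dots> \<le> exp (- (\<Lambda> * t)) * f t * 1 + 1 * ((\<Omega> * t + e) * h)"
      proof (intro add_mono mult_mono)
        have "exp (- (\<Lambda> * h)) * (1 + \<Lambda> * h) \<le> exp (- (\<Lambda> * h)) * exp (\<Lambda> * h)"
          using exp_ge_add_one_self by (intro mult_left_mono) auto
        then show "exp (- (\<Lambda> * h)) * (1 + \<Lambda> * h) \<le> 1"
          by (simp flip: exp_add)
      qed (use nn nonneg t \<Omega> \<Lambda> in auto)
      finally have "exp (- (\<Lambda> * (t + h))) * f (t + h) \<le> exp (- (\<Lambda> * t)) * f t + (\<Omega> * t + e) * h"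
        by simp
      then show ?case
        using nn by (simp add: \<phi>_def algebra_simps power2_eq_square)
    qed
  qed
  then have "exp (- (\<Lambda> * b)) * f b \<le> f 0 + \<Omega> * b\<^sup>2"
    by (simp add: \<phi>_def)
  then show ?thesis
    by (simp add: exp_minus field_simps)
qed

section \<open>Solutions and time reversal\<close>

text \<open>
  The one-sided part of the solution condition on a compact interval. Comparison arguments only
  look to the right; statements about negative times follow by reversing time.
\<close>
definition forward_solution :: "'a::metric_space curve_family \<Rightarrow> real \<Rightarrow> real \<Rightarrow> (real \<Rightarrow> 'a) \<Rightarrow> bool" where
  "forward_solution X a b \<sigma> \<longleftrightarrow> continuous_on {a..b} \<sigma> \<and>
     (\<forall>t\<in>{a..<b}. \<forall>e>0. \<forall>\<^sub>F h in at_right 0. dist (\<sigma> (t + h)) (X (\<sigma> t) h) \<le> e * h)"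

lemma forward_solution_subinterval:
  "forward_solution X a b \<sigma> \<Longrightarrow> a \<le> a' \<Longrightarrow> b' \<le> b \<Longrightarrow> forward_solution X a' b' \<sigma>"
  unfolding forward_solution_def by (simp add: continuous_on_subset[of "{a..b}" \<sigma> "{a'..b'}"])

lemma forward_solution_shift:
  assumes "forward_solution X a b \<sigma>"
  shows "forward_solution X (a - c) (b - c) (\<lambda>t. \<sigma> (c + t))"
proof -
  have "continuous_on {a - c..b - c} (\<lambda>t. \<sigma> (c + t))"
    by (rule continuous_on_compose2[of "{a..b}" \<sigma>])
       (use assms in \<open>auto simp: forward_solution_def intro!: continuous_intros\<close>)
  moreover have "\<forall>\<^sub>F h in at_right 0. dist (\<sigma> (c + (t + h))) (X (\<sigma> (c + t)) h) \<le> e * h"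
    if "t \<in> {a - c..<b - c}" "e > 0" for t e
  proof -
    have "c + t \<in> {a..<b}"
      using that by auto
    then show ?thesis
      using assms that unfolding forward_solution_def add.assoc[symmetric] by blast
  qed
  ultimately show ?thesis
    unfolding forward_solution_def by blast
qed

lemma solution_curve_imp_forward:
  assumes sol: "solution_curve X \<alpha> \<beta> \<sigma>" and ab: "\<alpha> < ereal a" "ereal b < \<beta>"
  shows "forward_solution X a b \<sigma>"
  unfolding forward_solution_def
proof (intro conjI ballI allI impI)
  have sub: "{a..b} \<subseteq> einterval \<alpha> \<beta>"
  proof
    fix t assume t: "t \<in> {a..b}"
    have "\<alpha> < ereal t"
      by (rule less_le_trans[of \<alpha> "ereal a"]) (use ab t in auto)
    moreover have "ereal t < \<beta>"
      by (rule le_less_trans[of _ "ereal b"]) (use ab t in auto)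
    ultimately show "t \<in> einterval \<alpha> \<beta>"
      by (simp add: einterval_iff)
  qed
  then show "continuous_on {a..b} \<sigma>"
    using sol unfolding solution_curve_def by (blast intro: continuous_on_subset)
  fix t e :: real assume t: "t \<in> {a..<b}" and e: "e > 0"
  have "t \<in> einterval \<alpha> \<beta>"
    using sub t by (auto dest!: subsetD[of _ _ t])
  then have "((\<lambda>h. dist (\<sigma> (t + h)) (X (\<sigma> t) h) / h) \<longlongrightarrow> 0) (at 0)"
    using sol by (simp add: solution_curve_def)
  then have "((\<lambda>h. dist (\<sigma> (t + h)) (X (\<sigma> t) h) / h) \<longlongrightarrow> 0) (at_right 0)"
    by (rule filterlim_mono) (simp_all add: at_le)
  then have "\<forall>\<^sub>F h in at_right 0. dist (\<sigma> (t + h)) (X (\<sigma> t) h) / h < e"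
    by (rule order_tendstoD(2)[OF _ e])
  then show "\<forall>\<^sub>F h in at_right 0. dist (\<sigma> (t + h)) (X (\<sigma> t) h) \<le> e * h"
    using eventually_at_right_less[of 0] by eventually_elim (auto simp: field_simps)
qed

definition reverse :: "'a curve_family \<Rightarrow> 'a curve_family" where
  "reverse X x t = X x (- t)"

lemma einterval_uminus: "(- t \<in> einterval (- \<beta>) (- \<alpha>)) \<longleftrightarrow> t \<in> einterval \<alpha> \<beta>"
  unfolding einterval_iff
  by (metis ereal_minus_less_minus uminus_ereal.simps(1))

lemma solution_curve_reverse:
  assumes "solution_curve X \<alpha> \<beta> \<sigma>"
  shows "solution_curve (reverse X) (- \<beta>) (- \<alpha>) (\<lambda>t. \<sigma> (- t))"
  unfolding solution_curve_def
proof (intro conjI ballI)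
  have mem: "- t \<in> einterval \<alpha> \<beta>" if "t \<in> einterval (- \<beta>) (- \<alpha>)" for t
    using einterval_uminus[of "- t" \<beta> \<alpha>] that by simp
  show "continuous_on (einterval (- \<beta>) (- \<alpha>)) (\<lambda>t. \<sigma> (- t))"
    by (rule continuous_on_compose2[of "einterval \<alpha> \<beta>" \<sigma>])
       (use assms mem in \<open>auto simp: solution_curve_def intro!: continuous_intros\<close>)
  fix t assume "t \<in> einterval (- \<beta>) (- \<alpha>)"
  then have "((\<lambda>h. dist (\<sigma> (- t + h)) (X (\<sigma> (- t)) h) / h) \<longlongrightarrow> 0) (at 0)"
    using assms mem unfolding solution_curve_def by blast
  then have "((\<lambda>h. dist (\<sigma> (- t + - h)) (X (\<sigma> (- t)) (- h)) / - h) \<longlongrightarrow> 0) (at 0)"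
    by (rule filterlim_compose) (simp add: filterlim_def filtermap_at_minus)
  then have "((\<lambda>h. - (dist (\<sigma> (- t + - h)) (X (\<sigma> (- t)) (- h)) / - h)) \<longlongrightarrow> - 0) (at 0)"
    by (rule tendsto_minus)
  then show "((\<lambda>h. dist (\<sigma> (- (t + h))) (reverse X (\<sigma> (- t)) h) / h) \<longlongrightarrow> 0) (at 0)"
    by (simp add: reverse_def)
qed

section \<open>Estimates for solutions of a controlled field\<close>

text \<open>
  The hypotheses on one arc field near a point, made uniform: one ball, one time bound and a single
  constant \<open>L\<close> for the speed and for both conditions. The ball has a complete superset, which is
  all that local completeness contributes.
\<close>
locale controlled_field =
  fixes X :: "'a::metric_space curve_family" and x0 :: 'a and R \<delta> L :: real
  assumes pos: "R > 0" "\<delta> > 0" "L > 0"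
    and field_zero: "X x 0 = x"
    and speed_bound: "x \<in> ball x0 R \<Longrightarrow> \<bar>s\<bar> < \<delta> \<Longrightarrow> \<bar>t\<bar> < \<delta> \<Longrightarrow> dist (X x s) (X x t) \<le> L * \<bar>s - t\<bar>"
    and E1: "x \<in> ball x0 R \<Longrightarrow> y \<in> ball x0 R \<Longrightarrow> \<bar>t\<bar> < \<delta> \<Longrightarrow>
      dist (X x t) (X y t) \<le> dist x y * (1 + \<bar>t\<bar> * L)"
    and E2: "x \<in> ball x0 R \<Longrightarrow> \<bar>s\<bar> < \<delta> \<Longrightarrow> \<bar>t\<bar> < \<delta> \<Longrightarrow> dist (X x (s + t)) (X (X x s) t) \<le> \<bar>s * t\<bar> * L"
    and complete_nbhd: "\<exists>U. complete U \<and> ball x0 R \<subseteq> U"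
begin

lemma controlled_reverse: "controlled_field (reverse X) x0 R \<delta> L"
proof
  fix x s t assume *: "x \<in> ball x0 R" "\<bar>s\<bar> < \<delta>" "\<bar>t\<bar> < \<delta>"
  show "dist (reverse X x s) (reverse X x t) \<le> L * \<bar>s - t\<bar>"
    using speed_bound[of x "- s" "- t"] * by (simp add: reverse_def abs_minus_commute)
  show "dist (reverse X x (s + t)) (reverse X (reverse X x s) t) \<le> \<bar>s * t\<bar> * L"
    using E2[of x "- s" "- t"] * by (simp add: reverse_def)
next
  fix x y t assume *: "x \<in> ball x0 R" "y \<in> ball x0 R" "\<bar>t\<bar> < \<delta>"
  then show "dist (reverse X x t) (reverse X y t) \<le> dist x y * (1 + \<bar>t\<bar> * L)"
    using E1[of x y "- t"] by (simp add: reverse_def)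
qed (use pos complete_nbhd in \<open>auto simp: reverse_def field_zero\<close>)

lemma eventually_small_time: "\<forall>\<^sub>F h in at_right 0. 0 < h \<and> h < \<delta>"
  using pos by (intro eventually_at_rightI[of 0 \<delta>]) auto

text \<open>
  Whether the solution stays in the region where the speed is bounded need not be settled
  beforehand: truncating the distance at \<open>c\<close> gives a function whose growth is bounded by \<open>L\<close> in
  either case, and \<open>L (b - a) < c\<close> shows afterwards that the truncation was never active.
\<close>
lemma forward_solution_lipschitz:
  assumes sol: "forward_solution X a b \<sigma>" and ab: "a \<le> b"
    and c: "ball (\<sigma> a) c \<subseteq> ball x0 R" "L * (b - a) < c"
  shows "dist (\<sigma> a) (\<sigma> b) \<le> L * (b - a)"
proof -
  define \<phi> where "\<phi> t = min (dist (\<sigma> a) (\<sigma> t)) c - L * (t - a)" for t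
  have "\<phi> b \<le> \<phi> a"
  proof (rule dini_nonincreasing[OF ab])
    show "continuous_on {a..b} \<phi>"
      using sol unfolding \<phi>_def forward_solution_def by (intro continuous_intros) auto
    fix t e :: real assume t: "t \<in> {a..<b}" and e: "e > 0"
    show "\<forall>\<^sub>F h in at_right 0. \<phi> (t + h) \<le> \<phi> t + e * h"
    proof (cases "dist (\<sigma> a) (\<sigma> t) < c")
      case False
      show ?thesis
        using eventually_small_time
      proof eventually_elim
        case (elim h)
        have "0 \<le> e * h" "0 \<le> L * h"
          using elim e pos by auto
        then show ?case
          using False by (auto simp: \<phi>_def algebra_simps)
      qed
    next
      case True
      then have ball: "\<sigma> t \<in> ball x0 R"
        using c by auto
      have "\<forall>\<^sub>F h in at_right 0. dist (\<sigma> (t + h)) (X (\<sigma> t) h) \<le> e * h"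
        using sol t e by (auto simp: forward_solution_def)
      with eventually_small_time show ?thesis
      proof eventually_elim
        case (elim h)
        have "dist (X (\<sigma> t) 0) (X (\<sigma> t) h) \<le> L * \<bar>0 - h\<bar>"
          using elim pos by (intro speed_bound ball) auto
        then have "dist (\<sigma> t) (\<sigma> (t + h)) \<le> (L + e) * h"
          using elim field_zero dist_triangle3[of "\<sigma> t" "\<sigma> (t + h)" "X (\<sigma> t) h"]
          by (auto simp: algebra_simps dist_commute)
        then have "dist (\<sigma> a) (\<sigma> (t + h)) \<le> dist (\<sigma> a) (\<sigma> t) + (L + e) * h"
          using dist_triangle[of "\<sigma> a" "\<sigma> (t + h)" "\<sigma> t"] by linarith
        then show ?case
          using True by (auto simp: \<phi>_def algebra_simps)
      qed
    qed
  qed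
  then show ?thesis
    using c ab pos by (auto simp: \<phi>_def min_def split: if_splits)
qed

text \<open>
  Compares a solution with an approximate solution whose defect per unit of time is \<open>\<Omega> t\<close>. With
  \<open>\<Omega> = 0\<close> it gives stability and uniqueness of solutions; with \<open>\<tau> = X x\<close>, where E2 bounds the
  defect, it shows that the flow is tangent to the field to second order.
\<close>
lemma forward_solutions_gronwall:
  assumes b: "0 \<le> b"
    and \<sigma>: "forward_solution X 0 b \<sigma>" "\<And>t. t \<in> {0..<b} \<Longrightarrow> \<sigma> t \<in> ball x0 R"
    and \<tau>: "continuous_on {0..b} \<tau>" "\<And>t. t \<in> {0..<b} \<Longrightarrow> \<tau> t \<in> ball x0 R"
    and \<Omega>: "\<Omega> \<ge> 0"
    and defect: "\<And>t e. t \<in> {0..<b} \<Longrightarrow> e > 0 \<Longrightarrow>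
      \<forall>\<^sub>F h in at_right 0. dist (\<tau> (t + h)) (X (\<tau> t) h) \<le> (\<Omega> * t + e) * h"
  shows "dist (\<sigma> b) (\<tau> b) \<le> exp (L * b) * (dist (\<sigma> 0) (\<tau> 0) + \<Omega> * b\<^sup>2)"
proof (rule gronwall_dini[OF b, where f = "\<lambda>t. dist (\<sigma> t) (\<tau> t)"])
  show "continuous_on {0..b} (\<lambda>t. dist (\<sigma> t) (\<tau> t))"
    using \<sigma> \<tau> by (intro continuous_intros) (auto simp: forward_solution_def)
  fix t e :: real assume t: "t \<in> {0..<b}" and e: "e > 0"
  have "\<forall>\<^sub>F h in at_right 0. dist (\<sigma> (t + h)) (X (\<sigma> t) h) \<le> e / 2 * h"
    using \<sigma>(1) t e half_gt_zero[OF e] unfolding forward_solution_def by blast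
  then show "\<forall>\<^sub>F h in at_right 0. dist (\<sigma> (t + h)) (\<tau> (t + h))
      \<le> dist (\<sigma> t) (\<tau> t) * (1 + L * h) + (\<Omega> * t + e) * h"
    using defect[OF t half_gt_zero[OF e]] eventually_small_time
  proof eventually_elim
    case (elim h)
    have "dist (X (\<sigma> t) h) (X (\<tau> t) h) \<le> dist (\<sigma> t) (\<tau> t) * (1 + \<bar>h\<bar> * L)"
      using elim t \<sigma> \<tau> by (intro E1) auto
    then have "dist (\<sigma> (t + h)) (\<tau> (t + h))
        \<le> e / 2 * h + dist (\<sigma> t) (\<tau> t) * (1 + h * L) + (\<Omega> * t + e / 2) * h"
      using elim dist_triangle[of "\<sigma> (t + h)" "\<tau> (t + h)" "X (\<sigma> t) h"]
        dist_triangle2[of "X (\<sigma> t) h" "\<tau> (t + h)" "X (\<tau> t) h"] by (simp add: dist_commute)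
    then show ?case
      by (simp add: algebra_simps)
  qed
qed (use pos \<Omega> in auto)

lemma forward_solutions_stable:
  assumes ab: "a \<le> b"
    and \<sigma>: "forward_solution X a b \<sigma>" "\<And>t. t \<in> {a..<b} \<Longrightarrow> \<sigma> t \<in> ball x0 R"
    and \<tau>: "forward_solution X a b \<tau>" "\<And>t. t \<in> {a..<b} \<Longrightarrow> \<tau> t \<in> ball x0 R"
  shows "dist (\<sigma> b) (\<tau> b) \<le> exp (L * (b - a)) * dist (\<sigma> a) (\<tau> a)"
proof -
  have "dist (\<sigma> (a + (b - a))) (\<tau> (a + (b - a)))
      \<le> exp (L * (b - a)) * (dist (\<sigma> (a + 0)) (\<tau> (a + 0)) + 0 * (b - a)\<^sup>2)"
  proof (rule forward_solutions_gronwall)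
    have shifted: "forward_solution X 0 (b - a) (\<lambda>t. \<sigma> (a + t))" "forward_solution X 0 (b - a) (\<lambda>t. \<tau> (a + t))"
      using forward_solution_shift[OF \<sigma>(1), of a] forward_solution_shift[OF \<tau>(1), of a] by simp_all
    then show "forward_solution X 0 (b - a) (\<lambda>t. \<sigma> (a + t))" "continuous_on {0..b - a} (\<lambda>t. \<tau> (a + t))"
      by (simp_all add: forward_solution_def)
    fix t e :: real assume "t \<in> {0..<b - a}" "e > 0"
    then show "\<forall>\<^sub>F h in at_right 0. dist (\<tau> (a + (t + h))) (X (\<tau> (a + t)) h) \<le> (0 * t + e) * h"
      using shifted(2) by (simp add: forward_solution_def)
  qed (use ab \<sigma> \<tau> in auto)
  then show ?thesis
    by simp
qed

lemma forward_solution_near_field: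
  assumes b: "0 \<le> b" "b < \<delta>" and \<sigma>: "forward_solution X 0 b \<sigma>" "\<And>t. t \<in> {0..<b} \<Longrightarrow> \<sigma> t \<in> ball x0 R"
    and x: "\<sigma> 0 = x" "x \<in> ball x0 R" "\<And>t. t \<in> {0..<b} \<Longrightarrow> X x t \<in> ball x0 R"
  shows "dist (\<sigma> b) (X x b) \<le> exp (L * b) * (L * b\<^sup>2)"
proof -
  have "L-lipschitz_on {0..b} (X x)"
    using speed_bound[OF x(2)] b pos by (intro lipschitz_onI) (auto simp: dist_real_def)
  then have "dist (\<sigma> b) (X x b) \<le> exp (L * b) * (dist (\<sigma> 0) (X x 0) + L * b\<^sup>2)"
  proof (intro forward_solutions_gronwall[OF b(1) \<sigma>] lipschitz_on_continuous_on)
    fix t e :: real assume t: "t \<in> {0..<b}" and e: "e > 0"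
    have "\<forall>\<^sub>F h in at_right 0. h < \<delta> - t"
      using t b by (intro eventually_at_rightI[of 0 "\<delta> - t"]) auto
    with eventually_small_time show "\<forall>\<^sub>F h in at_right 0. dist (X x (t + h)) (X (X x t) h) \<le> (L * t + e) * h"
    proof eventually_elim
      case (elim h)
      have "dist (X x (t + h)) (X (X x t) h) \<le> \<bar>t * h\<bar> * L"
        using t elim b x by (intro E2) auto
      then have "dist (X x (t + h)) (X (X x t) h) \<le> (L * t) * h"
        using t elim by (simp add: mult_ac)
      moreover have "0 \<le> e * h"
        using e elim by simp
      ultimately show ?case
        by (simp add: algebra_simps)
    qed
  qed (use x pos in auto)
  then show ?thesis
    using x field_zero by simp
qed

end

section \<open>Local flows exist for a uniform time\<close>

text \<open>
  Being a solution is a local property of a curve, so that solutions can be glued.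
\<close>
definition solves_at :: "'a::metric_space curve_family \<Rightarrow> (real \<Rightarrow> 'a) \<Rightarrow> real \<Rightarrow> bool" where
  "solves_at X \<sigma> t \<longleftrightarrow> isCont \<sigma> t \<and> ((\<lambda>h. dist (\<sigma> (t + h)) (X (\<sigma> t) h) / h) \<longlongrightarrow> 0) (at 0)"

lemma solution_curve_iff_solves_at:
  "solution_curve X \<alpha> \<beta> \<sigma> \<longleftrightarrow> (\<forall>t\<in>einterval \<alpha> \<beta>. solves_at X \<sigma> t)"
  by (auto simp: solution_curve_def solves_at_def continuous_on_eq_continuous_at)

lemma solves_at_cong:
  assumes "solves_at X \<sigma> t" and near: "\<forall>\<^sub>F s in nhds t. \<zeta> s = \<sigma> s"
  shows "solves_at X \<zeta> t"
proof -
  have "isCont \<zeta> t \<longleftrightarrow> isCont \<sigma> t"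
    using near by (rule isCont_cong)
  moreover have "((\<lambda>h. dist (\<zeta> (t + h)) (X (\<zeta> t) h) / h) \<longlongrightarrow> 0) (at 0) \<longleftrightarrow>
      ((\<lambda>h. dist (\<sigma> (t + h)) (X (\<sigma> t) h) / h) \<longlongrightarrow> 0) (at 0)"
  proof (rule tendsto_cong)
    obtain d where d: "d > 0" "\<And>s. dist s t < d \<Longrightarrow> \<zeta> s = \<sigma> s"
      using near unfolding eventually_nhds_metric by blast
    have "\<forall>\<^sub>F h in at 0. dist h 0 < d"
      using d(1) by (auto simp: eventually_at)
    then show "\<forall>\<^sub>F h in at 0. dist (\<zeta> (t + h)) (X (\<zeta> t) h) / h = dist (\<sigma> (t + h)) (X (\<sigma> t) h) / h"
    proof eventually_elim
      case (elim h)
      then show ?case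
        using d(2)[of "t + h"] d(2)[of t] d(1) by (simp add: dist_real_def)
    qed
  qed
  ultimately show ?thesis
    using assms(1) by (simp add: solves_at_def)
qed

lemma solves_at_shift:
  assumes "solves_at X \<tau> (t - B)"
  shows "solves_at X (\<lambda>t. \<tau> (t - B)) t"
proof -
  have "isCont (\<lambda>t. \<tau> (t - B)) t"
    by (rule isCont_o2[where g = \<tau>]) (use assms in \<open>auto simp: solves_at_def\<close>)
  then show ?thesis
    using assms by (simp add: solves_at_def algebra_simps)
qed

lemma reverse_reverse [simp]: "reverse (reverse X) = X"
  by (auto simp: reverse_def fun_eq_iff)

lemma solution_from_reverse:
  assumes "solution_from X x \<alpha> \<beta> \<sigma>"
  shows "solution_from (reverse X) x (- \<beta>) (- \<alpha>) (\<lambda>t. \<sigma> (- t))"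
  using assms solution_curve_reverse[of X \<alpha> \<beta> \<sigma>] einterval_uminus[of 0 \<beta> \<alpha>]
  by (auto simp: solution_from_def)

text \<open>
  Reversing time turns every statement about flows at positive times into one at negative times.
\<close>
lemma local_flow_reverse:
  assumes "local_flow X \<alpha> \<beta> F"
  shows "local_flow (reverse X) (\<lambda>x. - \<beta> x) (\<lambda>x. - \<alpha> x) (reverse F)"
  unfolding local_flow_def maximal_solution_def
proof (intro allI conjI impI)
  fix x
  have max: "maximal_solution X x (\<alpha> x) (\<beta> x) (F x)"
    using assms by (simp add: local_flow_def)
  show "solution_from (reverse X) x (- \<beta> x) (- \<alpha> x) (reverse F x)"
    using solution_from_reverse[of X x "\<alpha> x" "\<beta> x" "F x"] max
    by (simp add: maximal_solution_def reverse_def[abs_def])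
  fix \<alpha>' \<beta>' \<tau>
  assume *: "solution_from (reverse X) x \<alpha>' \<beta>' \<tau> \<and> \<alpha>' \<le> - \<beta> x \<and> - \<alpha> x \<le> \<beta>' \<and>
    (\<forall>t\<in>einterval (- \<beta> x) (- \<alpha> x). \<tau> t = reverse F x t)"
  have "solution_from X x (- \<beta>') (- \<alpha>') (\<lambda>t. \<tau> (- t))"
    using solution_from_reverse[of "reverse X" x \<alpha>' \<beta>' \<tau>] * by simp
  moreover have "- \<beta>' \<le> \<alpha> x" "\<beta> x \<le> - \<alpha>'"
    using * by (metis ereal_minus_le_minus ereal_uminus_uminus)+
  moreover have "\<forall>t\<in>einterval (\<alpha> x) (\<beta> x). \<tau> (- t) = F x t"
    using * by (auto simp: reverse_def einterval_uminus)
  ultimately have "- \<beta>' = \<alpha> x \<and> - \<alpha>' = \<beta> x"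
    using max unfolding maximal_solution_def by blast
  then show "\<alpha>' = - \<beta> x" "\<beta>' = - \<alpha> x"
    by (metis ereal_uminus_uminus)+
qed

lemma ball_diff_dist_subset:
  fixes x y :: "'a::metric_space"
  shows "ball y (R - dist x y) \<subseteq> ball x R"
proof
  fix z assume "z \<in> ball y (R - dist x y)"
  then show "z \<in> ball x R"
    using dist_triangle[of x z y] by simp
qed

context controlled_field
begin

lemma forward_solution_lipschitz_on:
  assumes sol: "forward_solution X a b \<sigma>" and room: "dist x0 (\<sigma> a) + L * (b - a) < R"
    and st: "a \<le> s" "s \<le> t" "t \<le> b"
  shows "dist (\<sigma> s) (\<sigma> t) \<le> L * (t - s)"
proof -
  have from_a: "dist (\<sigma> a) (\<sigma> u) \<le> L * (u - a)" if u: "a \<le> u" "u \<le> b" for u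
  proof (rule forward_solution_lipschitz)
    show "forward_solution X a u \<sigma>"
      using sol by (rule forward_solution_subinterval) (use u in auto)
    show "ball (\<sigma> a) (R - dist x0 (\<sigma> a)) \<subseteq> ball x0 R"
      by (rule ball_diff_dist_subset) 
    have "L * (u - a) \<le> L * (b - a)"
      using u pos by (intro mult_left_mono) auto
    then show "L * (u - a) < R - dist x0 (\<sigma> a)"
      using room by simp
  qed (use u in auto)
  show ?thesis
  proof (rule forward_solution_lipschitz)
    show "forward_solution X s t \<sigma>"
      using sol by (rule forward_solution_subinterval) (use st in auto)
    show "ball (\<sigma> s) (R - dist x0 (\<sigma> s)) \<subseteq> ball x0 R"
      by (rule ball_diff_dist_subset)
    have "dist x0 (\<sigma> s) + L * (t - s) \<le> dist x0 (\<sigma> a) + L * (s - a) + L * (b - s)"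
      using from_a[of s] st pos dist_triangle[of x0 "\<sigma> s" "\<sigma> a"]
      by (intro add_mono mult_left_mono) auto
    then show "L * (t - s) < R - dist x0 (\<sigma> s)"
      using room by (simp add: algebra_simps)
  qed (use st in auto)
qed

lemma forward_solution_in_ball:
  assumes sol: "forward_solution X a b \<sigma>" and room: "dist x0 (\<sigma> a) + L * (b - a) < R"
    and t: "t \<in> {a..b}"
  shows "\<sigma> t \<in> ball x0 R"
proof -
  have "dist (\<sigma> a) (\<sigma> t) \<le> L * (t - a)"
    using t by (intro forward_solution_lipschitz_on[OF sol room]) auto
  also have "\<dots> \<le> L * (b - a)"
    using t pos by (intro mult_left_mono) auto
  finally show ?thesis
    using room dist_triangle[of x0 "\<sigma> t" "\<sigma> a"] by simp
qed

end

locale controlled_flow = controlled_field X x0 R \<delta> L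
  for X :: "'a::metric_space curve_family" and x0 R \<delta> L +
  fixes F :: "'a curve_family" and \<alpha> \<beta> :: "'a \<Rightarrow> ereal"
  assumes flow: "local_flow X \<alpha> \<beta> F"
begin

lemma controlled_flow_reverse:
  "controlled_flow (reverse X) x0 R \<delta> L (reverse F) (\<lambda>x. - \<beta> x) (\<lambda>x. - \<alpha> x)"
  using controlled_reverse local_flow_reverse[OF flow]
  by (simp add: controlled_flow_def controlled_flow_axioms_def)

lemma flow_solution: "solution_curve X (\<alpha> x) (\<beta> x) (F x)" "\<alpha> x < 0" "0 < \<beta> x" "F x 0 = x"
  using flow by (auto simp: local_flow_def maximal_solution_def solution_from_def einterval_iff zero_ereal_def)

lemma flow_maximal:
  assumes "solution_from X x \<alpha>' \<beta>' \<tau>" "\<alpha>' \<le> \<alpha> x" "\<beta> x \<le> \<beta>'"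
    and "\<And>t. t \<in> einterval (\<alpha> x) (\<beta> x) \<Longrightarrow> \<tau> t = F x t"
  shows "\<beta>' = \<beta> x"
  using flow assms unfolding local_flow_def maximal_solution_def by blast

lemma flow_forward:
  assumes "0 \<le> a" "ereal b < \<beta> x"
  shows "forward_solution X a b (F x)"
proof (rule solution_curve_imp_forward[OF flow_solution(1)])
  show "\<alpha> x < ereal a"
    by (rule less_le_trans[OF flow_solution(2)]) (use assms in auto)
qed fact

text \<open>
  A solution whose forward interval ends before it can leave the ball is Lipschitz, hence has a
  limit at the end of its interval by completeness.
\<close>
lemma flow_limit_at_end:
  assumes B: "\<beta> x = ereal B" and room: "dist x0 x + L * B < R"
  obtains p where "dist x0 p < R" "\<And>t. 0 \<le> t \<Longrightarrow> t < B \<Longrightarrow> dist (F x t) p \<le> L * (B - t)"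
proof -
  have B0: "0 < B"
    using flow_solution(3)[of x] B by (simp add: zero_ereal_def)
  have lip: "dist (F x s) (F x t) \<le> L * (t - s)" if "0 \<le> s" "s \<le> t" "t < B" for s t
  proof (rule forward_solution_lipschitz_on)
    show "forward_solution X 0 t (F x)"
      using that B by (intro flow_forward) auto
    have "L * (t - 0) \<le> L * B"
      using that pos by (intro mult_left_mono) auto
    then show "dist x0 (F x 0) + L * (t - 0) < R"
      using room by (simp add: flow_solution(4))
  qed (use that in auto)
  define u where "u n = B - B / real (n + 2)" for n
  have u: "u n \<in> {0..<B}" for n
    using B0 by (auto simp: u_def field_simps)
  have u_lim: "u \<longlonglongrightarrow> B"
  proof -
    have "(\<lambda>n. B - B / real (n + 2)) \<longlonglongrightarrow> B - 0"
      by (intro tendsto_diff tendsto_const LIMSEQ_ignore_initial_segment lim_const_over_n)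
    then show ?thesis
      by (simp add: u_def[abs_def])
  qed
  have "L-lipschitz_on {0..<B} (F x)"
    using pos by (intro lipschitz_on_leI lip) (auto simp: dist_real_def intro: lip)
  then have "uniformly_continuous_on {0..<B} (F x)"
    by (rule lipschitz_on_uniformly_continuous)
  then have cauchy: "Cauchy (\<lambda>n. F x (u n))"
    using LIMSEQ_imp_Cauchy[OF u_lim] u by (rule uniformly_continuous_on_Cauchy)
  obtain U where U: "complete U" "ball x0 R \<subseteq> U"
    using complete_nbhd by blast
  have in_ball: "dist x0 (F x t) \<le> dist x0 x + L * B" if "t \<in> {0..<B}" for t
  proof -
    have "dist (F x 0) (F x t) \<le> L * (t - 0)"
      using that by (intro lip) auto
    also have "\<dots> \<le> L * B"
      using that pos by (intro mult_left_mono) auto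
    finally show ?thesis
      using dist_triangle[of x0 "F x t" x] by (simp add: flow_solution(4))
  qed
  have "\<forall>n. F x (u n) \<in> U"
  proof
    fix n
    show "F x (u n) \<in> U"
      using in_ball[OF u[of n]] room by (intro subsetD[OF U(2)]) simp
  qed
  then obtain p where p: "(\<lambda>n. F x (u n)) \<longlonglongrightarrow> p"
    using cauchy U(1) unfolding complete_def by meson
  show ?thesis
  proof
    have "dist x0 p \<le> dist x0 x + L * B"
    proof (rule tendsto_upperbound)
      show "(\<lambda>n. dist x0 (F x (u n))) \<longlonglongrightarrow> dist x0 p"
        by (intro tendsto_intros p)
    qed (use in_ball u in auto)
    then show "dist x0 p < R"
      using room by simp
    fix t assume t: "0 \<le> t" "t < B"
    show "dist (F x t) p \<le> L * (B - t)"
    proof (rule tendsto_le[of sequentially])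
      show "(\<lambda>n. dist (F x t) (F x (u n))) \<longlonglongrightarrow> dist (F x t) p"
        by (intro tendsto_intros p)
      show "(\<lambda>n. L * (u n - t)) \<longlonglongrightarrow> L * (B - t)"
        by (intro tendsto_intros u_lim)
      have "\<forall>\<^sub>F n in sequentially. t < u n"
        by (rule order_tendstoD(1)[OF u_lim t(2)])
      then show "\<forall>\<^sub>F n in sequentially. dist (F x t) (F x (u n)) \<le> L * (u n - t)"
      proof eventually_elim
        case (elim n)
        then show ?case
          using lip[of t "u n"] t u[of n] by auto
      qed
    qed simp
  qed
qed

text \<open>
  A solution that converges to \<open>p\<close> at time \<open>B\<close> coincides, shifted by \<open>B\<close>, with the backward
  solution from \<open>p\<close>: run backward in time from \<open>B - a\<close>, the two curves stay as close as they are
  at the start, and there their distance tends to zero with \<open>a\<close>.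
\<close>
lemma solutions_agree_before_limit:
  assumes \<sigma>: "solution_curve X \<alpha>1 (ereal B) \<sigma>" "\<alpha>1 < 0" "0 < B"
    and p: "dist x0 p < R" "\<And>t. 0 \<le> t \<Longrightarrow> t < B \<Longrightarrow> dist (\<sigma> t) p \<le> L * (B - t)"
  obtains c where "0 < c" "c < B" "\<alpha> p < - ereal c" "\<And>h. - c < h \<Longrightarrow> h < 0 \<Longrightarrow> \<sigma> (B + h) = F p h"
proof -
  interpret rev: controlled_flow "reverse X" x0 R \<delta> L "reverse F" "\<lambda>x. - \<beta> x" "\<lambda>x. - \<alpha> x"
    by (rule controlled_flow_reverse)
  obtain c0 where c0: "0 < ereal c0" "ereal c0 < - \<alpha> p"
    using ereal_dense2[of 0 "- \<alpha> p"] flow_solution(2)[of p] by auto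
  define c where "c = min c0 (min (B / 2) ((R - dist x0 p) / (2 * L)))"
  have c: "0 < c" "c < B" "c \<le> c0" "L * c < R - dist x0 p"
  proof -
    show "0 < c" "c < B" "c \<le> c0"
      using c0 \<sigma>(3) p(1) pos by (auto simp: c_def)
    have "L * c \<le> L * ((R - dist x0 p) / (2 * L))"
      using pos by (intro mult_left_mono) (auto simp: c_def)
    also have "\<dots> < R - dist x0 p"
      using pos p(1) by simp
    finally show "L * c < R - dist x0 p" .
  qed
  have c_end: "ereal c < - \<alpha> p"
    by (rule le_less_trans[OF _ c0(2)]) (use c in simp)
  have backward: "forward_solution (reverse X) 0 c (reverse F p)"
    by (rule rev.flow_forward) (use c_end in auto)
  have room: "dist x0 (reverse F p 0) + L * (c - 0) < R"
    using c by (simp add: rev.flow_solution(4))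
  have agree: "\<sigma> (B - b) = F p (- b)" if b: "0 < b" "b < c" for b
  proof -
    have est: "dist (\<sigma> (B - b)) (F p (- b)) \<le> (2 * L * exp (L * b)) * a" if a: "0 < a" "a < b" for a
    proof -
      have "forward_solution (reverse X) (a - B) (b - B) (\<lambda>t. \<sigma> (- t))"
      proof (rule solution_curve_imp_forward[OF solution_curve_reverse[OF \<sigma>(1)]])
        show "ereal (b - B) < - \<alpha>1"
          by (rule less_trans[of _ 0]) (use b c \<sigma> in \<open>auto simp: zero_ereal_def[symmetric] ereal_less_uminus_reorder\<close>)
      qed (use a in simp)
      from forward_solution_shift[OF this, of "- B"]
      have s1: "forward_solution (reverse X) a b (\<lambda>t. \<sigma> (B - t))"
        by simp
      have s2: "forward_solution (reverse X) a b (reverse F p)"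
        using backward by (rule forward_solution_subinterval) (use a b in auto)
      have "dist (\<sigma> (B - b)) (reverse F p b)
          \<le> exp (L * (b - a)) * dist (\<sigma> (B - a)) (reverse F p a)"
      proof (rule rev.forward_solutions_stable[OF _ s1 _ s2])
        fix t assume t: "t \<in> {a..<b}"
        show "reverse F p t \<in> ball x0 R"
          by (rule rev.forward_solution_in_ball[OF backward room]) (use t a b in auto)
        have "dist (\<sigma> (B - t)) p \<le> L * (B - (B - t))"
          using t a b c by (intro p) auto
        also have "\<dots> \<le> L * c"
          using t a b pos by (intro mult_left_mono) auto
        finally show "\<sigma> (B - t) \<in> ball x0 R"
          using c dist_triangle[of x0 "\<sigma> (B - t)" p] by (simp add: dist_commute)
      qed (use a in auto)
      also have "\<dots> \<le> exp (L * b) * (2 * L * a)"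
      proof (rule mult_mono)
        have "dist (\<sigma> (B - a)) p \<le> L * (B - (B - a))"
          using a b c by (intro p) auto
        moreover have "dist (reverse F p 0) (reverse F p a) \<le> L * (a - 0)"
          by (rule rev.forward_solution_lipschitz_on[OF backward room]) (use a b in auto)
        ultimately show "dist (\<sigma> (B - a)) (reverse F p a) \<le> 2 * L * a"
          using dist_triangle[of "\<sigma> (B - a)" "reverse F p a" p] by (simp add: rev.flow_solution(4))
      qed (use a pos in auto)
      finally show ?thesis
        by (simp add: reverse_def mult_ac)
    qed
    show ?thesis
    proof (rule ccontr)
      assume "\<sigma> (B - b) \<noteq> F p (- b)"
      then have d: "0 < dist (\<sigma> (B - b)) (F p (- b))"
        by simp
      define K where "K = 2 * L * exp (L * b)"
      define a where "a = min (b / 2) (dist (\<sigma> (B - b)) (F p (- b)) / (2 * K))"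
      have K: "0 < K"
        using pos by (simp add: K_def)
      have "0 < a" "a < b"
        using b d K by (auto simp: a_def)
      then have "dist (\<sigma> (B - b)) (F p (- b)) \<le> K * a"
        using est by (simp add: K_def)
      also have "\<dots> \<le> K * (dist (\<sigma> (B - b)) (F p (- b)) / (2 * K))"
        using K by (intro mult_left_mono) (auto simp: a_def)
      finally show False
        using d K by simp
    qed
  qed
  have agree': "\<sigma> (B + h) = F p h" if h: "- c < h" "h < 0" for h
    using agree[of "- h"] that by simp
  moreover have "\<alpha> p < - ereal c"
    using c_end ereal_less_uminus_reorder[of "ereal c" "\<alpha> p"] by simp
  ultimately show ?thesis
    using that c by blast
qed

text \<open>
  If the interval of existence ended at \<open>B < T\<close>, the limit \<open>p\<close> at \<open>B\<close> would have a solution of its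
  own. It agrees with the given one before \<open>B\<close> and prolongs it beyond \<open>B\<close>, against maximality.
\<close>
lemma flow_exists_forward:
  assumes room: "dist x0 x + L * T < R"
  shows "ereal T \<le> \<beta> x"
proof (rule ccontr)
  assume "\<not> ereal T \<le> \<beta> x"
  then obtain B where B: "\<beta> x = ereal B" "0 < B" "B < T"
    using flow_solution(3)[of x] by (cases "\<beta> x") auto
  have "L * B \<le> L * T"
    using B pos by (intro mult_left_mono) auto
  then have room': "dist x0 x + L * B < R"
    using room by simp
  obtain p where p: "dist x0 p < R" "\<And>t. 0 \<le> t \<Longrightarrow> t < B \<Longrightarrow> dist (F x t) p \<le> L * (B - t)"
    using flow_limit_at_end[OF B(1) room'] by blast
  obtain c where c: "0 < c" "c < B" "\<alpha> p < - ereal c" "\<And>h. - c < h \<Longrightarrow> h < 0 \<Longrightarrow> F x (B + h) = F p h"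
    using solutions_agree_before_limit[of "\<alpha> x" B "F x" p] flow_solution(1,2)[of x] B p by auto
  \<comment> \<open>The prolongation; it is a solution at \<open>B\<close> because it equals the shifted curve \<open>F p\<close> on both sides of \<open>B\<close>.\<close>
  define \<zeta> where "\<zeta> t = (if t < B then F x t else F p (t - B))" for t
  have \<zeta>_left: "\<zeta> t = F x t" if "t < B" for t
    using that by (simp add: \<zeta>_def)
  have \<zeta>_right: "\<zeta> t = F p (t - B)" if "B - c < t" for t
    using that c(4)[of "t - B"] by (simp add: \<zeta>_def)
  have "solution_curve X (\<alpha> x) (ereal B + \<beta> p) \<zeta>"
    unfolding solution_curve_iff_solves_at
  proof
    fix t assume t: "t \<in> einterval (\<alpha> x) (ereal B + \<beta> p)"
    show "solves_at X \<zeta> t"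
    proof (cases "t < B")
      case True
      then have "solves_at X (F x) t"
        using t flow_solution(1)[of x] B by (auto simp: solution_curve_iff_solves_at einterval_iff)
      moreover have "\<forall>\<^sub>F s in nhds t. s \<in> {..<B}"
        using True by (intro eventually_nhds_in_open) auto
      then have "\<forall>\<^sub>F s in nhds t. \<zeta> s = F x s"
        by eventually_elim (simp add: \<zeta>_left)
      ultimately show ?thesis
        by (rule solves_at_cong)
    next
      case False
      have "ereal (t - B) < \<beta> p"
        using t by (cases "\<beta> p") (auto simp: einterval_iff)
      moreover have "\<alpha> p < ereal (t - B)"
        by (rule less_le_trans[OF flow_solution(2)]) (use False in simp)
      ultimately have "solves_at X (F p) (t - B)"
        using flow_solution(1)[of p] by (simp add: solution_curve_iff_solves_at einterval_iff)
      then have "solves_at X (\<lambda>t. F p (t - B)) t"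
        by (rule solves_at_shift)
      moreover have "\<forall>\<^sub>F s in nhds t. s \<in> {B - c<..}"
        using False c by (intro eventually_nhds_in_open) auto
      then have "\<forall>\<^sub>F s in nhds t. \<zeta> s = F p (s - B)"
        by eventually_elim (simp add: \<zeta>_right)
      ultimately show ?thesis
        by (rule solves_at_cong)
    qed
  qed
  moreover have "\<beta> x < ereal B + \<beta> p"
    using flow_solution(3)[of p] B by (cases "\<beta> p") auto
  moreover from this have "0 < ereal B + \<beta> p"
    using flow_solution(3)[of x] by (rule less_trans[rotated])
  ultimately have "ereal B + \<beta> p = \<beta> x"
    using flow_solution(2,4)[of x] B
    by (intro flow_maximal[of x "\<alpha> x" _ \<zeta>])
       (auto simp: solution_from_def einterval_iff \<zeta>_left zero_ereal_def)
  then show False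
    using \<open>\<beta> x < ereal B + \<beta> p\<close> by simp
qed

lemma flow_forward_room:
  assumes room: "dist x0 x + L * T < R" and b: "0 \<le> b" "b < T"
  shows "forward_solution X 0 b (F x)" "dist x0 (F x 0) + L * (b - 0) < R"
proof -
  have "ereal b < ereal T"
    using b by simp
  also have "\<dots> \<le> \<beta> x"
    using room by (rule flow_exists_forward)
  finally show "forward_solution X 0 b (F x)"
    by (intro flow_forward) auto
  have "L * b \<le> L * T"
    using b pos by (intro mult_left_mono) auto
  then show "dist x0 (F x 0) + L * (b - 0) < R"
    using room by (simp add: flow_solution(4))
qed

lemma flow_lipschitz_forward:
  assumes room: "dist x0 x + L * T < R" and st: "0 \<le> s" "s \<le> t" "t < T"
  shows "dist (F x s) (F x t) \<le> L * (t - s)"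
  by (rule forward_solution_lipschitz_on[OF flow_forward_room[OF room]]) (use st in auto)

lemma flow_in_ball_forward:
  assumes room: "dist x0 x + L * T < R" and t: "0 \<le> t" "t < T"
  shows "F x t \<in> ball x0 R"
  by (rule forward_solution_in_ball[OF flow_forward_room[OF room]]) (use t in auto)

lemma flow_stable_forward:
  assumes "dist x0 x + L * T < R" "dist x0 y + L * T < R" "0 \<le> t" "t < T"
  shows "dist (F x t) (F y t) \<le> exp (L * t) * dist x y"
  using forward_solutions_stable[of 0 t "F x" "F y"] flow_forward_room(1) flow_in_ball_forward assms
  by (auto simp: flow_solution(4))

lemma flow_add_forward:
  assumes room: "dist x0 x + L * T < R" "dist x0 (F x s) + L * T < R"
    and st: "- T < s" "0 \<le> t" "t < T" "s + t < T"
  shows "F (F x s) t = F x (s + t)"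
proof -
  interpret rev: controlled_flow "reverse X" x0 R \<delta> L "reverse F" "\<lambda>x. - \<beta> x" "\<lambda>x. - \<alpha> x"
    by (rule controlled_flow_reverse)
  have "forward_solution X s (s + t) (F x)"
  proof (rule solution_curve_imp_forward[OF flow_solution(1)])
    have "ereal (s + t) < ereal T"
      using st by simp
    also have "\<dots> \<le> \<beta> x"
      using room(1) by (rule flow_exists_forward)
    finally show "ereal (s + t) < \<beta> x" .
    have "ereal (- s) < ereal T"
      using st by simp
    also have "\<dots> \<le> - \<alpha> x"
      using room(1) by (rule rev.flow_exists_forward)
    finally show "\<alpha> x < ereal s"
      using ereal_less_uminus_reorder[of "ereal (- s)" "\<alpha> x"] by simp
  qed
  from forward_solution_shift[OF this, of s]
  have shifted: "forward_solution X 0 t (\<lambda>u. F x (s + u))"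
    by simp
  have "dist (F (F x s) t) (F x (s + t)) \<le> exp (L * (t - 0)) * dist (F (F x s) 0) (F x (s + 0))"
  proof (rule forward_solutions_stable[OF _ flow_forward_room(1)[OF room(2)] _ shifted])
    fix u assume u: "u \<in> {0..<t}"
    show "F (F x s) u \<in> ball x0 R"
      using u st by (intro flow_in_ball_forward[OF room(2)]) auto
    show "F x (s + u) \<in> ball x0 R"
    proof (cases "0 \<le> s + u")
      case True
      then show ?thesis
        using u st by (intro flow_in_ball_forward[OF room(1)]) auto
    next
      case False
      then show ?thesis
        using rev.flow_in_ball_forward[OF room(1), of "- (s + u)"] u st by (simp add: reverse_def add.commute)
    qed
  qed (use st in auto)
  then show ?thesis
    by (simp add: flow_solution(4))
qed

lemma flow_near_field_forward:
  assumes room: "dist x0 x + L * T < R" and t: "0 \<le> t" "t < T" "t < \<delta>"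
  shows "dist (F x t) (X x t) \<le> exp (L * t) * (L * t\<^sup>2)"
proof (rule forward_solution_near_field)
  have x: "x \<in> ball x0 R"
    using flow_in_ball_forward[OF room, of 0] t by (simp add: flow_solution(4))
  then show "x \<in> ball x0 R" .
  show "forward_solution X 0 t (F x)"
    using flow_forward_room[OF room] t by simp
  show "F x u \<in> ball x0 R" if "u \<in> {0..<t}" for u
    using that t by (intro flow_in_ball_forward[OF room]) auto
  show "X x u \<in> ball x0 R" if u: "u \<in> {0..<t}" for u
  proof -
    have "dist (X x 0) (X x u) \<le> L * \<bar>0 - u\<bar>"
      using x u t pos by (intro speed_bound) auto
    also have "\<dots> \<le> L * T"
      using u t pos by (intro mult_left_mono) auto
    finally show ?thesis
      using room dist_triangle[of x0 "X x u" x] by (simp add: field_zero)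
  qed
qed (use t flow_solution(4) in auto)

end

text \<open>
  What the rest of the proof needs to know about a local flow. Here \<open>L\<close> bounds the speed and is the
  exponential rate at which trajectories separate.
\<close>
locale flow_box =
  fixes F :: "'a::metric_space curve_family" and x0 :: 'a and r T L :: real
  assumes box_pos: "0 < r" "0 < T" "0 < L"
    and flow_zero: "F x 0 = x"
    and flow_lipschitz: "x \<in> ball x0 r \<Longrightarrow> \<bar>s\<bar> < T \<Longrightarrow> \<bar>t\<bar> < T \<Longrightarrow> dist (F x s) (F x t) \<le> L * \<bar>s - t\<bar>"
    and flow_stable: "x \<in> ball x0 r \<Longrightarrow> y \<in> ball x0 r \<Longrightarrow> \<bar>t\<bar> < T \<Longrightarrow>
      dist (F x t) (F y t) \<le> exp (L * \<bar>t\<bar>) * dist x y"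
    and flow_add: "x \<in> ball x0 r \<Longrightarrow> F x s \<in> ball x0 r \<Longrightarrow> \<bar>s\<bar> < T \<Longrightarrow> \<bar>t\<bar> < T \<Longrightarrow> \<bar>s + t\<bar> < T \<Longrightarrow>
      F (F x s) t = F x (s + t)"

context controlled_flow
begin

context
  fixes r T assumes rT: "0 < r" "0 < T" "r + L * T \<le> R"
begin

lemma flow_has_box: "flow_box F x0 r T L"
proof -
  interpret rev: controlled_flow "reverse X" x0 R \<delta> L "reverse F" "\<lambda>x. - \<beta> x" "\<lambda>x. - \<alpha> x"
    by (rule controlled_flow_reverse)
  have room: "dist x0 x + L * T < R" if "x \<in> ball x0 r" for x
    using that rT by simp
  show ?thesis
  proof
    fix x s t assume x: "x \<in> ball x0 r" and st: "\<bar>s\<bar> < T" "\<bar>t\<bar> < T"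
    have le: "dist (F x s) (F x t) \<le> L * (t - s)" if st: "- T < s" "s \<le> t" "t < T" for s t
    proof (cases "0 \<le> s \<or> t \<le> 0")
      case True
      then show ?thesis
        using flow_lipschitz_forward[OF room[OF x], of s t] rev.flow_lipschitz_forward[OF room[OF x], of "- t" "- s"] st
        by (auto simp: reverse_def dist_commute)
    next
      case False
      then show ?thesis
        using flow_lipschitz_forward[OF room[OF x], of 0 t] rev.flow_lipschitz_forward[OF room[OF x], of 0 "- s"] st
          dist_triangle[of "F x s" "F x t" "F x 0"]
        by (auto simp: reverse_def dist_commute algebra_simps)
    qed
    show "dist (F x s) (F x t) \<le> L * \<bar>s - t\<bar>"
      using le[of s t] le[of t s] st by (cases "s \<le> t") (auto simp: dist_commute)
  next
    fix x y t assume *: "x \<in> ball x0 r" "y \<in> ball x0 r" "\<bar>t\<bar> < T"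
    then show "dist (F x t) (F y t) \<le> exp (L * \<bar>t\<bar>) * dist x y"
      using flow_stable_forward[of x T y t] rev.flow_stable_forward[of x T y "- t"] room[of x] room[of y]
      by (cases "0 \<le> t") (auto simp: reverse_def)
  next
    fix x s t assume *: "x \<in> ball x0 r" "F x s \<in> ball x0 r" "\<bar>s\<bar> < T" "\<bar>t\<bar> < T" "\<bar>s + t\<bar> < T"
    show "F (F x s) t = F x (s + t)"
    proof (cases "0 \<le> t")
      case True
      then show ?thesis
        using * room by (intro flow_add_forward[of x T]) auto
    next
      case False
      then show ?thesis
        using rev.flow_add_forward[of x T "- s" "- t"] * room[of x] room[of "F x s"]
        by (auto simp: reverse_def add.commute)
    qed
  qed (use rT pos flow_solution in auto)
qed

lemma flow_defined_on_box:
  assumes "x \<in> ball x0 r"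
  shows "\<alpha> x \<le> ereal (- T)" "ereal T \<le> \<beta> x"
proof -
  interpret rev: controlled_flow "reverse X" x0 R \<delta> L "reverse F" "\<lambda>x. - \<beta> x" "\<lambda>x. - \<alpha> x"
    by (rule controlled_flow_reverse)
  have room: "dist x0 x + L * T < R"
    using assms rT by simp
  show "ereal T \<le> \<beta> x"
    by (rule flow_exists_forward[OF room])
  show "\<alpha> x \<le> ereal (- T)"
    using rev.flow_exists_forward[OF room] ereal_minus_le_minus[of "ereal (- T)" "\<alpha> x"] by simp
qed

lemma flow_near_field:
  assumes x: "x \<in> ball x0 r" and t: "\<bar>t\<bar> < T" "\<bar>t\<bar> < \<delta>"
  shows "dist (F x t) (X x t) \<le> exp (L * \<bar>t\<bar>) * (L * t\<^sup>2)"
proof -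
  interpret rev: controlled_flow "reverse X" x0 R \<delta> L "reverse F" "\<lambda>x. - \<beta> x" "\<lambda>x. - \<alpha> x"
    by (rule controlled_flow_reverse)
  have "dist x0 x + L * T < R"
    using x rT by simp
  from flow_near_field_forward[OF this, of t] rev.flow_near_field_forward[OF this, of "- t"] t
  show ?thesis
    by (cases "0 \<le> t") (auto simp: reverse_def)
qed

end

end

section \<open>Local constants of an arc field\<close>

lemma arc_field_speed_bound:
  assumes "arc_field X"
  obtains r \<rho> where "r > 0" "\<rho> > 0"
    "\<And>x s t. x \<in> ball x0 r \<Longrightarrow> \<bar>s\<bar> \<le> 1 \<Longrightarrow> \<bar>t\<bar> \<le> 1 \<Longrightarrow> dist (X x s) (X x t) \<le> \<rho> * \<bar>s - t\<bar>"
proof -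
  have "\<forall>\<^sub>F r in at_right 0. (SUP y \<in> ball x0 r. speed X y) < \<infinity>"
    using assms by (simp add: arc_field_def)
  with eventually_at_right_less[of "0::real"]
  have "\<forall>\<^sub>F r in at_right 0. 0 < r \<and> (SUP y \<in> ball x0 r. speed X y) < \<infinity>"
    by eventually_elim simp
  then obtain r :: real where r: "0 < r" "(SUP y \<in> ball x0 r. speed X y) < \<infinity>"
    using eventually_happens'[OF trivial_limit_at_right_real] by blast
  obtain \<rho> where \<rho>: "(SUP y \<in> ball x0 r. speed X y) \<le> ereal \<rho>"
    using r(2) by (cases "SUP y \<in> ball x0 r. speed X y") auto
  show ?thesis
  proof
    fix x and s t :: real assume *: "x \<in> ball x0 r" "\<bar>s\<bar> \<le> 1" "\<bar>t\<bar> \<le> 1"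
    show "dist (X x s) (X x t) \<le> max \<rho> 1 * \<bar>s - t\<bar>"
    proof (cases "s = t")
      case False
      have "ereal (dist (X x s) (X x t) / \<bar>s - t\<bar>) \<le> speed X x"
        unfolding speed_def using * False by (intro SUP_upper2[of "(s, t)"]) auto
      also have "\<dots> \<le> (SUP y \<in> ball x0 r. speed X y)"
        using * by (intro SUP_upper) auto
      also have "\<dots> \<le> ereal \<rho>"
        by fact
      finally have "dist (X x s) (X x t) / \<bar>s - t\<bar> \<le> max \<rho> 1"
        by simp
      then show ?thesis
        using False by (simp add: divide_le_eq)
    qed simp
  qed (use r in auto)
qed

text \<open>
  The constants may be worsened freely, which allows two fields to share them.
\<close>
lemma arc_field_imp_controlled:
  fixes X :: "'a::metric_space curve_family"
  assumes complete: "locally_complete (UNIV :: 'a set)"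
    and X: "arc_field X" "cond_E1 X" "cond_E2 X"
  obtains R0 \<delta>0 L0 where "R0 > 0" "\<delta>0 > 0" "L0 > 0"
    "\<And>R \<delta> L. 0 < R \<Longrightarrow> R \<le> R0 \<Longrightarrow> 0 < \<delta> \<Longrightarrow> \<delta> \<le> \<delta>0 \<Longrightarrow> L0 \<le> L \<Longrightarrow> controlled_field X x0 R \<delta> L"
proof -
  obtain r1 \<rho> where 1: "r1 > 0" "\<rho> > 0"
    "\<And>x s t. x \<in> ball x0 r1 \<Longrightarrow> \<bar>s\<bar> \<le> 1 \<Longrightarrow> \<bar>t\<bar> \<le> 1 \<Longrightarrow> dist (X x s) (X x t) \<le> \<rho> * \<bar>s - t\<bar>"
    using arc_field_speed_bound[OF X(1)] by metis
  obtain r2 \<delta>2 \<Lambda> where 2: "r2 > 0" "\<delta>2 > 0" "\<Lambda> > 0"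
    "\<And>x y t. x \<in> ball x0 r2 \<Longrightarrow> y \<in> ball x0 r2 \<Longrightarrow> t \<in> {-\<delta>2<..<\<delta>2} \<Longrightarrow>
      dist (X x t) (X y t) \<le> dist x y * (1 + \<bar>t\<bar> * \<Lambda>)"
    using X(2) unfolding cond_E1_def by metis
  obtain r3 \<delta>3 \<Omega> where 3: "r3 > 0" "\<delta>3 > 0" "\<Omega> > 0"
    "\<And>x s t. x \<in> ball x0 r3 \<Longrightarrow> s \<in> {-\<delta>3<..<\<delta>3} \<Longrightarrow> t \<in> {-\<delta>3<..<\<delta>3} \<Longrightarrow>
      dist (X x (s + t)) (X (X x s) t) \<le> \<bar>s * t\<bar> * \<Omega>"
    using X(3) unfolding cond_E2_def by metis
  obtain U r4 where 4: "complete U" "r4 > 0" "ball x0 r4 \<subseteq> U"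
    using complete unfolding locally_complete_def by (metis UNIV_I inf_top.right_neutral)
  show ?thesis
  proof
    show "0 < min (min r1 r2) (min r3 r4)" "0 < min 1 (min \<delta>2 \<delta>3)" "0 < max \<rho> (max \<Lambda> \<Omega>)"
      using 1 2 3 4 by auto
    fix R \<delta> L assume *: "0 < R" "R \<le> min (min r1 r2) (min r3 r4)" "0 < \<delta>" "\<delta> \<le> min 1 (min \<delta>2 \<delta>3)"
      "max \<rho> (max \<Lambda> \<Omega>) \<le> L"
    show "controlled_field X x0 R \<delta> L"
    proof
      fix x s t assume **: "x \<in> ball x0 R" "\<bar>s\<bar> < \<delta>" "\<bar>t\<bar> < \<delta>"
      have "dist (X x s) (X x t) \<le> \<rho> * \<bar>s - t\<bar>"
        using * ** by (intro 1) auto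
      also have "\<dots> \<le> L * \<bar>s - t\<bar>"
        using * by (intro mult_right_mono) auto
      finally show "dist (X x s) (X x t) \<le> L * \<bar>s - t\<bar>" .
      have "dist (X x (s + t)) (X (X x s) t) \<le> \<bar>s * t\<bar> * \<Omega>"
        using * ** by (intro 3) auto
      also have "\<dots> \<le> \<bar>s * t\<bar> * L"
        using * by (intro mult_left_mono) auto
      finally show "dist (X x (s + t)) (X (X x s) t) \<le> \<bar>s * t\<bar> * L" .
    next
      fix x y t assume **: "x \<in> ball x0 R" "y \<in> ball x0 R" "\<bar>t\<bar> < \<delta>"
      have "dist (X x t) (X y t) \<le> dist x y * (1 + \<bar>t\<bar> * \<Lambda>)"
        using * ** by (intro 2) auto
      also have "\<dots> \<le> dist x y * (1 + \<bar>t\<bar> * L)"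
        using * by (intro mult_left_mono add_left_mono) auto
      finally show "dist (X x t) (X y t) \<le> dist x y * (1 + \<bar>t\<bar> * L)" .
    next
      show "\<exists>U. complete U \<and> ball x0 R \<subseteq> U"
        using 4 * by (intro exI[of _ U]) auto
    next
      show "X x 0 = x" for x
        using X(1) by (simp add: arc_field_def)
    qed (use * 1 in auto)
  qed
qed

section \<open>Two flows that nearly commute\<close>

text \<open>
  Times are restricted so that a single application of the flow moves a point by at most the unit
  \<open>u\<close> and expands distances by at most the factor 2. Twenty units fit into the box, so that points
  obtained by composing a few flows remain in it; the real index of \<open>near\<close> counts the units used.
\<close>
locale graded_flow_box = flow_box F x0 r T L for F :: "'a::metric_space curve_family" and x0 r T L +
  fixes u :: real
  assumes room: "20 * u \<le> r" "L * T \<le> u" "L * T \<le> 1 / 2"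
begin

definition near :: "real \<Rightarrow> 'a \<Rightarrow> bool" where
  "near n x \<longleftrightarrow> dist x0 x < n * u"

lemma unit_pos: "0 < u"
proof -
  have "0 < L * T"
    using box_pos by simp
  then show ?thesis
    using room by simp
qed

lemma near_mono: "near m x \<Longrightarrow> m \<le> n \<Longrightarrow> near n x"
  using mult_right_mono[OF _ less_imp_le[OF unit_pos], of m n] by (simp add: near_def)

lemma near_imp_ball: "near n x \<Longrightarrow> n \<le> 20 \<Longrightarrow> x \<in> ball x0 r"
  using near_mono[of n x 20] room by (auto simp: near_def)

lemma flow_near: "near (n - 1) x \<Longrightarrow> n \<le> 21 \<Longrightarrow> \<bar>t\<bar> < T \<Longrightarrow> near n (F x t)"
proof -
  assume *: "near (n - 1) x" "n \<le> 21" "\<bar>t\<bar> < T"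
  have "dist (F x 0) (F x t) \<le> L * \<bar>0 - t\<bar>"
    using * box_pos by (intro flow_lipschitz near_imp_ball[of "n - 1"]) auto
  also have "\<dots> \<le> L * T"
    using * box_pos by (intro mult_left_mono) auto
  also have "\<dots> \<le> u"
    by (rule room)
  finally show ?thesis
    using *(1) dist_triangle[of x0 "F x t" x] by (simp add: near_def flow_zero algebra_simps)
qed

lemma flow_time_lipschitz: "near 20 x \<Longrightarrow> \<bar>s\<bar> < T \<Longrightarrow> \<bar>t\<bar> < T \<Longrightarrow> dist (F x s) (F x t) \<le> L * \<bar>s - t\<bar>"
  by (intro flow_lipschitz near_imp_ball) auto

lemma exp_small: "\<bar>t\<bar> < T \<Longrightarrow> exp (L * \<bar>t\<bar>) \<le> 2"
proof -
  assume t: "\<bar>t\<bar> < T"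
  have "L * \<bar>t\<bar> \<le> L * T"
    using t box_pos by (intro mult_left_mono) auto
  then have "exp (L * \<bar>t\<bar>) \<le> exp (1 / 2)"
    using room by simp
  also have "\<dots> \<le> 2"
    using exp_half_le2 by simp
  finally show ?thesis .
qed

lemma flow_exp: "near 20 x \<Longrightarrow> near 20 y \<Longrightarrow> \<bar>t\<bar> < T \<Longrightarrow> dist (F x t) (F y t) \<le> exp (L * \<bar>t\<bar>) * dist x y"
  by (intro flow_stable near_imp_ball) auto

lemma flow_double: "near 20 x \<Longrightarrow> near 20 y \<Longrightarrow> \<bar>t\<bar> < T \<Longrightarrow> dist (F x t) (F y t) \<le> 2 * dist x y"
  using flow_exp[of x y t] exp_small[of t] mult_right_mono[of "exp (L * \<bar>t\<bar>)" 2 "dist x y"] by auto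

lemma flow_compose: "near 19 x \<Longrightarrow> \<bar>s\<bar> < T \<Longrightarrow> \<bar>t\<bar> < T \<Longrightarrow> \<bar>s + t\<bar> < T \<Longrightarrow> F (F x s) t = F x (s + t)"
  using near_imp_ball[of 19 x] near_imp_ball[OF flow_near[of 20 x s]] by (intro flow_add) auto

lemma flow_undo: "near 19 x \<Longrightarrow> \<bar>s\<bar> < T \<Longrightarrow> F (F x s) (- s) = x" "near 19 x \<Longrightarrow> \<bar>s\<bar> < T \<Longrightarrow> F (F x (- s)) s = x"
  using box_pos flow_compose[of x s "- s"] flow_compose[of x "- s" s] by (auto simp: flow_zero)

end

text \<open>
  The closeness of the fields passes to their flows at first only with an error quadratic in the
  larger of the two times, since a flow approximates its field up to the square of the time.
\<close>
locale flow_pair = F: graded_flow_box F x0 r T L u + G: graded_flow_box G x0 r T L u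
  for F G :: "'a::metric_space curve_family" and x0 r T L u +
  assumes commute_rough: "F.near 12 x \<Longrightarrow> \<bar>s\<bar> \<le> k \<Longrightarrow> \<bar>t\<bar> \<le> k \<Longrightarrow> k < T \<Longrightarrow>
      dist (G (F x t) s) (F (G x s) t) \<le> L * k\<^sup>2"
begin

abbreviation "near \<equiv> F.near"

lemmas near_flow = F.flow_near G.flow_near

lemma swap: "flow_pair G F x0 r T L u"
proof (intro flow_pair.intro flow_pair_axioms.intro)
  show "dist (F (G x t) s) (G (F x s) t) \<le> L * k\<^sup>2"
    if "F.near 12 x" "\<bar>s\<bar> \<le> k" "\<bar>t\<bar> \<le> k" "k < T" for x s t k
    using commute_rough[of x t k s] that by (simp add: dist_commute)
qed unfold_locales

text \<open>
  The time of \<open>G\<close> is cut into pieces no longer than that of \<open>F\<close>, and \<open>F\<close> is moved past one piece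
  after another. Each exchange costs \<open>L t\<^sup>2\<close>.
\<close>
lemma commute_multiple:
  assumes x: "near 10 x" and t: "\<bar>t\<bar> < T" "\<bar>\<sigma>\<bar> \<le> \<bar>t\<bar>"
  shows "real n * \<bar>\<sigma>\<bar> < T \<Longrightarrow> dist (G (F x t) (n * \<sigma>)) (F (G x (n * \<sigma>)) t) \<le> n * L * t\<^sup>2 * exp (L * (n * \<bar>\<sigma>\<bar>))"
proof (induction n)
  case 0
  then show ?case
    by (simp add: F.flow_zero G.flow_zero)
next
  case (Suc n)
  have n: "real n * \<bar>\<sigma>\<bar> < T" "\<bar>real n * \<sigma>\<bar> < T" "\<bar>real n * \<sigma> + \<sigma>\<bar> < T" "\<bar>\<sigma>\<bar> < T"
  proof -
    have suc: "real n * \<bar>\<sigma>\<bar> + \<bar>\<sigma>\<bar> < T"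
      using Suc.prems by (simp add: algebra_simps)
    have nn: "0 \<le> real n * \<bar>\<sigma>\<bar>" "\<bar>real n * \<sigma>\<bar> = real n * \<bar>\<sigma>\<bar>"
      by (simp_all add: abs_mult)
    show "real n * \<bar>\<sigma>\<bar> < T" "\<bar>real n * \<sigma>\<bar> < T" "\<bar>\<sigma>\<bar> < T"
      using suc nn abs_ge_zero[of \<sigma>] by linarith+
    show "\<bar>real n * \<sigma> + \<sigma>\<bar> < T"
      using suc nn abs_triangle_ineq[of "real n * \<sigma>" \<sigma>] by linarith
  qed
  let ?y = "G x (n * \<sigma>)"
  have suc: "real (Suc n) * \<sigma> = n * \<sigma> + \<sigma>"
    by (simp add: algebra_simps)
  have "G (F x t) (Suc n * \<sigma>) = G (G (F x t) (n * \<sigma>)) \<sigma>"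
    unfolding suc by (rule G.flow_compose[symmetric]) (use n t in \<open>auto intro!: near_flow F.near_mono[OF x]\<close>)
  then have "dist (G (F x t) (Suc n * \<sigma>)) (G (F ?y t) \<sigma>)
      \<le> exp (L * \<bar>\<sigma>\<bar>) * dist (G (F x t) (n * \<sigma>)) (F ?y t)"
    by (simp only:) (rule G.flow_exp, use n t in \<open>auto intro!: near_flow F.near_mono[OF x]\<close>)
  also have "\<dots> \<le> exp (L * \<bar>\<sigma>\<bar>) * (n * L * t\<^sup>2 * exp (L * (n * \<bar>\<sigma>\<bar>)))"
    by (intro mult_left_mono Suc.IH n) auto
  also have "\<dots> = n * L * t\<^sup>2 * exp (L * (Suc n * \<bar>\<sigma>\<bar>))"
    by (simp add: ring_distribs exp_add)
  finally have 1: "dist (G (F x t) (Suc n * \<sigma>)) (G (F ?y t) \<sigma>) \<le> n * L * t\<^sup>2 * exp (L * (Suc n * \<bar>\<sigma>\<bar>))" .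
  have "dist (G (F ?y t) \<sigma>) (F (G ?y \<sigma>) t) \<le> L * \<bar>t\<bar>\<^sup>2"
  proof (rule commute_rough)
    show "near 12 ?y"
      using n by (auto intro!: near_flow F.near_mono[OF x])
  qed (use t in auto)
  also have "\<dots> = L * t\<^sup>2 * 1"
    by simp
  also have "\<dots> \<le> L * t\<^sup>2 * exp (L * (Suc n * \<bar>\<sigma>\<bar>))"
    using F.box_pos by (intro mult_left_mono) auto
  finally have 2: "dist (G (F ?y t) \<sigma>) (F (G ?y \<sigma>) t) \<le> L * t\<^sup>2 * exp (L * (Suc n * \<bar>\<sigma>\<bar>))" .
  have "G ?y \<sigma> = G x (Suc n * \<sigma>)"
    unfolding suc by (rule G.flow_compose) (use n t in \<open>auto intro!: near_flow F.near_mono[OF x]\<close>)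
  then have "dist (G (F x t) (Suc n * \<sigma>)) (F (G x (Suc n * \<sigma>)) t)
      \<le> n * L * t\<^sup>2 * exp (L * (Suc n * \<bar>\<sigma>\<bar>)) + L * t\<^sup>2 * exp (L * (Suc n * \<bar>\<sigma>\<bar>))"
    using 1 2 dist_triangle[of "G (F x t) (Suc n * \<sigma>)" "F (G ?y \<sigma>) t" "G (F ?y t) \<sigma>"] by simp
  also have "\<dots> = (real n + 1) * (L * t\<^sup>2 * exp (L * (Suc n * \<bar>\<sigma>\<bar>)))"
    by (simp add: ring_distribs mult.assoc)
  finally show ?case
    by (simp add: mult.assoc add.commute)
qed

lemma commute_product_ordered:
  assumes x: "near 10 x" and st: "\<bar>s\<bar> < T" "\<bar>t\<bar> \<le> \<bar>s\<bar>"
  shows "dist (G (F x t) s) (F (G x s) t) \<le> 4 * L * \<bar>s\<bar> * \<bar>t\<bar>"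
proof (cases "t = 0")
  case True
  then show ?thesis
    by (simp add: F.flow_zero)
next
  case False
  \<comment> \<open>The least number of pieces of length at most \<open>\<bar>t\<bar>\<close>; it is at most \<open>2 \<bar>s\<bar> / \<bar>t\<bar>\<close> as \<open>\<bar>t\<bar> \<le> \<bar>s\<bar>\<close>.\<close>
  define n where "n = nat \<lceil>\<bar>s\<bar> / \<bar>t\<bar>\<rceil>"
  have q: "1 \<le> \<bar>s\<bar> / \<bar>t\<bar>"
    using False st by (simp add: field_simps)
  have n: "\<bar>s\<bar> / \<bar>t\<bar> \<le> n" "real n \<le> \<bar>s\<bar> / \<bar>t\<bar> + 1"
    unfolding n_def using q by linarith+
  have n0: "0 < real n"
    using q n by linarith
  have "dist (G (F x t) (n * (s / n))) (F (G x (n * (s / n))) t) \<le> n * L * t\<^sup>2 * exp (L * (n * \<bar>s / n\<bar>))"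
  proof (rule commute_multiple[OF x])
    show "\<bar>s / n\<bar> \<le> \<bar>t\<bar>"
      using n(1) n0 False by (simp add: field_simps)
  qed (use st n0 in auto)
  also have "\<dots> \<le> (2 * (\<bar>s\<bar> / \<bar>t\<bar>)) * L * t\<^sup>2 * 2"
    using n q n0 F.box_pos F.exp_small[OF st(1)] by (intro mult_mono) auto
  also have "\<dots> = 4 * L * \<bar>s\<bar> * \<bar>t\<bar>"
    using False by (simp add: field_simps power2_eq_square abs_mult_self_eq flip: abs_mult)
  finally show ?thesis
    using n0 by simp
qed

text \<open>
  The rough estimate improves to the product of the two times. This is what makes exchanging
  a time \<open>\<tau>\<close> with a time of order \<open>\<tau>\<^sup>2\<close> negligible at order \<open>\<tau>\<^sup>2\<close>.
\<close>
lemma commute_product: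
  assumes x: "near 10 x" and st: "\<bar>s\<bar> < T" "\<bar>t\<bar> < T"
  shows "dist (G (F x t) s) (F (G x s) t) \<le> 4 * L * \<bar>s\<bar> * \<bar>t\<bar>"
proof (cases "\<bar>t\<bar> \<le> \<bar>s\<bar>")
  case True
  then show ?thesis
    using commute_product_ordered assms by blast
next
  case False
  interpret swapped: flow_pair G F x0 r T L u
    by (rule swap)
  show ?thesis
    using swapped.commute_product_ordered[of x t s] x st False by (simp add: dist_commute mult_ac)
qed

end

context flow_pair
begin

section \<open>The commutator for all signs of the times\<close>

text \<open>
  Up to an error \<open>e\<close>, the point \<open>q\<close> arises from \<open>q'\<close> by flowing along \<open>G\<close> and \<open>F\<close> for times of size
  at most \<open>\<kappa>\<close>. Below \<open>\<kappa>\<close> is of order \<open>\<tau>\<^sup>2\<close> and \<open>e\<close> is \<open>o(\<tau>\<^sup>2)\<close>. Modulo such errors the relation is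
  symmetric and invariant under both flows at times of order \<open>\<tau>\<close>.
\<close>
definition shifted :: "real \<Rightarrow> real \<Rightarrow> 'a \<Rightarrow> 'a \<Rightarrow> bool" where
  "shifted \<kappa> e q q' \<longleftrightarrow> (\<exists>a b. \<bar>a\<bar> \<le> \<kappa> \<and> \<bar>b\<bar> \<le> \<kappa> \<and> dist q (F (G q' b) a) \<le> e)"

lemma commute_bounded:
  assumes "near 10 x" "\<bar>s\<bar> \<le> \<kappa>" "\<bar>t\<bar> \<le> \<tau>" "\<kappa> < T" "\<tau> < T"
  shows "dist (G (F x t) s) (F (G x s) t) \<le> 4 * L * \<kappa> * \<tau>"
proof -
  have "dist (G (F x t) s) (F (G x s) t) \<le> 4 * L * \<bar>s\<bar> * \<bar>t\<bar>"
    using assms by (intro commute_product) auto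
  also have "\<dots> \<le> 4 * L * \<kappa> * \<tau>"
    using assms F.box_pos by (intro mult_mono) auto
  finally show ?thesis .
qed

lemma shifted_mono: "shifted \<kappa> e q q' \<Longrightarrow> e \<le> e' \<Longrightarrow> shifted \<kappa> e' q q'"
  unfolding shifted_def by force

lemma shifted_sym:
  assumes q: "near 8 q" "near 8 q'" and \<kappa>: "\<kappa> < T" and sh: "shifted \<kappa> e q q'"
  shows "shifted \<kappa> (4 * e + 4 * L * \<kappa> * \<kappa>) q' q"
proof -
  obtain a b where ab: "\<bar>a\<bar> \<le> \<kappa>" "\<bar>b\<bar> \<le> \<kappa>" "dist q (F (G q' b) a) \<le> e"
    using sh by (auto simp: shifted_def)
  note [intro!] = near_flow F.near_mono[OF q(1)] F.near_mono[OF q(2)]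
  have T: "\<bar>a\<bar> < T" "\<bar>b\<bar> < T"
    using ab(1,2) \<kappa> by auto
  note [simp] = T ab(1,2) \<kappa>
  have "dist (F q (- a)) (F (F (G q' b) a) (- a)) \<le> 2 * dist q (F (G q' b) a)"
    by (intro F.flow_double) auto
  moreover have "F (F (G q' b) a) (- a) = G q' b"
    by (intro F.flow_undo) auto
  ultimately have 1: "dist (F q (- a)) (G q' b) \<le> 2 * e"
    using ab by simp
  have "dist (G (F q (- a)) (- b)) (G (G q' b) (- b)) \<le> 2 * dist (F q (- a)) (G q' b)"
    by (intro G.flow_double) auto
  moreover have "G (G q' b) (- b) = q'"
    by (intro G.flow_undo) auto
  ultimately have 2: "dist (G (F q (- a)) (- b)) q' \<le> 4 * e"
    using 1 by simp
  have "dist (G (F q (- a)) (- b)) (F (G q (- b)) (- a)) \<le> 4 * L * \<kappa> * \<kappa>"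
    by (intro commute_bounded) auto
  then have "dist q' (F (G q (- b)) (- a)) \<le> 4 * e + 4 * L * \<kappa> * \<kappa>"
    using 2 dist_triangle[of q' "F (G q (- b)) (- a)" "G (F q (- a)) (- b)"] by (simp add: dist_commute)
  then show ?thesis
    unfolding shifted_def using ab by (intro exI[of _ "- a"] exI[of _ "- b"]) auto
qed

lemma shifted_F:
  assumes q: "near 8 q" "near 8 q'" and \<kappa>: "\<bar>h\<bar> \<le> \<tau>" "\<tau> + \<kappa> < T" and sh: "shifted \<kappa> e q q'"
  shows "shifted \<kappa> (2 * e + 8 * L * \<kappa> * \<tau>) (F q h) (F q' h)"
proof -
  obtain a b where ab: "\<bar>a\<bar> \<le> \<kappa>" "\<bar>b\<bar> \<le> \<kappa>" "dist q (F (G q' b) a) \<le> e"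
    using sh by (auto simp: shifted_def)
  note [intro!] = near_flow F.near_mono[OF q(1)] F.near_mono[OF q(2)]
  have T: "\<bar>a\<bar> < T" "\<bar>b\<bar> < T" "\<bar>h\<bar> < T" "\<bar>a + h\<bar> < T" "\<bar>h + a\<bar> < T" "\<kappa> < T" "\<tau> < T"
    using ab(1,2) \<kappa> by auto
  note [simp] = T ab(1,2) \<kappa>(1)
  have 1: "dist (F q h) (F (F (G q' b) a) h) \<le> 2 * dist q (F (G q' b) a)"
    by (intro F.flow_double) auto
  have "F (F (G q' b) a) h = F (G q' b) (a + h)" "F (F (G q' b) h) a = F (G q' b) (h + a)"
    by (rule F.flow_compose; auto)+
  then have 2: "F (F (G q' b) a) h = F (F (G q' b) h) a"
    by (simp add: add.commute)
  have "dist (F (G (F q' h) b) a) (F (F (G q' b) h) a) \<le> 2 * dist (G (F q' h) b) (F (G q' b) h)"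
    by (intro F.flow_double) auto
  moreover have "dist (G (F q' h) b) (F (G q' b) h) \<le> 4 * L * \<kappa> * \<tau>"
    by (intro commute_bounded) auto
  ultimately have "dist (F q h) (F (G (F q' h) b) a) \<le> 2 * e + 8 * L * \<kappa> * \<tau>"
    using 1 2 ab(3) dist_triangle2[of "F q h" "F (G (F q' h) b) a" "F (F (G q' b) h) a"] by simp
  then show ?thesis
    unfolding shifted_def using ab by blast
qed

lemma shifted_G:
  assumes q: "near 8 q" "near 8 q'" and \<kappa>: "\<bar>h\<bar> \<le> \<tau>" "\<tau> + \<kappa> < T" and sh: "shifted \<kappa> e q q'"
  shows "shifted \<kappa> (2 * e + 8 * L * \<kappa> * \<tau>) (G q h) (G q' h)"
proof -
  obtain a b where ab: "\<bar>a\<bar> \<le> \<kappa>" "\<bar>b\<bar> \<le> \<kappa>" "dist q (F (G q' b) a) \<le> e"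
    using sh by (auto simp: shifted_def)
  note [intro!] = near_flow F.near_mono[OF q(1)] F.near_mono[OF q(2)]
  have T: "\<bar>a\<bar> < T" "\<bar>b\<bar> < T" "\<bar>h\<bar> < T" "\<bar>b + h\<bar> < T" "\<bar>h + b\<bar> < T" "\<kappa> < T" "\<tau> < T"
    using ab(1,2) \<kappa> by auto
  note [simp] = T ab(1,2) \<kappa>(1)
  have 1: "dist (G q h) (G (F (G q' b) a) h) \<le> 2 * dist q (F (G q' b) a)"
    by (intro G.flow_double) auto
  have "G (G q' b) h = G q' (b + h)" "G (G q' h) b = G q' (h + b)"
    by (rule G.flow_compose; auto)+
  then have 2: "G (G q' b) h = G (G q' h) b"
    by (simp add: add.commute)
  have "dist (G (F (G q' b) a) h) (F (G (G q' b) h) a) \<le> 4 * L * \<tau> * \<kappa>"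
    by (intro commute_bounded) auto
  moreover have "0 \<le> \<tau>" "0 \<le> \<kappa>"
    using ab(1) \<kappa>(1) by linarith+
  then have "0 \<le> 4 * L * \<tau> * \<kappa>"
    using F.box_pos by simp
  ultimately have "dist (G q h) (F (G (G q' h) b) a) \<le> 2 * e + 8 * L * \<kappa> * \<tau>"
    using 1 2 ab(3) dist_triangle[of "G q h" "F (G (G q' h) b) a" "G (F (G q' b) a) h"] by (simp add: algebra_simps)
  then show ?thesis
    unfolding shifted_def using ab by blast
qed

definition loop :: "'a \<Rightarrow> real \<Rightarrow> 'a" where
  "loop x \<tau> = G (F (G (F x \<tau>) \<tau>) (- \<tau>)) (- \<tau>)"

text \<open>
  The bracket only compares the flows at positive times. The corners of the nearly closed loop
  traced by the bracket realize the four combinations of signs: starting the comparison at another corner and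
  transporting the shift along one or both flows gives the statement for the other signs.
\<close>
lemma commutator_any_sign:
  assumes x: "near 3 x" and \<tau>: "0 < \<tau>" "\<kappa> \<le> \<tau>" "\<tau> + \<kappa> < T" "0 \<le> \<kappa>"
    and loop: "\<And>p. near 6 p \<Longrightarrow> shifted \<kappa> e (loop p \<tau>) p"
    and hk: "\<bar>h\<bar> = \<tau>" "\<bar>k\<bar> = \<tau>"
  shows "shifted \<kappa> (8 * e + 24 * L * \<kappa> * \<tau>) (G (F x h) k) (F (G x k) h)"
proof -
  note [intro!] = near_flow F.near_mono[OF x]
  have T: "\<tau> < T" "\<bar>\<tau>\<bar> < T" "\<kappa> < T" "\<bar>\<tau>\<bar> \<le> \<tau>" "\<bar>-\<tau>\<bar> \<le> \<tau>"
    using \<tau> by auto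
  note [simp] = T \<tau>(3) less_imp_le[OF \<tau>(1)]
  have nn: "0 \<le> e" "L * \<kappa> * \<kappa> \<le> L * \<kappa> * \<tau>" "0 \<le> L * \<kappa> * \<tau>"
  proof -
    have "shifted \<kappa> e (loop x \<tau>) x"
      by (rule loop) auto
    then obtain y where "dist (loop x \<tau>) y \<le> e"
      by (auto simp: shifted_def)
    then show "0 \<le> e"
      using zero_le_dist order_trans by blast
  qed (use \<tau> F.box_pos in \<open>auto intro!: mult_left_mono\<close>)
  consider "h = \<tau>" "k = \<tau>" | "h = \<tau>" "k = - \<tau>" | "h = - \<tau>" "k = \<tau>" | "h = - \<tau>" "k = - \<tau>"
    using hk by linarith
  then show ?thesis
  proof cases
    case 1
    have "shifted \<kappa> e (loop x \<tau>) x"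
      by (rule loop) auto
    then have "shifted \<kappa> (2 * e + 8 * L * \<kappa> * \<tau>) (G (loop x \<tau>) \<tau>) (G x \<tau>)"
      by (intro shifted_G) (auto simp: loop_def)
    then have "shifted \<kappa> (2 * (2 * e + 8 * L * \<kappa> * \<tau>) + 8 * L * \<kappa> * \<tau>) (F (G (loop x \<tau>) \<tau>) \<tau>) (F (G x \<tau>) \<tau>)"
      by (intro shifted_F) (auto simp: loop_def)
    moreover have "F (G (loop x \<tau>) \<tau>) \<tau> = G (F x \<tau>) \<tau>"
      unfolding loop_def by (subst G.flow_undo, auto, subst F.flow_undo, auto)
    ultimately show ?thesis
      using nn unfolding 1 by (auto elim!: shifted_mono)
  next
    case 2
    \<comment> \<open>The loop from \<open>p\<close> has \<open>x\<close> as its third corner.\<close>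
    define p where "p = F (G (F x \<tau>) (- \<tau>)) (- \<tau>)"
    have p: "near 6 p"
      by (auto simp: p_def)
    have Fp: "F p \<tau> = G (F x \<tau>) (- \<tau>)"
      unfolding p_def by (rule F.flow_undo) auto
    have Gp: "G (F p \<tau>) \<tau> = F x \<tau>"
      unfolding Fp by (rule G.flow_undo) auto
    have "loop p \<tau> = G x (- \<tau>)"
      unfolding loop_def Gp by (subst F.flow_undo) auto
    then have "shifted \<kappa> e (G x (- \<tau>)) p"
      using loop[OF p] by simp
    then have "shifted \<kappa> (4 * e + 4 * L * \<kappa> * \<kappa>) p (G x (- \<tau>))"
      using p by (intro shifted_sym) (auto intro: F.near_mono[OF p])
    then have "shifted \<kappa> (2 * (4 * e + 4 * L * \<kappa> * \<kappa>) + 8 * L * \<kappa> * \<tau>) (F p \<tau>) (F (G x (- \<tau>)) \<tau>)"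
      using p by (intro shifted_F) (auto intro: F.near_mono[OF p])
    then show ?thesis
      using nn unfolding 2 Fp by (auto elim!: shifted_mono)
  next
    case 3
    \<comment> \<open>The loop from \<open>p\<close> has \<open>x\<close> as its first corner.\<close>
    define p where "p = F x (- \<tau>)"
    have p: "near 6 p"
      by (auto simp: p_def)
    have Fp: "F p \<tau> = x"
      unfolding p_def by (rule F.flow_undo) auto
    have lp: "loop p \<tau> = G (F (G x \<tau>) (- \<tau>)) (- \<tau>)"
      by (simp add: loop_def Fp)
    have "shifted \<kappa> (4 * e + 4 * L * \<kappa> * \<kappa>) p (loop p \<tau>)"
      using p by (intro shifted_sym loop) (auto simp: lp intro: F.near_mono[OF p])
    then have "shifted \<kappa> (2 * (4 * e + 4 * L * \<kappa> * \<kappa>) + 8 * L * \<kappa> * \<tau>) (G p \<tau>) (G (loop p \<tau>) \<tau>)"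
      using p by (intro shifted_G) (auto simp: lp intro: F.near_mono[OF p])
    moreover have "G (loop p \<tau>) \<tau> = F (G x \<tau>) (- \<tau>)"
      unfolding lp by (rule G.flow_undo) auto
    ultimately show ?thesis
      using nn unfolding 3 p_def by (auto elim!: shifted_mono)
  next
    case 4
    \<comment> \<open>The loop from \<open>p\<close> has \<open>x\<close> as its second corner.\<close>
    define p where "p = F (G x (- \<tau>)) (- \<tau>)"
    have p: "near 6 p"
      by (auto simp: p_def)
    have Fp: "F p \<tau> = G x (- \<tau>)"
      unfolding p_def by (rule F.flow_undo) auto
    have "loop p \<tau> = G (F x (- \<tau>)) (- \<tau>)"
      unfolding loop_def Fp by (subst G.flow_undo) auto
    then have "shifted \<kappa> e (G (F x (- \<tau>)) (- \<tau>)) p"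
      using loop[OF p] by simp
    then show ?thesis
      using nn unfolding 4 p_def by (auto elim!: shifted_mono)
  qed
qed

text \<open>
  Commuting \<open>G\<close> and \<open>F\<close> at times of equal size changes both times only by a second-order amount.
  The shift between the two orders of composition is absorbed into the times by letting its parts
  commute with the flows.
\<close>
lemma commutator_step:
  assumes x: "near 3 x" and \<tau>: "0 < \<tau>" "\<kappa> \<le> \<tau>" "\<tau> + \<kappa> < T" "0 \<le> \<kappa>"
    and loop: "\<And>p. near 6 p \<Longrightarrow> shifted \<kappa> e (loop p \<tau>) p"
    and hk: "\<bar>h\<bar> = \<tau>" "\<bar>k\<bar> = \<tau>"
  shows "\<exists>a b. \<bar>a\<bar> \<le> \<kappa> \<and> \<bar>b\<bar> \<le> \<kappa> \<and>
    dist (G (F x h) k) (F (G x (k + b)) (h + a)) \<le> 8 * e + 32 * L * \<kappa> * \<tau>"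
proof -
  note [intro!] = near_flow F.near_mono[OF x]
  obtain a b where ab: "\<bar>a\<bar> \<le> \<kappa>" "\<bar>b\<bar> \<le> \<kappa>"
      "dist (G (F x h) k) (F (G (F (G x k) h) b) a) \<le> 8 * e + 24 * L * \<kappa> * \<tau>"
    using commutator_any_sign[OF assms] unfolding shifted_def by blast
  have T: "\<bar>a\<bar> < T" "\<bar>b\<bar> < T" "\<bar>h\<bar> < T" "\<bar>k\<bar> < T" "\<bar>k + b\<bar> < T" "\<bar>h + a\<bar> < T" "\<kappa> < T" "\<tau> < T"
    using ab(1,2) \<tau> hk by auto
  note [simp] = T ab(1,2) eq_refl[OF hk(1)] 
  have "dist (F (G (F (G x k) h) b) a) (F (F (G (G x k) b) h) a) \<le> 2 * dist (G (F (G x k) h) b) (F (G (G x k) b) h)"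
    by (intro F.flow_double) auto
  moreover have "dist (G (F (G x k) h) b) (F (G (G x k) b) h) \<le> 4 * L * \<kappa> * \<tau>"
    by (intro commute_bounded) auto
  moreover have "F (F (G (G x k) b) h) a = F (G (G x k) b) (h + a)" "G (G x k) b = G x (k + b)"
    by (rule F.flow_compose G.flow_compose; auto)+
  ultimately have "dist (G (F x h) k) (F (G x (k + b)) (h + a)) \<le> 8 * e + 32 * L * \<kappa> * \<tau>"
    using ab(3) dist_triangle[of "G (F x h) k" "F (G x (k + b)) (h + a)" "F (G (F (G x k) h) b) a"] by simp
  then show ?thesis
    using ab by blast
qed

end

section \<open>Pulling one flow through the other\<close>

lemma one_minus_ge_exp:
  fixes z :: real
  assumes "0 \<le> z" "z \<le> 1 / 2"
  shows "1 \<le> exp (2 * z) * (1 - z)"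
proof -
  have "0 \<le> z * (1 - 2 * z)"
    using assms by (intro mult_nonneg_nonneg) auto
  then have "1 \<le> (1 + 2 * z) * (1 - z)"
    by (simp add: algebra_simps)
  also have "\<dots> \<le> exp (2 * z) * (1 - z)"
    using assms exp_ge_add_one_self[of "2 * z"] by (intro mult_right_mono) auto
  finally show ?thesis .
qed

text \<open>
  The involutivity hypothesis in the form in which it is used. Only the size of the time corrections
  enters, so the coefficient functions are replaced by a bound \<open>K\<close>.
\<close>
locale frame = flow_pair +
  fixes K :: real
  assumes K_pos: "0 < K"
    and commutator: "\<epsilon> > 0 \<Longrightarrow> \<exists>\<tau>0>0. \<forall>x \<tau>. near 6 x \<and> 0 < \<tau> \<and> \<tau> < \<tau>0 \<longrightarrow> shifted (K * \<tau>\<^sup>2) (\<epsilon> * \<tau>\<^sup>2) (loop x \<tau>) x"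
begin

definition nearly_commutes :: "real \<Rightarrow> real \<Rightarrow> bool" where
  "nearly_commutes \<epsilon> k1 \<longleftrightarrow> (\<forall>x h k. near 3 x \<and> 0 < \<bar>k\<bar> \<and> \<bar>k\<bar> \<le> k1 \<and> \<bar>h\<bar> = \<bar>k\<bar> \<longrightarrow>
    (\<exists>a b. \<bar>a\<bar> \<le> K * k\<^sup>2 \<and> \<bar>b\<bar> \<le> K * k\<^sup>2 \<and> dist (G (F x h) k) (F (G x (k + b)) (h + a)) \<le> \<epsilon> * k\<^sup>2))"

lemma nearly_commutes_mono: "nearly_commutes \<epsilon> k1 \<Longrightarrow> k2 \<le> k1 \<Longrightarrow> nearly_commutes \<epsilon> k2"
  unfolding nearly_commutes_def by (meson order_trans)

lemma ex_nearly_commutes: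
  assumes "\<epsilon> > 0"
  shows "\<exists>k1>0. nearly_commutes \<epsilon> k1"
proof -
  obtain \<tau>0 where \<tau>0: "\<tau>0 > 0"
    "\<And>x \<tau>. near 6 x \<Longrightarrow> 0 < \<tau> \<Longrightarrow> \<tau> < \<tau>0 \<Longrightarrow> shifted (K * \<tau>\<^sup>2) (\<epsilon> / 16 * \<tau>\<^sup>2) (loop x \<tau>) x"
    using commutator[of "\<epsilon> / 16"] assms by auto
  define k1 where "k1 = Min {\<tau>0 / 2, 1 / K, T / 3, \<epsilon> / (64 * L * K)}"
  have L: "0 < L" "0 < T"
    using F.box_pos by auto
  have k1: "0 < k1" "k1 \<le> \<tau>0 / 2" "k1 \<le> 1 / K" "k1 \<le> T / 3" "k1 \<le> \<epsilon> / (64 * L * K)"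
    using \<tau>0 K_pos L assms by (auto simp: k1_def)
  have "nearly_commutes \<epsilon> k1"
    unfolding nearly_commutes_def
  proof (intro allI impI)
    fix x and h k :: real
    assume *: "near 3 x \<and> 0 < \<bar>k\<bar> \<and> \<bar>k\<bar> \<le> k1 \<and> \<bar>h\<bar> = \<bar>k\<bar>"
    define \<tau> where "\<tau> = \<bar>k\<bar>"
    have \<tau>: "0 < \<tau>" "\<tau> \<le> k1" "\<bar>h\<bar> = \<tau>" "\<bar>k\<bar> = \<tau>" "k\<^sup>2 = \<tau>\<^sup>2"
      using * by (auto simp: \<tau>_def)
    have "K * \<tau> \<le> K * (1 / K)"
      using \<tau> k1 K_pos by (intro mult_left_mono) auto
    then have "K * \<tau> \<le> 1"
      using K_pos by simp
    then have \<kappa>: "K * \<tau>\<^sup>2 \<le> \<tau>"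
      using \<tau> mult_right_mono[of "K * \<tau>" 1 \<tau>] by (simp add: power2_eq_square)
    have "\<exists>a b. \<bar>a\<bar> \<le> K * \<tau>\<^sup>2 \<and> \<bar>b\<bar> \<le> K * \<tau>\<^sup>2 \<and>
      dist (G (F x h) k) (F (G x (k + b)) (h + a)) \<le> 8 * (\<epsilon> / 16 * \<tau>\<^sup>2) + 32 * L * (K * \<tau>\<^sup>2) * \<tau>"
      by (rule commutator_step) (use * \<tau> \<kappa> k1 K_pos \<tau>0 L in auto)
    moreover have "8 * (\<epsilon> / 16 * \<tau>\<^sup>2) + 32 * L * (K * \<tau>\<^sup>2) * \<tau> \<le> \<epsilon> * \<tau>\<^sup>2"
    proof -
      have "64 * L * K * \<tau> \<le> 64 * L * K * (\<epsilon> / (64 * L * K))"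
        using \<tau> k1(5) K_pos L by (intro mult_left_mono) auto
      then have "64 * L * K * \<tau> \<le> \<epsilon>"
        using K_pos L by simp
      then have "64 * L * K * \<tau> * \<tau>\<^sup>2 \<le> \<epsilon> * \<tau>\<^sup>2"
        by (intro mult_right_mono) auto
      then show ?thesis
        by (simp add: algebra_simps)
    qed
    ultimately show "\<exists>a b. \<bar>a\<bar> \<le> K * k\<^sup>2 \<and> \<bar>b\<bar> \<le> K * k\<^sup>2 \<and>
        dist (G (F x h) k) (F (G x (k + b)) (h + a)) \<le> \<epsilon> * k\<^sup>2"
      unfolding \<tau> by (meson order_trans)
  qed
  then show ?thesis
    using k1 by blast
qed

text \<open>
  The last piece of \<open>F\<close>, shorter than the time of \<open>G\<close>, costs an error of second order in that time.
\<close>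
lemma pull_through_short:
  assumes \<epsilon>: "0 < \<epsilon>" and k1: "k1 \<le> T / 8" and y: "near 2 y" and vk: "\<bar>v\<bar> \<le> \<bar>k\<bar>" "\<bar>k\<bar> \<le> k1"
  shows "\<exists>A k'. \<bar>A\<bar> \<le> K * k1 * \<bar>v\<bar> \<and> \<bar>k'\<bar> \<le> k1 \<and>
      dist (G (F y v) k) (F (G y k') (v + A)) \<le> exp (2 * L * \<bar>v\<bar>) * (\<epsilon> * k1 * \<bar>v\<bar> + 4 * L * k1\<^sup>2)"
proof (intro exI conjI)
  note pos = F.box_pos K_pos
  have k1': "0 \<le> k1" "k1 < T"
    using vk k1 pos by auto
  show "\<bar>0\<bar> \<le> K * k1 * \<bar>v\<bar>" "\<bar>k\<bar> \<le> k1"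
    using vk pos k1' by auto
  have "dist (G (F y v) k) (F (G y k) v) \<le> 4 * L * k1 * k1"
    using vk k1' by (intro commute_bounded F.near_mono[OF y]) auto
  also have "\<dots> = 1 * (0 + 4 * L * k1\<^sup>2)"
    by (simp add: power2_eq_square)
  also have "\<dots> \<le> exp (2 * L * \<bar>v\<bar>) * (\<epsilon> * k1 * \<bar>v\<bar> + 4 * L * k1\<^sup>2)"
    using pos \<epsilon> k1' by (intro mult_mono add_right_mono) auto
  finally show "dist (G (F y v) k) (F (G y k) (v + 0)) \<le> exp (2 * L * \<bar>v\<bar>) * (\<epsilon> * k1 * \<bar>v\<bar> + 4 * L * k1\<^sup>2)"
    by simp
qed

lemma abs_le_exp_bound:
  assumes "\<bar>k\<bar> * exp (K * \<bar>v\<bar>) \<le> k1"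
  shows "\<bar>k\<bar> \<le> k1"
proof -
  have "\<bar>k\<bar> * 1 \<le> \<bar>k\<bar> * exp (K * \<bar>v\<bar>)"
    using K_pos by (intro mult_left_mono) auto
  then show ?thesis
    using assms by simp
qed

text \<open>
  The flow \<open>F\<close> is cut into steps, and \<open>G\<close> is moved through one step after another. The commutation
  estimate requires the two times to be of equal size, whereas the time of \<open>G\<close> changes at each step,
  so the step length always equals the current \<open>G\<close>-time. The factors \<open>exp (K \<bar>v\<bar>)\<close> and
  \<open>exp (- 2 K \<bar>v\<bar>)\<close>, with the remaining time \<open>v\<close> of \<open>F\<close>, keep the \<open>G\<close>-time below \<open>k1\<close> and above \<open>m\<close> in the
  course of the process; the lower bound ensures that finitely many steps suffice. A step of length \<open>\<bar>k\<bar>\<close>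
  contributes the error \<open>\<epsilon> k\<^sup>2\<close>, so that the errors add up to a multiple of \<open>\<epsilon> k1 \<bar>v\<bar>\<close>.
\<close>
lemma pull_through_induct:
  assumes step: "nearly_commutes \<epsilon> k1" and \<epsilon>: "0 < \<epsilon>" and k1: "K * k1 \<le> 1 / 2" "k1 \<le> T / 8"
    and m: "0 < m" and y: "near 2 y"
  shows "\<bar>v\<bar> \<le> real n * m \<Longrightarrow> \<bar>v\<bar> < T / 2 \<Longrightarrow> m \<le> \<bar>k\<bar> * exp (- (2 * K * \<bar>v\<bar>)) \<Longrightarrow> \<bar>k\<bar> * exp (K * \<bar>v\<bar>) \<le> k1 \<Longrightarrow>
    \<exists>A k'. \<bar>A\<bar> \<le> K * k1 * \<bar>v\<bar> \<and> \<bar>k'\<bar> \<le> k1 \<and>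
      dist (G (F y v) k) (F (G y k') (v + A)) \<le> exp (2 * L * \<bar>v\<bar>) * (\<epsilon> * k1 * \<bar>v\<bar> + 4 * L * k1\<^sup>2)"
proof (induction n arbitrary: v k)
  case 0
  then show ?case
    using abs_le_exp_bound[of k v] by (intro pull_through_short[OF \<epsilon> k1(2) y]) auto
next
  case (Suc n)
  note pos = F.box_pos K_pos
  show ?case
  proof (cases "\<bar>v\<bar> \<le> \<bar>k\<bar>")
    case True
    then show ?thesis
      using abs_le_exp_bound[of k v] Suc.prems by (intro pull_through_short[OF \<epsilon> k1(2) y]) auto
  next
    case False
    have k: "\<bar>k\<bar> \<le> k1" "m \<le> \<bar>k\<bar>" "0 < \<bar>k\<bar>"
    proof -
      show "\<bar>k\<bar> \<le> k1"
        using abs_le_exp_bound Suc.prems by blast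
      have "\<bar>k\<bar> * exp (- (2 * K * \<bar>v\<bar>)) \<le> \<bar>k\<bar> * 1"
        using pos by (intro mult_left_mono) auto
      then show "m \<le> \<bar>k\<bar>" "0 < \<bar>k\<bar>"
        using Suc.prems(3) m by auto
    qed
    \<comment> \<open>The next step of \<open>F\<close> has the length of the current time of \<open>G\<close> and the direction of \<open>v\<close>.\<close>
    define h where "h = sgn v * \<bar>k\<bar>"
    have h: "\<bar>h\<bar> = \<bar>k\<bar>" "\<bar>v - h\<bar> = \<bar>v\<bar> - \<bar>k\<bar>"
      using False k by (auto simp: h_def sgn_if abs_mult)
    have small: "\<bar>h\<bar> < T" "\<bar>v - h\<bar> < T" "\<bar>v\<bar> < T" "\<bar>v - h\<bar> < T / 2"
      unfolding h using k Suc.prems(2) k1(2) pos(2) by auto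
    let ?x = "F y (v - h)"
    have x: "near 3 ?x"
      using y small by (intro near_flow) auto
    obtain a b where ab: "\<bar>a\<bar> \<le> K * k\<^sup>2" "\<bar>b\<bar> \<le> K * k\<^sup>2"
      "dist (G (F ?x h) k) (F (G ?x (k + b)) (h + a)) \<le> \<epsilon> * k\<^sup>2"
      using step[unfolded nearly_commutes_def, rule_format, of ?x k h] x k h by auto
    have Fx: "F ?x h = F y v"
      using F.flow_compose[of y "v - h" h] F.near_mono[OF y, of 19] small by simp
    define z where "z = K * \<bar>k\<bar>"
    have z: "0 \<le> z" "z \<le> 1 / 2" "K * k\<^sup>2 = \<bar>k\<bar> * z"
    proof -
      have "z \<le> K * k1"
        using k pos by (auto simp: z_def intro!: mult_left_mono)
      then show "z \<le> 1 / 2"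
        using k1 by simp
      show "K * k\<^sup>2 = \<bar>k\<bar> * z"
        by (simp add: z_def power2_eq_square flip: abs_mult)
    qed (use pos in \<open>auto simp: z_def\<close>)
    have upper: "\<bar>k + b\<bar> \<le> \<bar>k\<bar> * exp z"
    proof -
      have "\<bar>k + b\<bar> \<le> \<bar>k\<bar> * (1 + z)"
        using ab(2) z(3) abs_triangle_ineq[of k b] by (simp add: algebra_simps)
      also have "\<dots> \<le> \<bar>k\<bar> * exp z"
        by (intro mult_left_mono) auto
      finally show ?thesis .
    qed
    have lower: "\<bar>k\<bar> \<le> \<bar>k + b\<bar> * exp (2 * z)"
    proof -
      have "\<bar>k\<bar> * 1 \<le> \<bar>k\<bar> * (exp (2 * z) * (1 - z))"
        using one_minus_ge_exp[OF z(1,2)] by (intro mult_left_mono) auto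
      also have "\<dots> = (\<bar>k\<bar> * (1 - z)) * exp (2 * z)"
        by simp
      also have "\<dots> \<le> \<bar>k + b\<bar> * exp (2 * z)"
        using ab(2) z(3) by (intro mult_right_mono) (auto simp: algebra_simps)
      finally show ?thesis
        by simp
    qed
    have split: "K * \<bar>v\<bar> = z + K * \<bar>v - h\<bar>" "K * k1 * \<bar>v\<bar> = K * k1 * \<bar>k\<bar> + K * k1 * \<bar>v - h\<bar>"
      by (simp_all add: h z_def algebra_simps)
    have "\<exists>A k'. \<bar>A\<bar> \<le> K * k1 * \<bar>v - h\<bar> \<and> \<bar>k'\<bar> \<le> k1 \<and>
      dist (G ?x (k + b)) (F (G y k') (v - h + A)) \<le> exp (2 * L * \<bar>v - h\<bar>) * (\<epsilon> * k1 * \<bar>v - h\<bar> + 4 * L * k1\<^sup>2)"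
    proof (rule Suc.IH)
      show "\<bar>v - h\<bar> \<le> real n * m"
        using Suc.prems(1) k h by (simp add: algebra_simps)
      show "\<bar>v - h\<bar> < T / 2"
        by fact
      have "m \<le> \<bar>k\<bar> * exp (- (2 * K * \<bar>v\<bar>))"
        by fact
      also have "\<dots> \<le> (\<bar>k + b\<bar> * exp (2 * z)) * exp (- (2 * K * \<bar>v\<bar>))"
        using lower by (intro mult_right_mono) auto
      also have "\<dots> = \<bar>k + b\<bar> * exp (2 * z - 2 * K * \<bar>v\<bar>)"
        by (simp add: exp_diff exp_minus field_simps)
      also have "2 * z - 2 * K * \<bar>v\<bar> = - (2 * K * \<bar>v - h\<bar>)"
        using split(1) by simp
      finally show "m \<le> \<bar>k + b\<bar> * exp (- (2 * K * \<bar>v - h\<bar>))" .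
      have "\<bar>k + b\<bar> * exp (K * \<bar>v - h\<bar>) \<le> (\<bar>k\<bar> * exp z) * exp (K * \<bar>v - h\<bar>)"
        using upper by (intro mult_right_mono) auto
      also have "\<dots> = \<bar>k\<bar> * exp (K * \<bar>v\<bar>)"
        by (simp add: split exp_add)
      finally show "\<bar>k + b\<bar> * exp (K * \<bar>v - h\<bar>) \<le> k1"
        using Suc.prems(4) by simp
    qed
    then obtain A k' where IH: "\<bar>A\<bar> \<le> K * k1 * \<bar>v - h\<bar>" "\<bar>k'\<bar> \<le> k1"
      "dist (G ?x (k + b)) (F (G y k') (v - h + A)) \<le> exp (2 * L * \<bar>v - h\<bar>) * (\<epsilon> * k1 * \<bar>v - h\<bar> + 4 * L * k1\<^sup>2)"
      by blast
    have a_le: "\<bar>a\<bar> \<le> K * k1 * \<bar>k\<bar>" "\<bar>a\<bar> \<le> \<bar>k\<bar> / 2" "\<bar>b\<bar> \<le> \<bar>k\<bar> / 2"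
    proof -
      have "K * \<bar>k\<bar> * \<bar>k\<bar> \<le> K * k1 * \<bar>k\<bar>"
        using k pos by (intro mult_right_mono mult_left_mono) auto
      then show "\<bar>a\<bar> \<le> K * k1 * \<bar>k\<bar>"
        using ab(1) by (simp add: power2_eq_square mult.assoc flip: abs_mult)
      have "\<bar>k\<bar> * z \<le> \<bar>k\<bar> * (1 / 2)"
        using z by (intro mult_left_mono) auto
      then show "\<bar>a\<bar> \<le> \<bar>k\<bar> / 2" "\<bar>b\<bar> \<le> \<bar>k\<bar> / 2"
        using ab z(3) by auto
    qed
    have A_le: "\<bar>A\<bar> \<le> T / 4"
    proof -
      have "K * k1 * \<bar>v - h\<bar> \<le> 1 / 2 * (T / 2)"
        using k1(1) small pos by (intro mult_mono) auto
      then show ?thesis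
        using IH(1) by simp
    qed
    have k_small: "2 * \<bar>k\<bar> \<le> T / 4" "0 < T"
      using k(1) k1(2) pos by auto
    have T1: "\<bar>h + a\<bar> \<le> 2 * \<bar>k\<bar>"
      using abs_triangle_ineq[of h a] h(1) a_le(2) by linarith
    have T2: "\<bar>h + a\<bar> < T"
      using T1 k_small by linarith
    have T3: "\<bar>v - h + A\<bar> < 3 / 4 * T"
      using abs_triangle_ineq[of "v - h" A] small(4) A_le by linarith
    have T4: "\<bar>v - h + A + (h + a)\<bar> < T"
      using abs_triangle_ineq[of "v - h + A" "h + a"] T1 T3 k_small by linarith
    have T5: "\<bar>v - h + A\<bar> < T"
      using T3 k_small by linarith
    have T6: "\<bar>k'\<bar> < T"
      using IH(2) k1(2) k_small by linarith
    have T7: "\<bar>k + b\<bar> < T"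
      using abs_triangle_ineq[of k b] a_le(3) k_small by linarith
    note [simp] = T2 T5 T6 T7 small(2)
    have near: "near 20 (G ?x (k + b))" "near 20 (F (G y k') (v - h + A))" "near 19 (G y k')"
      by (auto intro!: near_flow F.near_mono[OF y])
    have "dist (F (G ?x (k + b)) (h + a)) (F (F (G y k') (v - h + A)) (h + a))
        \<le> exp (L * \<bar>h + a\<bar>) * dist (G ?x (k + b)) (F (G y k') (v - h + A))"
      by (rule F.flow_exp[OF near(1,2) T2])
    also have "\<dots> \<le> exp (2 * L * \<bar>k\<bar>) * (exp (2 * L * \<bar>v - h\<bar>) * (\<epsilon> * k1 * \<bar>v - h\<bar> + 4 * L * k1\<^sup>2))"
      using T1 pos \<epsilon> k by (intro mult_mono IH) auto
    also have "\<dots> = exp (2 * L * \<bar>v\<bar>) * (\<epsilon> * k1 * \<bar>v - h\<bar> + 4 * L * k1\<^sup>2)"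
    proof -
      have "2 * L * \<bar>v\<bar> = 2 * L * \<bar>k\<bar> + 2 * L * \<bar>v - h\<bar>"
        by (simp add: h algebra_simps)
      then show ?thesis
        by (simp add: exp_add)
    qed
    also have "F (F (G y k') (v - h + A)) (h + a) = F (G y k') (v + (A + a))"
      using F.flow_compose[OF near(3) T5 T2 T4] by (simp add: algebra_simps)
    finally have 1: "dist (F (G ?x (k + b)) (h + a)) (F (G y k') (v + (A + a)))
        \<le> exp (2 * L * \<bar>v\<bar>) * (\<epsilon> * k1 * \<bar>v - h\<bar> + 4 * L * k1\<^sup>2)" .
    have "\<epsilon> * k\<^sup>2 = 1 * (\<epsilon> * \<bar>k\<bar> * \<bar>k\<bar>)"
      by (simp add: power2_eq_square mult.assoc flip: abs_mult)
    also have "\<dots> \<le> exp (2 * L * \<bar>v\<bar>) * (\<epsilon> * k1 * \<bar>k\<bar>)"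
      using k \<epsilon> pos by (intro mult_mono) auto
    finally have 2: "\<epsilon> * k\<^sup>2 \<le> exp (2 * L * \<bar>v\<bar>) * (\<epsilon> * k1 * \<bar>k\<bar>)" .
    have "dist (G (F y v) k) (F (G y k') (v + (A + a)))
        \<le> exp (2 * L * \<bar>v\<bar>) * (\<epsilon> * k1 * \<bar>k\<bar>) + exp (2 * L * \<bar>v\<bar>) * (\<epsilon> * k1 * \<bar>v - h\<bar> + 4 * L * k1\<^sup>2)"
      using 1 2 ab(3) Fx dist_triangle[of "G (F y v) k" "F (G y k') (v + (A + a))" "F (G ?x (k + b)) (h + a)"]
      by simp
    also have "\<dots> = exp (2 * L * \<bar>v\<bar>) * (\<epsilon> * k1 * \<bar>v\<bar> + 4 * L * k1\<^sup>2)"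
      by (simp add: h algebra_simps)
    finally have "dist (G (F y v) k) (F (G y k') (v + (A + a)))
        \<le> exp (2 * L * \<bar>v\<bar>) * (\<epsilon> * k1 * \<bar>v\<bar> + 4 * L * k1\<^sup>2)" .
    moreover have "\<bar>A + a\<bar> \<le> K * k1 * \<bar>v\<bar>"
      using IH(1) a_le(1) split(2) abs_triangle_ineq[of A a] by linarith
    ultimately show ?thesis
      using IH(2) by blast
  qed
qed

text \<open>
  The pull-back of \<open>G\<close> along \<open>F\<close> is, infinitesimally, a bounded combination of \<open>F\<close> and \<open>G\<close>: moving \<open>G\<close>
  through \<open>F\<close> corrects the time of \<open>F\<close> by \<open>O(k)\<close> and turns the time \<open>k\<close> of \<open>G\<close> into another time of
  order \<open>k\<close>, up to an error \<open>o(k)\<close> uniform in the base point.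
\<close>
lemma pull_through:
  "\<exists>C>0. \<forall>\<epsilon>>0. \<exists>k0>0. \<forall>y v k. near 2 y \<and> \<bar>v\<bar> < T / 2 \<and> \<bar>k\<bar> < k0 \<longrightarrow>
    (\<exists>A k'. \<bar>A\<bar> \<le> C * \<bar>k\<bar> \<and> \<bar>k'\<bar> \<le> C * \<bar>k\<bar> \<and> dist (G (F y v) k) (F (G y k') (v + A)) \<le> \<epsilon> * \<bar>k\<bar>)"
proof -
  note pos = F.box_pos K_pos
  define E where "E = exp (K * T)"
  have E: "1 \<le> E"
    using pos by (simp add: E_def)
  define C where "C = E * (1 + K * T)"
  have C: "0 < C" "E \<le> C" "K * E * T \<le> C"
    using E pos by (auto simp: C_def algebra_simps add_pos_nonneg)
  have "\<exists>k0>0. \<forall>y v k. near 2 y \<and> \<bar>v\<bar> < T / 2 \<and> \<bar>k\<bar> < k0 \<longrightarrow>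
    (\<exists>A k'. \<bar>A\<bar> \<le> C * \<bar>k\<bar> \<and> \<bar>k'\<bar> \<le> C * \<bar>k\<bar> \<and> dist (G (F y v) k) (F (G y k') (v + A)) \<le> \<epsilon> * \<bar>k\<bar>)"
    if \<epsilon>: "0 < \<epsilon>" for \<epsilon>
  proof -
    define \<epsilon>' where "\<epsilon>' = \<epsilon> / (6 * E * T)"
    have \<epsilon>': "0 < \<epsilon>'" "\<epsilon>' * E * T = \<epsilon> / 6"
      using \<epsilon> E pos by (auto simp: \<epsilon>'_def)
    obtain \<kappa> where \<kappa>: "0 < \<kappa>" "nearly_commutes \<epsilon>' \<kappa>"
      using ex_nearly_commutes[OF \<epsilon>'(1)] by blast
    define \<kappa>' where "\<kappa>' = Min {\<kappa>, 1 / (2 * K), T / 8, \<epsilon> / (24 * L * E)}"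
    have \<kappa>': "0 < \<kappa>'" "\<kappa>' \<le> \<kappa>" "\<kappa>' \<le> 1 / (2 * K)" "\<kappa>' \<le> T / 8" "\<kappa>' \<le> \<epsilon> / (24 * L * E)"
      using \<kappa> \<epsilon> E pos by (auto simp: \<kappa>'_def)
    show ?thesis
    proof (rule exI[of _ "\<kappa>' / E"], intro conjI allI impI)
      show "0 < \<kappa>' / E"
        using \<kappa>' E by simp
      fix y v k assume *: "near 2 y \<and> \<bar>v\<bar> < T / 2 \<and> \<bar>k\<bar> < \<kappa>' / E"
      show "\<exists>A k'. \<bar>A\<bar> \<le> C * \<bar>k\<bar> \<and> \<bar>k'\<bar> \<le> C * \<bar>k\<bar> \<and> dist (G (F y v) k) (F (G y k') (v + A)) \<le> \<epsilon> * \<bar>k\<bar>"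
      proof (cases "k = 0")
        case True
        then show ?thesis
          by (intro exI[of _ 0]) (simp add: G.flow_zero)
      next
        case False
        define k1 where "k1 = \<bar>k\<bar> * E"
        define m where "m = \<bar>k\<bar> * exp (- (2 * K * \<bar>v\<bar>))"
        have k1: "0 < k1" "k1 \<le> \<kappa>'" "0 < m"
          using False E * by (auto simp: k1_def m_def field_simps)
        obtain n :: nat where n: "\<bar>v\<bar> / m \<le> real n"
          using real_arch_simple by blast
        have v: "\<bar>v\<bar> \<le> T" "\<bar>v\<bar> < T"
          using * pos by linarith+
        have "\<exists>A k'. \<bar>A\<bar> \<le> K * k1 * \<bar>v\<bar> \<and> \<bar>k'\<bar> \<le> k1 \<and>
            dist (G (F y v) k) (F (G y k') (v + A)) \<le> exp (2 * L * \<bar>v\<bar>) * (\<epsilon>' * k1 * \<bar>v\<bar> + 4 * L * k1\<^sup>2)"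
        proof (rule pull_through_induct)
          show "nearly_commutes \<epsilon>' k1"
            using \<kappa>(2) by (rule nearly_commutes_mono) (use k1 \<kappa>' in auto)
          have "K * k1 \<le> K * (1 / (2 * K))"
            using k1 \<kappa>' pos by (intro mult_left_mono) auto
          then show "K * k1 \<le> 1 / 2"
            using pos by simp
          show "\<bar>v\<bar> \<le> real n * m"
            using n k1 by (simp add: field_simps)
          show "\<bar>k\<bar> * exp (K * \<bar>v\<bar>) \<le> k1"
            unfolding k1_def E_def using v pos by (intro mult_left_mono) auto
          show "m \<le> \<bar>k\<bar> * exp (- (2 * K * \<bar>v\<bar>))"
            by (simp add: m_def)
        qed (use * k1 \<kappa>' \<epsilon>' in auto)
        then obtain A k' where A: "\<bar>A\<bar> \<le> K * k1 * \<bar>v\<bar>" "\<bar>k'\<bar> \<le> k1"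
            "dist (G (F y v) k) (F (G y k') (v + A)) \<le> exp (2 * L * \<bar>v\<bar>) * (\<epsilon>' * k1 * \<bar>v\<bar> + 4 * L * k1\<^sup>2)"
          by blast
        have "exp (2 * L * \<bar>v\<bar>) \<le> 3"
        proof -
          have "2 * L * \<bar>v\<bar> \<le> 2 * (L * T)"
            using v pos by simp
          also have "\<dots> \<le> 1"
            using F.room by simp
          finally have "exp (2 * L * \<bar>v\<bar>) \<le> exp 1"
            by simp
          then show ?thesis
            using exp_le by (rule order_trans)
        qed
        moreover have "\<epsilon>' * k1 * \<bar>v\<bar> \<le> \<epsilon> / 6 * \<bar>k\<bar>"
        proof -
          have "\<epsilon>' * k1 * \<bar>v\<bar> \<le> \<epsilon>' * k1 * T"
            using v \<epsilon>' k1 by (intro mult_left_mono) auto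
          also have "\<dots> = \<epsilon>' * E * T * \<bar>k\<bar>"
            by (simp add: k1_def)
          finally show ?thesis
            by (simp add: \<epsilon>')
        qed
        moreover have "4 * L * k1\<^sup>2 \<le> \<epsilon> / 6 * \<bar>k\<bar>"
        proof -
          have "4 * L * k1\<^sup>2 = 4 * L * E * k1 * \<bar>k\<bar>"
            by (simp add: k1_def power2_eq_square)
          also have "\<dots> \<le> 4 * L * E * (\<epsilon> / (24 * L * E)) * \<bar>k\<bar>"
            using k1 \<kappa>' E pos by (intro mult_right_mono mult_left_mono) auto
          also have "\<dots> = \<epsilon> / 6 * \<bar>k\<bar>"
            using E pos by simp
          finally show ?thesis .
        qed
        ultimately have "exp (2 * L * \<bar>v\<bar>) * (\<epsilon>' * k1 * \<bar>v\<bar> + 4 * L * k1\<^sup>2) \<le> 3 * (\<epsilon> / 3 * \<bar>k\<bar>)"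
        proof (intro mult_mono)
          show "0 \<le> \<epsilon>' * k1 * \<bar>v\<bar> + 4 * L * k1\<^sup>2"
            using \<epsilon>'(1) k1 pos by simp
        qed auto
        then have "dist (G (F y v) k) (F (G y k') (v + A)) \<le> \<epsilon> * \<bar>k\<bar>"
          using A(3) by simp
        moreover have "\<bar>k'\<bar> \<le> C * \<bar>k\<bar>"
          using A(2) mult_right_mono[OF C(2), of "\<bar>k\<bar>"] by (simp add: k1_def mult.commute)
        moreover have "\<bar>A\<bar> \<le> C * \<bar>k\<bar>"
        proof -
          have "K * k1 * \<bar>v\<bar> \<le> K * k1 * T"
            using v pos k1 by (intro mult_left_mono) auto
          also have "\<dots> = K * E * T * \<bar>k\<bar>"
            by (simp add: k1_def)
          also have "\<dots> \<le> C * \<bar>k\<bar>"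
            using C by (intro mult_right_mono) auto
          finally show ?thesis
            using A(1) by simp
        qed
        ultimately show ?thesis
          by blast
      qed
    qed
  qed
  then show ?thesis
    using C(1) by blast
qed

end

section \<open>Surfaces from charts\<close>

lemma second_countable_euclidean:
  "second_countable (euclidean :: 'b::second_countable_topology topology)"
proof -
  obtain \<B> :: "'b set set" where \<B>: "countable \<B>" "\<And>C. C \<in> \<B> \<Longrightarrow> open C"
    "\<And>S. open S \<Longrightarrow> \<exists>U. U \<subseteq> \<B> \<and> S = \<Union>U"
    using univ_second_countable[where ?'a = 'b] by blast
  have "\<exists>V\<in>\<B>. x \<in> V \<and> V \<subseteq> U" if "open U" "x \<in> U" for U and x :: 'b
    using \<B>(3)[OF that(1)] that(2) by blast
  then show ?thesis
    using \<B> by (auto simp: second_countable_def)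
qed

lemma surface_homeomorphic_image:
  fixes S :: "'a::metric_space set" and V :: "(real^2) set"
  assumes hom: "homeomorphism V S f g" and V: "open V"
  shows "surface S"
  unfolding surface_def
proof (intro conjI ballI)
  show "Hausdorff_space (top_of_set S)"
    by (simp add: Hausdorff_space_subtopology Hausdorff_space_euclidean)
  show "second_countable (top_of_set S)"
  proof (rule second_countable_open_map_image)
    show "continuous_map (top_of_set V) (top_of_set S) f"
      using hom by (auto simp: homeomorphism_def)
    show "open_map (top_of_set V) (top_of_set S) f"
      unfolding open_map_def using homeomorphism_imp_open_map[OF hom] by blast
    show "f ` topspace (top_of_set V) = topspace (top_of_set S)"
      using hom by (simp add: homeomorphism_def)
    show "second_countable (top_of_set V)"
      by (intro second_countable_subtopology second_countable_euclidean)
  qed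
  fix p assume "p \<in> S"
  moreover have "S homeomorphic V"
    using hom by (meson homeomorphic_def homeomorphic_sym)
  ultimately show "\<exists>U. \<exists>V :: (real^2) set. openin (top_of_set S) U \<and> p \<in> U \<and> open V \<and> U homeomorphic V"
    using V by (intro exI[of _ S] exI[of _ V]) auto
qed

section \<open>The fields next to their flows\<close>

text \<open>
  The fields themselves enter only through their second-order contact with the flows.
\<close>
locale field_pair = flow_pair F G x0 r T L u for F G :: "'a::metric_space curve_family" and x0 r T L u +
  fixes X Y :: "'a curve_family"
  assumes T_small: "T \<le> 1 / 2"
    and near_X: "near 20 x \<Longrightarrow> \<bar>t\<bar> < T \<Longrightarrow> dist (F x t) (X x t) \<le> 2 * L * t\<^sup>2"
    and near_Y: "near 20 x \<Longrightarrow> \<bar>t\<bar> < T \<Longrightarrow> dist (G x t) (Y x t) \<le> 2 * L * t\<^sup>2"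
begin

lemma near_X_step:
  assumes x: "near 18 x" and t: "\<bar>t\<bar> < T"
  shows "near 20 (X x t)"
proof -
  have "dist (F x t) (X x t) \<le> 2 * L * t\<^sup>2"
    using x t by (intro near_X) (auto intro: F.near_mono)
  also have "\<dots> = 2 * (L * \<bar>t\<bar>) * \<bar>t\<bar>"
    by (simp add: power2_eq_square flip: abs_mult)
  also have "\<dots> \<le> 2 * (L * T) * (1 / 2)"
    using t T_small F.box_pos by (intro mult_mono) auto
  also have "\<dots> \<le> u"
    using F.room by simp
  finally have *: "dist (F x t) (X x t) \<le> u" .
  have "near 19 (F x t)"
    using t by (auto intro!: near_flow F.near_mono[OF x])
  then show ?thesis
    using * dist_triangle[of x0 "X x t" "F x t"] by (simp add: F.near_def)
qed

lemma combination_near_flows: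
  assumes x: "near 18 x" and s: "\<bar>s\<bar> \<le> \<kappa>" and k: "\<bar>k\<bar> \<le> \<kappa>" and \<kappa>: "\<kappa> < T"
  shows "dist (Y (X x s) k) (G (F x s) k) \<le> 6 * L * \<kappa>\<^sup>2"
proof -
  have T: "\<bar>s\<bar> < T" "\<bar>k\<bar> < T"
    using s k \<kappa> by auto
  have "s\<^sup>2 \<le> \<kappa>\<^sup>2" "k\<^sup>2 \<le> \<kappa>\<^sup>2"
    using s k by (auto simp: abs_le_square_iff[symmetric])
  then have sq: "L * s\<^sup>2 \<le> L * \<kappa>\<^sup>2" "L * k\<^sup>2 \<le> L * \<kappa>\<^sup>2"
    using F.box_pos by auto
  have w: "near 20 (X x s)" "near 20 (F x s)"
    using near_X_step[OF x T(1)] T by (auto intro!: near_flow F.near_mono[OF x])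
  have "dist (G (X x s) k) (Y (X x s) k) \<le> 2 * L * k\<^sup>2"
    using w T by (intro near_Y)
  moreover have "dist (G (F x s) k) (G (X x s) k) \<le> 2 * dist (F x s) (X x s)"
    using w T by (intro G.flow_double)
  moreover have "dist (F x s) (X x s) \<le> 2 * L * s\<^sup>2"
    using T by (intro near_X F.near_mono[OF x]) auto
  ultimately show ?thesis
    using sq dist_triangle[of "Y (X x s) k" "G (F x s) k" "G (X x s) k"] by (simp add: dist_commute algebra_simps)
qed

lemma combination_field_eq:
  assumes "\<bar>a x * t\<bar> < 1" "\<bar>b (X x (a x * t)) * t\<bar> < 1"
  shows "add_field (scale_field a X) (scale_field b Y) x t = Y (X x (a x * t)) (b (X x (a x * t)) * t)"
proof -
  have eq: "scale_field c Z y t = Z y (c y * t)" if "\<bar>c y * t\<bar> < 1" for c and Z :: "'a curve_family" and y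
  proof -
    have "\<not> \<bar>c y\<bar> * t > 1" "\<not> \<bar>c y\<bar> * t < - 1"
      using that by (auto simp: abs_mult abs_if split: if_splits)
    then show ?thesis
      by (simp add: scale_field_def)
  qed
  show ?thesis
    unfolding add_field_def using assms by (simp add: eq)
qed

end

section \<open>The integral surface\<close>

text \<open>
  Transversality of the fields carries over to the flows because the two differ only to second
  order.
\<close>
locale framed_fields = field_pair F G x0 r T L u X Y + frame F G x0 r T L u K
  for F G :: "'a::metric_space curve_family" and x0 r T L u X Y K +
  fixes c :: real
  assumes c_pos: "0 < c"
    and transversal: "near 20 x \<Longrightarrow> \<bar>s\<bar> < T \<Longrightarrow> \<bar>t\<bar> < T \<Longrightarrow> \<bar>s\<bar> + \<bar>t\<bar> \<le> c * dist (F x s) (G x t)"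
begin

lemma near_base: "near 1 x0"
  using F.unit_pos by (simp add: F.near_def)

text \<open>
  Applying \<open>F\<close> backward for the time \<open>t'\<close> to both points reduces the estimate to transversality at
  the single point \<open>G x0 s\<close>.
\<close>
lemma chart_expanding:
  assumes "\<bar>t\<bar> < T / 2" "\<bar>t'\<bar> < T / 2" "\<bar>s\<bar> < T / 2" "\<bar>s'\<bar> < T / 2"
  shows "\<bar>t - t'\<bar> + \<bar>s - s'\<bar> \<le> 2 * c * dist (F (G x0 s) t) (F (G x0 s') t')"
proof -
  have T: "\<bar>t\<bar> < T" "\<bar>t'\<bar> < T" "\<bar>s\<bar> < T" "\<bar>s'\<bar> < T" "\<bar>t - t'\<bar> < T" "\<bar>s' - s\<bar> < T"
    using assms by auto
  note [simp] = T
  have n: "near 2 (G x0 s)" "near 2 (G x0 s')"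
    by (auto intro!: near_flow F.near_mono[OF near_base])
  note [intro!] = near_flow F.near_mono[OF n(1)] F.near_mono[OF n(2)]
  have "dist (F (F (G x0 s) t) (- t')) (F (F (G x0 s') t') (- t')) \<le> 2 * dist (F (G x0 s) t) (F (G x0 s') t')"
    by (rule F.flow_double) auto
  moreover have "F (F (G x0 s) t) (- t') = F (G x0 s) (t + - t')"
    by (rule F.flow_compose) auto
  moreover have "F (F (G x0 s') t') (- t') = G x0 s'"
    by (rule F.flow_undo) auto
  moreover have "G (G x0 s) (s' - s) = G x0 (s + (s' - s))"
    by (rule G.flow_compose) (auto intro!: F.near_mono[OF near_base])
  ultimately have "dist (F (G x0 s) (t - t')) (G (G x0 s) (s' - s)) \<le> 2 * dist (F (G x0 s) t) (F (G x0 s') t')"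
    by simp
  then have "c * dist (F (G x0 s) (t - t')) (G (G x0 s) (s' - s)) \<le> c * (2 * dist (F (G x0 s) t) (F (G x0 s') t'))"
    using c_pos by (intro mult_left_mono) auto
  moreover have "\<bar>t - t'\<bar> + \<bar>s' - s\<bar> \<le> c * dist (F (G x0 s) (t - t')) (G (G x0 s) (s' - s))"
    by (rule transversal) auto
  ultimately show ?thesis
    by (simp add: abs_minus_commute)
qed

lemma chart_lipschitz:
  assumes "\<bar>t\<bar> < T" "\<bar>t'\<bar> < T" "\<bar>s\<bar> < T" "\<bar>s'\<bar> < T"
  shows "dist (F (G x0 s) t) (F (G x0 s') t') \<le> 2 * L * (\<bar>t - t'\<bar> + \<bar>s - s'\<bar>)"
proof -
  note [simp] = assms
  have "dist (F (G x0 s) t) (F (G x0 s) t') \<le> L * \<bar>t - t'\<bar>"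
    by (rule F.flow_time_lipschitz) (auto intro!: near_flow F.near_mono[OF near_base])
  moreover have "dist (F (G x0 s) t') (F (G x0 s') t') \<le> 2 * dist (G x0 s) (G x0 s')"
    by (rule F.flow_double) (auto intro!: near_flow F.near_mono[OF near_base])
  moreover have "dist (G x0 s) (G x0 s') \<le> L * \<bar>s - s'\<bar>"
    by (rule G.flow_time_lipschitz) (auto intro!: F.near_mono[OF near_base])
  moreover have "0 \<le> L * \<bar>t - t'\<bar>"
    using F.box_pos by simp
  ultimately show ?thesis
    using dist_triangle[of "F (G x0 s) t" "F (G x0 s') t'" "F (G x0 s) t'"] by (simp add: algebra_simps)
qed

text \<open>
  Transversality makes this parametrization bi-Lipschitz, so that its image is a surface.
\<close>
definition chart :: "real^2 \<Rightarrow> 'a" where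
  "chart p = F (G x0 (p $ 2)) (p $ 1)"

definition square :: "(real^2) set" where
  "square = {p. \<bar>p $ 1\<bar> < T / 2 \<and> \<bar>p $ 2\<bar> < T / 2}"

lemma open_square: "open square"
proof -
  have "square = {p. \<bar>p $ 1\<bar> < T / 2} \<inter> {p. \<bar>p $ 2\<bar> < T / 2}"
    by (auto simp: square_def)
  also have "open \<dots>"
    by (intro open_Int open_Collect_less continuous_intros)
  finally show ?thesis .
qed

lemma dist_chart_lower:
  assumes "p \<in> square" "q \<in> square"
  shows "dist p q \<le> 2 * c * dist (chart p) (chart q)"
proof -
  have "dist p q \<le> \<bar>p $ 1 - q $ 1\<bar> + \<bar>p $ 2 - q $ 2\<bar>"
    using norm_le_l1_cart[of "p - q"] by (simp add: dist_norm sum_2)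
  also have "\<dots> \<le> 2 * c * dist (chart p) (chart q)"
    unfolding chart_def using assms by (intro chart_expanding) (auto simp: square_def)
  finally show ?thesis .
qed

lemma surface_chart: "surface (chart ` square)"
proof (rule surface_homeomorphic_image[OF _ open_square])
  have inj: "inj_on chart square"
    using dist_chart_lower by (intro inj_onI) force
  have "(4 * L)-lipschitz_on square chart"
  proof (rule lipschitz_onI)
    fix p q assume *: "p \<in> square" "q \<in> square"
    have "dist (chart p) (chart q) \<le> 2 * L * (\<bar>p $ 1 - q $ 1\<bar> + \<bar>p $ 2 - q $ 2\<bar>)"
      unfolding chart_def using * F.box_pos by (intro chart_lipschitz) (auto simp: square_def)
    also have "\<dots> \<le> 2 * L * (dist p q + dist p q)"
      using component_le_norm_cart[of "p - q" 1] component_le_norm_cart[of "p - q" 2] F.box_pos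
      by (intro mult_left_mono add_mono) (auto simp: dist_norm)
    finally show "dist (chart p) (chart q) \<le> 4 * L * dist p q"
      by simp
  qed (use F.box_pos in auto)
  then have cont: "continuous_on square chart"
    by (rule lipschitz_on_continuous_on)
  have "(2 * c)-lipschitz_on (chart ` square) (inv_into square chart)"
  proof (rule lipschitz_onI)
    fix x y assume "x \<in> chart ` square" "y \<in> chart ` square"
    then show "dist (inv_into square chart x) (inv_into square chart y) \<le> 2 * c * dist x y"
      using dist_chart_lower inj by (auto simp: inv_into_f_f)
  qed (use c_pos in auto)
  then have "continuous_on (chart ` square) (inv_into square chart)"
    by (rule lipschitz_on_continuous_on)
  then show "homeomorphism square (chart ` square) chart (inv_into square chart)"
    using cont inj by (simp add: homeomorphism_def inv_into_f_f f_inv_into_f image_image)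
qed

lemma base_in_surface: "x0 \<in> chart ` square"
  by (rule image_eqI[of _ _ 0]) (use F.box_pos in \<open>auto simp: chart_def square_def F.flow_zero G.flow_zero\<close>)

text \<open>
  Near \<open>x = F (G x0 s) t\<close> a combination of the fields is, to second order, a step along \<open>F\<close>
  followed by a step along \<open>G\<close>. The first only changes \<open>t\<close>. The second is pulled through \<open>F\<close>
  and then changes \<open>t\<close> and \<open>s\<close> up to an error \<open>o(h)\<close>. Near a given point of the surface there is a
  margin \<open>\<rho>\<close> in the parameters, so the new parameters still lie in the square.
\<close>
lemma infdist_combination:
  assumes a: "\<And>x. near 20 x \<Longrightarrow> \<bar>a x\<bar> \<le> B" and b: "\<And>x. near 20 x \<Longrightarrow> \<bar>b x\<bar> \<le> B" and B: "0 < B"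
    and p: "p \<in> chart ` square"
  shows "\<exists>r'>0. \<forall>\<epsilon>>0. \<exists>\<delta>>0. \<forall>x \<in> chart ` square \<inter> ball p r'. \<forall>h. 0 < \<bar>h\<bar> \<and> \<bar>h\<bar> < \<delta> \<longrightarrow>
    infdist (add_field (scale_field a X) (scale_field b Y) x h) (chart ` square) < \<epsilon> * \<bar>h\<bar>"
proof -
  note pos = F.box_pos
  obtain q where q: "q \<in> square" "p = chart q"
    using p by blast
  \<comment> \<open>The distance of the parameters of \<open>p\<close> from the boundary of the square.\<close>
  define \<rho> where "\<rho> = T / 2 - max \<bar>q $ 1\<bar> \<bar>q $ 2\<bar>"
  have \<rho>: "0 < \<rho>" "\<bar>q $ 1\<bar> \<le> T / 2 - \<rho>" "\<bar>q $ 2\<bar> \<le> T / 2 - \<rho>" "\<rho> \<le> T / 2"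
    using q by (auto simp: \<rho>_def square_def)
  obtain C where C: "0 < C" and pull: "\<And>\<epsilon>. 0 < \<epsilon> \<Longrightarrow> \<exists>k0>0. \<forall>y v k. near 2 y \<and> \<bar>v\<bar> < T / 2 \<and> \<bar>k\<bar> < k0 \<longrightarrow>
    (\<exists>A k'. \<bar>A\<bar> \<le> C * \<bar>k\<bar> \<and> \<bar>k'\<bar> \<le> C * \<bar>k\<bar> \<and> dist (G (F y v) k) (F (G y k') (v + A)) \<le> \<epsilon> * \<bar>k\<bar>)"
    using pull_through by blast
  show ?thesis
  proof (rule exI[of _ "\<rho> / (4 * c)"], intro conjI allI impI)
    show "0 < \<rho> / (4 * c)"
      using \<rho> c_pos by simp
    fix \<epsilon> :: real assume \<epsilon>: "0 < \<epsilon>"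
    obtain k0 where k0: "0 < k0" "\<And>y v k. near 2 y \<Longrightarrow> \<bar>v\<bar> < T / 2 \<Longrightarrow> \<bar>k\<bar> < k0 \<Longrightarrow>
      \<exists>A k'. \<bar>A\<bar> \<le> C * \<bar>k\<bar> \<and> \<bar>k'\<bar> \<le> C * \<bar>k\<bar> \<and> dist (G (F y v) k) (F (G y k') (v + A)) \<le> \<epsilon> / (4 * B) * \<bar>k\<bar>"
      using pull[of "\<epsilon> / (4 * B)"] \<epsilon> B by auto
    \<comment> \<open>The second bound keeps the parameters in the square, the third makes the error \<open>6 L (B h)\<^sup>2\<close> small.\<close>
    define d where "d = Min {k0, \<rho> / (2 * (1 + C)), \<epsilon> / (24 * L * B)}"
    have d: "0 < d" "d \<le> k0" "d \<le> \<rho> / (2 * (1 + C))" "d \<le> \<epsilon> / (24 * L * B)"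
      using k0 \<rho> \<epsilon> B C pos by (auto simp: d_def)
    have d': "d + C * d \<le> \<rho> / 2" "6 * L * B * d \<le> \<epsilon> / 4"
    proof -
      have le: "(1 + C) * d \<le> (1 + C) * (\<rho> / (2 * (1 + C)))"
        using d C by (intro mult_left_mono) auto
      have "D * (\<rho> / (2 * D)) = \<rho> / 2" if "0 < D" for D
        using that by simp
      from this[of "1 + C"] have eq: "(1 + C) * (\<rho> / (2 * (1 + C))) = \<rho> / 2"
        using C by simp
      have "(1 + C) * d \<le> \<rho> / 2"
        using le unfolding eq .
      then show "d + C * d \<le> \<rho> / 2"
        by (simp add: algebra_simps)
      have "6 * L * B * d \<le> 6 * L * B * (\<epsilon> / (24 * L * B))"
        using d B pos by (intro mult_left_mono) auto
      then show "6 * L * B * d \<le> \<epsilon> / 4"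
        using B pos by simp
    qed
    have Cd: "0 < C * d"
      using C d by simp
    show "\<exists>\<delta>>0. \<forall>x \<in> chart ` square \<inter> ball p (\<rho> / (4 * c)). \<forall>h. 0 < \<bar>h\<bar> \<and> \<bar>h\<bar> < \<delta> \<longrightarrow>
      infdist (add_field (scale_field a X) (scale_field b Y) x h) (chart ` square) < \<epsilon> * \<bar>h\<bar>"
    proof (rule exI[of _ "d / B"], intro conjI ballI allI impI)
      show "0 < d / B"
        using d B by simp
      fix x h assume x: "x \<in> chart ` square \<inter> ball p (\<rho> / (4 * c))" and h: "0 < \<bar>h\<bar> \<and> \<bar>h\<bar> < d / B"
      obtain w where w: "w \<in> square" "x = chart w"
        using x by blast
      define t s where "t = w $ 1" and "s = w $ 2"
      have ts: "\<bar>t\<bar> < T / 2" "\<bar>s\<bar> < T / 2" "x = F (G x0 s) t"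
        using w by (auto simp: t_def s_def square_def chart_def)
      have "\<bar>t - q $ 1\<bar> + \<bar>s - q $ 2\<bar> \<le> 2 * c * dist x p"
        unfolding ts(3) q chart_def using q ts by (intro chart_expanding) (auto simp: square_def)
      also have "\<dots> < 2 * c * (\<rho> / (4 * c))"
        using x c_pos by (intro mult_strict_left_mono) (auto simp: dist_commute)
      also have "\<dots> = \<rho> / 2"
        using c_pos by simp
      finally have "\<bar>t - q $ 1\<bar> + \<bar>s - q $ 2\<bar> < \<rho> / 2" .
      then have margin: "\<bar>t\<bar> < T / 2 - \<rho> / 2" "\<bar>s\<bar> < T / 2 - \<rho> / 2"
        using \<rho>(2,3) abs_triangle_ineq[of "t - q $ 1" "q $ 1"] abs_triangle_ineq[of "s - q $ 2" "q $ 2"]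
          abs_ge_zero[of "t - q $ 1"] abs_ge_zero[of "s - q $ 2"] by (simp_all del: abs_ge_zero)
      define \<kappa> where "\<kappa> = B * \<bar>h\<bar>"
      have \<kappa>: "0 < \<kappa>" "\<kappa> < d" "\<kappa> < T / 2" "\<kappa> < T" "\<kappa> < 1"
      proof -
        show "0 < \<kappa>" "\<kappa> < d"
          using h B by (auto simp: \<kappa>_def field_simps)
        then show "\<kappa> < T / 2" "\<kappa> < T" "\<kappa> < 1"
          using d'(1) Cd \<rho> T_small by linarith+
      qed
      have near_x: "near 3 x"
        unfolding ts(3) using ts pos by (intro near_flow F.near_mono[OF near_base]) auto
      define \<alpha> where "\<alpha> = a x * h"
      define k where "k = b (X x \<alpha>) * h"
      have \<alpha>: "\<bar>\<alpha>\<bar> \<le> \<kappa>"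
        using a[OF F.near_mono[OF near_x]] by (auto simp: \<alpha>_def \<kappa>_def abs_mult intro!: mult_right_mono)
      have \<alpha>T: "\<bar>\<alpha>\<bar> < T" "\<bar>\<alpha>\<bar> < d"
        using \<alpha> \<kappa> by linarith+
      have "near 20 (X x \<alpha>)"
        using near_x \<alpha>T by (intro near_X_step F.near_mono[OF near_x]) auto
      then have k: "\<bar>k\<bar> \<le> \<kappa>"
        using b by (auto simp: k_def \<kappa>_def abs_mult intro!: mult_right_mono)
      have "add_field (scale_field a X) (scale_field b Y) x h = Y (X x \<alpha>) k"
        unfolding \<alpha>_def k_def
        by (rule combination_field_eq) (use \<alpha> k \<kappa> in \<open>auto simp: \<alpha>_def k_def\<close>)
      moreover have "dist (Y (X x \<alpha>) k) (G (F x \<alpha>) k) \<le> 6 * L * \<kappa>\<^sup>2"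
        using \<alpha> k \<kappa> by (intro combination_near_flows F.near_mono[OF near_x]) auto
      moreover have "F x \<alpha> = F (G x0 s) (t + \<alpha>)"
      proof -
        have "\<bar>t + \<alpha>\<bar> < T" "\<bar>t\<bar> < T" "\<bar>s\<bar> < T"
          using ts(1,2) \<alpha> \<kappa> pos abs_triangle_ineq[of t \<alpha>] by linarith+
        then show ?thesis
          unfolding ts(3) using \<alpha>T
          by (intro F.flow_compose near_flow F.near_mono[OF near_base]) auto
      qed
      moreover obtain A k' where A: "\<bar>A\<bar> \<le> C * \<bar>k\<bar>" "\<bar>k'\<bar> \<le> C * \<bar>k\<bar>"
        "dist (G (F (G x0 s) (t + \<alpha>)) k) (F (G (G x0 s) k') (t + \<alpha> + A)) \<le> \<epsilon> / (4 * B) * \<bar>k\<bar>"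
      proof -
        have "near 2 (G x0 s)"
          using ts pos by (intro near_flow F.near_mono[OF near_base]) auto
        moreover have "\<bar>t + \<alpha>\<bar> < T / 2"
          using margin(1) \<alpha>T(2) d'(1) Cd abs_triangle_ineq[of t \<alpha>] by linarith
        moreover have "\<bar>k\<bar> < k0"
          using k \<kappa> d by linarith
        ultimately show ?thesis
          using k0(2)[of "G x0 s" "t + \<alpha>" k] that by blast
      qed
      moreover have "F (G (G x0 s) k') (t + \<alpha> + A) \<in> chart ` square"
      proof -
        have "C * \<bar>k\<bar> \<le> C * d"
          using k \<kappa> C by (intro mult_left_mono) auto
        then have Ak: "\<bar>A\<bar> \<le> C * d" "\<bar>k'\<bar> \<le> C * d"
          using A by auto
        have 1: "\<bar>t + \<alpha> + A\<bar> < T / 2"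
          using margin(1) \<alpha>T(2) d'(1) Ak(1) abs_triangle_ineq[of t \<alpha>] abs_triangle_ineq[of "t + \<alpha>" A] by linarith
        have 2: "\<bar>s + k'\<bar> < T / 2"
          using margin(2) d(1) d'(1) Ak(2) abs_triangle_ineq[of s k'] by linarith
        have "\<bar>k'\<bar> < T"
          using Ak(2) d(1) d'(1) \<rho>(1,4) pos(2) by linarith
        then have "G (G x0 s) k' = G x0 (s + k')"
          using ts(2) 2 pos(2) by (intro G.flow_compose F.near_mono[OF near_base]) auto
        then show ?thesis
          using 1 2 by (intro image_eqI[of _ _ "vector [t + \<alpha> + A, s + k']"]) (auto simp: chart_def square_def)
      qed
      ultimately have "infdist (add_field (scale_field a X) (scale_field b Y) x h) (chart ` square)
          \<le> 6 * L * \<kappa>\<^sup>2 + \<epsilon> / (4 * B) * \<bar>k\<bar>"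
        using infdist_le[of "F (G (G x0 s) k') (t + \<alpha> + A)" "chart ` square" "Y (X x \<alpha>) k"]
          dist_triangle[of "Y (X x \<alpha>) k" "F (G (G x0 s) k') (t + \<alpha> + A)" "G (F x \<alpha>) k"] by simp
      also have "\<dots> \<le> \<epsilon> / 4 * \<bar>h\<bar> + \<epsilon> / 4 * \<bar>h\<bar>"
      proof (rule add_mono)
        have "6 * L * \<kappa>\<^sup>2 = 6 * L * B * \<kappa> * \<bar>h\<bar>"
          by (simp add: \<kappa>_def power2_eq_square)
        also have "\<dots> \<le> 6 * L * B * d * \<bar>h\<bar>"
          using \<kappa> B pos by (intro mult_right_mono mult_left_mono) auto
        also have "\<dots> \<le> \<epsilon> / 4 * \<bar>h\<bar>"
          using d'(2) by (intro mult_right_mono) auto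
        finally show "6 * L * \<kappa>\<^sup>2 \<le> \<epsilon> / 4 * \<bar>h\<bar>" .
        have "\<epsilon> / (4 * B) * \<bar>k\<bar> \<le> \<epsilon> / (4 * B) * (B * \<bar>h\<bar>)"
          using k \<epsilon> B by (intro mult_left_mono) (auto simp: \<kappa>_def)
        then show "\<epsilon> / (4 * B) * \<bar>k\<bar> \<le> \<epsilon> / 4 * \<bar>h\<bar>"
          using B by simp
      qed
      also have "\<dots> < \<epsilon> * \<bar>h\<bar>"
        using \<epsilon> h by simp
      finally show "infdist (add_field (scale_field a X) (scale_field b Y) x h) (chart ` square) < \<epsilon> * \<bar>h\<bar>" .
    qed
  qed
qed

end

section \<open>From the hypotheses to a frame\<close>

lemma lipschitz_function_bounded_on_ball:
  fixes a :: "'a::metric_space \<Rightarrow> real"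
  assumes "lipschitz_function a"
  obtains B where "0 < B" "\<And>x. x \<in> ball x0 r \<Longrightarrow> \<bar>a x\<bar> \<le> B"
proof -
  obtain M where M: "M-lipschitz_on UNIV a"
    using assms by (auto simp: lipschitz_function_def)
  have M0: "0 \<le> M"
    using M by (rule lipschitz_on_nonneg)
  show ?thesis
  proof
    show "0 < \<bar>a x0\<bar> + M * \<bar>r\<bar> + 1"
      using M0 by (simp add: add_nonneg_pos)
    fix x assume x: "x \<in> ball x0 r"
    have "\<bar>a x0 - a x\<bar> \<le> M * dist x0 x"
      using lipschitz_onD[OF M, of x0 x] by (simp add: dist_real_def)
    also have "\<dots> \<le> M * \<bar>r\<bar>"
      using x M0 by (intro mult_left_mono) auto
    finally show "\<bar>a x\<bar> \<le> \<bar>a x0\<bar> + M * \<bar>r\<bar> + 1"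
      by linarith
  qed
qed

lemma flow_field_eq_flow:
  assumes "\<alpha> x \<le> ereal (- (2 * T))" "ereal (2 * T) \<le> \<beta> x" "\<bar>t\<bar> < T"
  shows "flow_field \<alpha> \<beta> F x t = F x t"
proof -
  have "\<not> ereal t \<le> \<alpha> x / 2"
    using assms by (cases "\<alpha> x") auto
  moreover have "\<not> \<beta> x / 2 \<le> ereal t"
    using assms by (cases "\<beta> x") auto
  ultimately show ?thesis
    by (simp add: flow_field_def)
qed

text \<open>
  At \<open>t = \<tau>\<^sup>2\<close> the bracket is the loop with sides \<open>\<tau>\<close>, and the combination \<open>a X + b Y\<close> is a shift with
  times of size at most \<open>B \<tau>\<^sup>2\<close>, up to errors of order \<open>\<tau>\<^sup>4\<close>.
\<close>
lemma (in field_pair) tangent_imp_commutator: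
  assumes a: "\<And>x. near 20 x \<Longrightarrow> \<bar>a x\<bar> \<le> B" and b: "\<And>x. near 20 x \<Longrightarrow> \<bar>b x\<bar> \<le> B" and B: "0 < B"
    and F': "\<And>x t. near 20 x \<Longrightarrow> \<bar>t\<bar> < T \<Longrightarrow> F' x t = F x t"
    and G': "\<And>x t. near 20 x \<Longrightarrow> \<bar>t\<bar> < T \<Longrightarrow> G' x t = G x t"
    and tan: "\<And>\<epsilon>. 0 < \<epsilon> \<Longrightarrow> \<exists>\<delta>>0. \<forall>x t. near 20 x \<and> 0 < \<bar>t\<bar> \<and> \<bar>t\<bar> < \<delta> \<longrightarrow>
      dist (bracket F' G' x t) (add_field (scale_field a X) (scale_field b Y) x t) < \<epsilon> * \<bar>t\<bar>"
    and \<epsilon>: "0 < \<epsilon>"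
  shows "\<exists>\<tau>0>0. \<forall>x \<tau>. near 6 x \<and> 0 < \<tau> \<and> \<tau> < \<tau>0 \<longrightarrow> shifted (B * \<tau>\<^sup>2) (\<epsilon> * \<tau>\<^sup>2) (loop x \<tau>) x"
proof -
  note pos = F.box_pos
  obtain \<delta> where \<delta>: "0 < \<delta>" "\<And>x t. near 20 x \<Longrightarrow> 0 < \<bar>t\<bar> \<Longrightarrow> \<bar>t\<bar> < \<delta> \<Longrightarrow>
      dist (bracket F' G' x t) (add_field (scale_field a X) (scale_field b Y) x t) < \<epsilon> / 2 * \<bar>t\<bar>"
    using tan[of "\<epsilon> / 2"] \<epsilon> by auto
  define \<tau>0 where "\<tau>0 = Min {T, \<delta>, T / B, \<epsilon> / (20 * L * B * B)}"
  have \<tau>0: "0 < \<tau>0" "\<tau>0 \<le> T" "\<tau>0 \<le> \<delta>" "\<tau>0 \<le> T / B" "\<tau>0 \<le> \<epsilon> / (20 * L * B * B)"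
    using \<delta> \<epsilon> B pos by (auto simp: \<tau>0_def)
  show ?thesis
  proof (rule exI[of _ \<tau>0], intro conjI allI impI)
    show "0 < \<tau>0"
      by fact
    fix x \<tau> assume *: "near 6 x \<and> 0 < \<tau> \<and> \<tau> < \<tau>0"
    have x: "near 6 x" and \<tau>: "0 < \<tau>" "\<tau> < \<tau>0" "\<tau> < T" "\<tau> < 1"
      using * \<tau>0 T_small by auto
    have sq: "0 < \<tau>\<^sup>2" "\<tau>\<^sup>2 \<le> \<tau>"
      using \<tau> by (auto simp: power2_eq_square mult_le_cancel_left1)
    define \<kappa> where "\<kappa> = B * \<tau>\<^sup>2"
    have \<kappa>: "0 < \<kappa>" "\<kappa> < T" "\<kappa> < 1"
    proof -
      show "0 < \<kappa>"
        using B \<tau> by (simp add: \<kappa>_def)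
      have "B * \<tau>\<^sup>2 \<le> B * \<tau>"
        using sq B by (intro mult_left_mono) auto
      also have "\<dots> < B * (T / B)"
        using \<tau> \<tau>0 B by (intro mult_strict_left_mono) auto
      finally show "\<kappa> < T" "\<kappa> < 1"
        using B T_small by (auto simp: \<kappa>_def)
    qed
    define s where "s = a x * \<tau>\<^sup>2"
    define k where "k = b (X x s) * \<tau>\<^sup>2"
    have s: "\<bar>s\<bar> \<le> \<kappa>"
      using a[OF F.near_mono[OF x]] by (auto simp: s_def \<kappa>_def abs_mult intro!: mult_right_mono)
    have "near 20 (X x s)"
      using s \<kappa> by (intro near_X_step F.near_mono[OF x]) auto
    then have k: "\<bar>k\<bar> \<le> \<kappa>"
      using b by (auto simp: k_def \<kappa>_def abs_mult intro!: mult_right_mono)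
    have "bracket F' G' x (\<tau>\<^sup>2) = loop x \<tau>"
    proof -
      note [simp] = \<tau>(1) less_imp_le[OF \<tau>(1)] \<tau>(3)
      have "bracket F' G' x (\<tau>\<^sup>2) = G' (F' (G' (F' x \<tau>) \<tau>) (- \<tau>)) (- \<tau>)"
        by (simp add: bracket_def)
      also have "F' x \<tau> = F x \<tau>"
        by (rule F') (auto intro!: near_flow F.near_mono[OF x])
      also have "G' (F x \<tau>) \<tau> = G (F x \<tau>) \<tau>"
        by (rule G') (auto intro!: near_flow F.near_mono[OF x])
      also have "F' (G (F x \<tau>) \<tau>) (- \<tau>) = F (G (F x \<tau>) \<tau>) (- \<tau>)"
        by (rule F') (auto intro!: near_flow F.near_mono[OF x])
      also have "G' (F (G (F x \<tau>) \<tau>) (- \<tau>)) (- \<tau>) = G (F (G (F x \<tau>) \<tau>) (- \<tau>)) (- \<tau>)"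
        by (rule G') (auto intro!: near_flow F.near_mono[OF x])
      finally show ?thesis
        by (simp add: loop_def)
    qed
    moreover have "add_field (scale_field a X) (scale_field b Y) x (\<tau>\<^sup>2) = Y (X x s) k"
      unfolding s_def k_def by (rule combination_field_eq) (use s k \<kappa> in \<open>auto simp: s_def k_def\<close>)
    moreover have "dist (bracket F' G' x (\<tau>\<^sup>2)) (add_field (scale_field a X) (scale_field b Y) x (\<tau>\<^sup>2)) < \<epsilon> / 2 * \<bar>\<tau>\<^sup>2\<bar>"
      using sq \<tau> \<tau>0 by (intro \<delta> F.near_mono[OF x]) auto
    ultimately have 1: "dist (loop x \<tau>) (Y (X x s) k) \<le> \<epsilon> / 2 * \<tau>\<^sup>2"
      by simp
    have 2: "dist (Y (X x s) k) (G (F x s) k) \<le> 6 * L * \<kappa>\<^sup>2"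
      using s k \<kappa> by (intro combination_near_flows F.near_mono[OF x]) auto
    have 3: "dist (G (F x s) k) (F (G x k) s) \<le> 4 * L * \<kappa> * \<kappa>"
      using s k \<kappa> by (intro commute_bounded F.near_mono[OF x]) auto
    have "10 * L * \<kappa>\<^sup>2 = 10 * L * B * B * \<tau>\<^sup>2 * \<tau>\<^sup>2"
      by (simp add: \<kappa>_def power2_eq_square)
    also have "\<dots> \<le> 10 * L * B * B * (\<epsilon> / (20 * L * B * B)) * \<tau>\<^sup>2"
      using sq \<tau> \<tau>0 B pos by (intro mult_right_mono mult_left_mono) auto
    also have "\<dots> = \<epsilon> / 2 * \<tau>\<^sup>2"
      using B pos by simp
    finally have "dist (loop x \<tau>) (F (G x k) s) \<le> \<epsilon> * \<tau>\<^sup>2"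
      using 1 2 3 dist_triangle[of "loop x \<tau>" "G (F x s) k" "Y (X x s) k"]
        dist_triangle[of "loop x \<tau>" "F (G x k) s" "G (F x s) k"]
      by (simp add: power2_eq_square)
    then show "shifted (B * \<tau>\<^sup>2) (\<epsilon> * \<tau>\<^sup>2) (loop x \<tau>) x"
      unfolding shifted_def using s k by (auto simp: \<kappa>_def)
  qed
qed

lemma controlled_flow_near_field:
  assumes "controlled_flow X x0 R \<delta> L F \<alpha> \<beta>" and r: "0 < r" "0 < T" "r + L * T \<le> R" "T \<le> \<delta>" "L * T \<le> 1 / 2"
    and x: "x \<in> ball x0 r" and t: "\<bar>t\<bar> < T"
  shows "dist (F x t) (X x t) \<le> 2 * L * t\<^sup>2"
proof -
  interpret controlled_flow X x0 R \<delta> L F \<alpha> \<beta>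
    by fact
  have "L * \<bar>t\<bar> \<le> L * T"
    using t pos by (intro mult_left_mono) auto
  then have "exp (L * \<bar>t\<bar>) \<le> exp (1 / 2)"
    using r by simp
  then have exp: "exp (L * \<bar>t\<bar>) \<le> 2"
    using exp_half_le2 by (rule order_trans)
  have "dist (F x t) (X x t) \<le> exp (L * \<bar>t\<bar>) * (L * t\<^sup>2)"
    using r t by (intro flow_near_field[OF r(1-3) x]) auto
  also have "\<dots> \<le> 2 * (L * t\<^sup>2)"
    using exp pos by (intro mult_right_mono) auto
  finally show ?thesis
    by simp
qed

text \<open>
  Chooses common constants for the two fields. The flows are first compared with the fields using the
  smaller constant \<open>L0\<close>; the constant \<open>L\<close> of the pair must also bound the failure to commute, for
  which replacing fields by flows costs \<open>12 L0\<close> in addition to the closeness constant. The bound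
  \<open>d\<close> leaves room for the neighbourhoods required by transversality and tangency.
\<close>
lemma ex_field_pair:
  fixes X Y F G :: "'a::metric_space curve_family"
  assumes complete: "locally_complete (UNIV :: 'a set)"
    and X: "arc_field X" "cond_E1 X" "cond_E2 X" and Y: "arc_field Y" "cond_E1 Y" "cond_E2 Y"
    and close: "fields_close X Y"
    and F: "local_flow X \<alpha>F \<beta>F F" and G: "local_flow Y \<alpha>G \<beta>G G"
    and d: "0 < d"
  obtains r T L u where "field_pair F G x0 r T L u X Y" "r \<le> d" "T \<le> d" "4 * L * T \<le> d"
    "\<And>x t. x \<in> ball x0 r \<Longrightarrow> \<bar>t\<bar> < T \<Longrightarrow> flow_field \<alpha>F \<beta>F F x t = F x t"
    "\<And>x t. x \<in> ball x0 r \<Longrightarrow> \<bar>t\<bar> < T \<Longrightarrow> flow_field \<alpha>G \<beta>G G x t = G x t"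
proof -
  obtain R1 \<delta>1 L1 where 1: "R1 > 0" "\<delta>1 > 0" "L1 > 0"
    "\<And>R \<delta> L. 0 < R \<Longrightarrow> R \<le> R1 \<Longrightarrow> 0 < \<delta> \<Longrightarrow> \<delta> \<le> \<delta>1 \<Longrightarrow> L1 \<le> L \<Longrightarrow> controlled_field X x0 R \<delta> L"
    using arc_field_imp_controlled[OF complete X] by metis
  obtain R2 \<delta>2 L2 where 2: "R2 > 0" "\<delta>2 > 0" "L2 > 0"
    "\<And>R \<delta> L. 0 < R \<Longrightarrow> R \<le> R2 \<Longrightarrow> 0 < \<delta> \<Longrightarrow> \<delta> \<le> \<delta>2 \<Longrightarrow> L2 \<le> L \<Longrightarrow> controlled_field Y x0 R \<delta> L"
    using arc_field_imp_controlled[OF complete Y] by metis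
  obtain C \<delta>3 r3 where 3: "C > 0" "\<delta>3 > 0" "r3 > 0"
    "\<And>x s t. x \<in> ball x0 r3 \<Longrightarrow> \<bar>s\<bar> < \<delta>3 \<Longrightarrow> \<bar>t\<bar> < \<delta>3 \<Longrightarrow> dist (Y (X x t) s) (X (Y x s) t) \<le> C * \<bar>s * t\<bar>"
    using close unfolding fields_close_def by metis
  define R where "R = min R1 R2"
  define \<delta> where "\<delta> = min \<delta>1 \<delta>2"
  define L0 where "L0 = max L1 L2"
  define L where "L = 12 * L0 + C"
  define r where "r = Min {R / 2, r3, d}"
  define u where "u = r / 20"
  define T where "T = Min {\<delta>, \<delta>3, u / L, 1 / 2, 1 / (2 * L), d, d / (4 * L)}"
  have R: "0 < R" "R \<le> R1" "R \<le> R2" and \<delta>: "0 < \<delta>" "\<delta> \<le> \<delta>1" "\<delta> \<le> \<delta>2"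
    and L0: "0 < L0" "L1 \<le> L0" "L2 \<le> L0"
    using 1 2 by (auto simp: R_def \<delta>_def L0_def)
  then have L: "0 < L" "L0 \<le> L" "L1 \<le> L" "L2 \<le> L"
    using 3 by (auto simp: L_def)
  have r: "0 < r" "r \<le> R / 2" "r \<le> r3" "r \<le> d" "0 < u" "20 * u \<le> r"
    using R 3 d by (auto simp: r_def u_def)
  have "0 < T"
    unfolding T_def using \<delta> 3(2) r L d by (subst Min_gr_iff) auto
  have T_le: "T \<le> z" if "z \<in> {\<delta>, \<delta>3, u / L, 1 / 2, 1 / (2 * L), d, d / (4 * L)}" for z
    unfolding T_def using that by (intro Min_le) auto
  have T: "0 < T" "T \<le> \<delta>" "T \<le> \<delta>3" "T \<le> 1 / 2" "T \<le> d" "L * T \<le> u" "L * T \<le> 1 / 2" "4 * L * T \<le> d"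
  proof -
    have "L * T \<le> L * (u / L)" "L * T \<le> L * (1 / (2 * L))" "4 * L * T \<le> 4 * L * (d / (4 * L))"
      using L by (intro mult_left_mono T_le; simp)+
    then show "L * T \<le> u" "L * T \<le> 1 / 2" "4 * L * T \<le> d"
      using L by simp_all
    show "T \<le> \<delta>" "T \<le> \<delta>3" "T \<le> 1 / 2" "T \<le> d"
      by (rule T_le; simp)+
  qed fact
  have room: "r + L * T \<le> R" "r + L * (2 * T) \<le> R" "r + L0 * T \<le> R" "L0 * T \<le> 1 / 2"
  proof -
    have 1: "L0 * T \<le> L * T"
      using L T by (intro mult_right_mono) auto
    have 2: "0 \<le> L * T" "r + 2 * (L * T) \<le> R"
      using L T r by auto
    show "r + L * T \<le> R" "r + L * (2 * T) \<le> R" "r + L0 * T \<le> R" "L0 * T \<le> 1 / 2"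
      using 1 2 T(7) by linarith+
  qed
  have cF: "controlled_flow X x0 R \<delta> L' F \<alpha>F \<beta>F" if "L1 \<le> L'" for L'
    using 1(4)[OF R(1,2) \<delta>(1,2) that] F by (simp add: controlled_flow_def controlled_flow_axioms_def)
  have cG: "controlled_flow Y x0 R \<delta> L' G \<alpha>G \<beta>G" if "L2 \<le> L'" for L'
    using 2(4)[OF R(1,3) \<delta>(1,3) that] G by (simp add: controlled_flow_def controlled_flow_axioms_def)
  interpret F: graded_flow_box F x0 r T L u
    using controlled_flow.flow_has_box[OF cF[OF L(3)] r(1) T(1) room(1)] r T
    by (simp add: graded_flow_box_def graded_flow_box_axioms_def)
  interpret G: graded_flow_box G x0 r T L u
    using controlled_flow.flow_has_box[OF cG[OF L(4)] r(1) T(1) room(1)] r T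
    by (simp add: graded_flow_box_def graded_flow_box_axioms_def)
  have nearX: "dist (F x t) (X x t) \<le> 2 * L0 * t\<^sup>2" if "F.near 20 x" "\<bar>t\<bar> < T" for x t
    using controlled_flow_near_field[OF cF[OF L0(2)] r(1) T(1) room(3) T(2) room(4)] that F.near_imp_ball[of 20 x] by simp
  have nearY: "dist (G x t) (Y x t) \<le> 2 * L0 * t\<^sup>2" if "F.near 20 x" "\<bar>t\<bar> < T" for x t
    using controlled_flow_near_field[OF cG[OF L0(3)] r(1) T(1) room(3) T(2) room(4)] that F.near_imp_ball[of 20 x] by simp
  have le_u: "2 * L0 * t\<^sup>2 \<le> u" if "\<bar>t\<bar> < T" for t
  proof -
    have "2 * L0 * t\<^sup>2 = 2 * (L0 * \<bar>t\<bar>) * \<bar>t\<bar>"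
      by (simp add: power2_eq_square flip: abs_mult)
    also have "\<dots> \<le> 2 * (L * T) * (1 / 2)"
      using that T L L0 by (intro mult_mono) auto
    finally show ?thesis
      using T by simp
  qed
  have rough: "dist (G (F x t) s) (F (G x s) t) \<le> L * k\<^sup>2"
    if x: "F.near 12 x" and st: "\<bar>s\<bar> \<le> k" "\<bar>t\<bar> \<le> k" "k < T" for x s t k
  proof -
    have T': "\<bar>s\<bar> < T" "\<bar>t\<bar> < T"
      using st by auto
    note [simp] = T'
    have n: "F.near 13 (F x t)" "F.near 13 (G x s)"
      by (auto intro!: F.flow_near G.flow_near F.near_mono[OF x])
    have "F.near 14 (X x t)"
      using n(1) nearX[OF F.near_mono[OF x], of t] le_u[OF T'(2)] dist_triangle[of x0 "X x t" "F x t"]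
      by (simp add: F.near_def)
    moreover have "F.near 14 (Y x s)"
      using n(2) nearY[OF F.near_mono[OF x], of s] le_u[OF T'(1)] dist_triangle[of x0 "Y x s" "G x s"]
      by (simp add: F.near_def)
    ultimately have n20: "F.near 20 (X x t)" "F.near 20 (Y x s)" "F.near 20 (F x t)" "F.near 20 (G x s)" "F.near 20 x"
      using n x by (auto intro: F.near_mono)
    have sq: "L0 * s\<^sup>2 \<le> L0 * k\<^sup>2" "L0 * t\<^sup>2 \<le> L0 * k\<^sup>2" "C * \<bar>s * t\<bar> \<le> C * k\<^sup>2"
    proof -
      have "s\<^sup>2 \<le> k\<^sup>2" "t\<^sup>2 \<le> k\<^sup>2"
        using st by (auto simp: abs_le_square_iff[symmetric])
      then show "L0 * s\<^sup>2 \<le> L0 * k\<^sup>2" "L0 * t\<^sup>2 \<le> L0 * k\<^sup>2"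
        using L0 by auto
      have "\<bar>s\<bar> * \<bar>t\<bar> \<le> k * k"
        using st by (intro mult_mono) auto
      then show "C * \<bar>s * t\<bar> \<le> C * k\<^sup>2"
        using 3 by (auto simp: abs_mult power2_eq_square)
    qed
    have "dist (G (F x t) s) (G (X x t) s) \<le> 2 * dist (F x t) (X x t)"
      using n20 by (intro G.flow_double) auto
    then have a1: "dist (G (F x t) s) (Y (X x t) s) \<le> 6 * (L0 * k\<^sup>2)"
      using sq nearX[OF n20(5), of t] nearY[OF n20(1), of s]
        dist_triangle[of "G (F x t) s" "Y (X x t) s" "G (X x t) s"] by simp
    have "dist (F (G x s) t) (F (Y x s) t) \<le> 2 * dist (G x s) (Y x s)"
      using n20 by (intro F.flow_double) auto
    then have a2: "dist (F (G x s) t) (X (Y x s) t) \<le> 6 * (L0 * k\<^sup>2)"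
      using sq nearY[OF n20(5), of s] nearX[OF n20(2), of t]
        dist_triangle[of "F (G x s) t" "X (Y x s) t" "F (Y x s) t"] by simp
    have "x \<in> ball x0 r3"
      using F.near_imp_ball[OF x] r(3) by simp
    then have "dist (Y (X x t) s) (X (Y x s) t) \<le> C * \<bar>s * t\<bar>"
      by (intro 3(4) less_le_trans[OF T'(1) T(3)] less_le_trans[OF T'(2) T(3)])
    then have "dist (G (F x t) s) (F (G x s) t) \<le> 12 * (L0 * k\<^sup>2) + C * k\<^sup>2"
      using a1 a2 sq dist_triangle[of "G (F x t) s" "F (G x s) t" "Y (X x t) s"]
        dist_triangle2[of "Y (X x t) s" "F (G x s) t" "X (Y x s) t"] by (simp add: dist_commute)
    then show ?thesis
      by (simp add: L_def algebra_simps)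
  qed
  have le_L: "2 * L0 * t\<^sup>2 \<le> 2 * L * t\<^sup>2" for t
    using L by (intro mult_right_mono) auto
  have "field_pair F G x0 r T L u X Y"
  proof
    show "dist (F x t) (X x t) \<le> 2 * L * t\<^sup>2" if "F.near 20 x" "\<bar>t\<bar> < T" for x t
      using nearX[OF that] le_L by (rule order_trans)
    show "dist (G x t) (Y x t) \<le> 2 * L * t\<^sup>2" if "F.near 20 x" "\<bar>t\<bar> < T" for x t
      using nearY[OF that] le_L by (rule order_trans)
  qed (use rough T in auto)
  moreover have "flow_field \<alpha>F \<beta>F F x t = F x t" if "x \<in> ball x0 r" "\<bar>t\<bar> < T" for x t
    using controlled_flow.flow_defined_on_box[OF cF[OF L(3)] r(1) _ room(2) that(1)] T that
    by (intro flow_field_eq_flow) auto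
  moreover have "flow_field \<alpha>G \<beta>G G x t = G x t" if "x \<in> ball x0 r" "\<bar>t\<bar> < T" for x t
    using controlled_flow.flow_defined_on_box[OF cG[OF L(4)] r(1) _ room(2) that(1)] T that
    by (intro flow_field_eq_flow) auto
  ultimately show ?thesis
    using r T that by blast
qed

theorem theorem27:
  fixes X Y F G :: "'a::metric_space \<Rightarrow> real \<Rightarrow> 'a"
    and \<alpha>F \<beta>F \<alpha>G \<beta>G :: "'a \<Rightarrow> ereal"
    and a b :: "'a \<Rightarrow> real"
    and x0 :: 'a
  assumes "locally_complete (UNIV :: 'a set)"
    and "arc_field X" and "arc_field Y"
    and "cond_E1 X" and "cond_E2 X"
    and "cond_E1 Y" and "cond_E2 Y"
    and "fields_close X Y"
    and "transverse X Y"
    and "local_flow X \<alpha>F \<beta>F F" and "local_flow Y \<alpha>G \<beta>G G"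
    and "lipschitz_function a" and "lipschitz_function b"
    and "tangent (bracket (flow_field \<alpha>F \<beta>F F) (flow_field \<alpha>G \<beta>G G))
           (add_field (scale_field a X) (scale_field b Y))"
  shows "\<exists>S. x0 \<in> S \<and> integral_surface X Y S"
proof -
  obtain \<delta> where \<delta>: "0 < \<delta>"
    "\<And>x s t. \<bar>s\<bar> < \<delta> \<Longrightarrow> \<bar>t\<bar> < \<delta> \<Longrightarrow> x \<in> ball x0 \<delta> \<Longrightarrow> \<delta> * (\<bar>s\<bar> + \<bar>t\<bar>) \<le> dist (X x s) (Y x t)"
    using \<open>transverse X Y\<close>[unfolded transverse_def, rule_format, of x0] by blast
  obtain r1 where r1: "0 < r1" and tan: "\<And>\<epsilon>. 0 < \<epsilon> \<Longrightarrow> \<exists>\<delta>>0. \<forall>x\<in>ball x0 r1. \<forall>t. 0 < \<bar>t\<bar> \<and> \<bar>t\<bar> < \<delta> \<longrightarrow>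
      dist (bracket (flow_field \<alpha>F \<beta>F F) (flow_field \<alpha>G \<beta>G G) x t)
        (add_field (scale_field a X) (scale_field b Y) x t) < \<epsilon> * \<bar>t\<bar>"
    using assms(14)[unfolded tangent_def, THEN spec, of x0] by blast
  have "0 < min \<delta> r1"
    using \<delta>(1) r1 by simp
  from ex_field_pair[OF assms(1,2,4,5,3,6,7,8,10,11) this, of x0]
  obtain r T L u where pair: "field_pair F G x0 r T L u X Y"
    and small: "r \<le> min \<delta> r1" "T \<le> min \<delta> r1" "4 * L * T \<le> min \<delta> r1"
    and flow_field: "\<And>x t. x \<in> ball x0 r \<Longrightarrow> \<bar>t\<bar> < T \<Longrightarrow> flow_field \<alpha>F \<beta>F F x t = F x t"
      "\<And>x t. x \<in> ball x0 r \<Longrightarrow> \<bar>t\<bar> < T \<Longrightarrow> flow_field \<alpha>G \<beta>G G x t = G x t"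
    by blast
  interpret field_pair F G x0 r T L u X Y
    by (rule pair)
  have bound: "\<exists>B>0. (\<forall>x. near 20 x \<longrightarrow> \<bar>a x\<bar> \<le> B) \<and> (\<forall>x. near 20 x \<longrightarrow> \<bar>b x\<bar> \<le> B)"
    if lip: "lipschitz_function a" "lipschitz_function b" for a b :: "'a \<Rightarrow> real"
  proof -
    obtain A where A: "0 < A" "\<And>x. x \<in> ball x0 r \<Longrightarrow> \<bar>a x\<bar> \<le> A"
      by (rule lipschitz_function_bounded_on_ball[OF lip(1), of x0 r]) blast
    obtain B where B: "0 < B" "\<And>x. x \<in> ball x0 r \<Longrightarrow> \<bar>b x\<bar> \<le> B"
      by (rule lipschitz_function_bounded_on_ball[OF lip(2), of x0 r]) blast
    show ?thesis
    proof (intro exI[of _ "max A B"] conjI allI impI)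
      fix x assume "near 20 x"
      then have "x \<in> ball x0 r"
        by (rule F.near_imp_ball) simp
      then show "\<bar>a x\<bar> \<le> max A B" "\<bar>b x\<bar> \<le> max A B"
        using A(2) B(2) by (auto simp: le_max_iff_disj)
    qed (use A in simp)
  qed
  obtain K where K: "0 < K" "\<And>x. near 20 x \<Longrightarrow> \<bar>a x\<bar> \<le> K" "\<And>x. near 20 x \<Longrightarrow> \<bar>b x\<bar> \<le> K"
    using bound[OF assms(12,13)] by blast
  interpret framed_fields F G x0 r T L u X Y K "2 / \<delta>"
  proof
    show "0 < K" "0 < 2 / \<delta>"
      using K \<delta> by auto
    show "\<exists>\<tau>0>0. \<forall>x \<tau>. near 6 x \<and> 0 < \<tau> \<and> \<tau> < \<tau>0 \<longrightarrow> shifted (K * \<tau>\<^sup>2) (\<epsilon> * \<tau>\<^sup>2) (loop x \<tau>) x"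
      if "0 < \<epsilon>" for \<epsilon>
    proof (rule tangent_imp_commutator[OF K(2,3,1) _ _ _ that])
      show "flow_field \<alpha>F \<beta>F F x t = F x t" "flow_field \<alpha>G \<beta>G G x t = G x t" if "near 20 x" "\<bar>t\<bar> < T" for x t
        using flow_field[OF F.near_imp_ball[OF that(1)] that(2)] by simp_all
      fix \<epsilon> :: real assume "0 < \<epsilon>"
      obtain \<delta>' where \<delta>': "0 < \<delta>'" "\<And>x t. x \<in> ball x0 r1 \<Longrightarrow> 0 < \<bar>t\<bar> \<Longrightarrow> \<bar>t\<bar> < \<delta>' \<Longrightarrow>
          dist (bracket (flow_field \<alpha>F \<beta>F F) (flow_field \<alpha>G \<beta>G G) x t)
            (add_field (scale_field a X) (scale_field b Y) x t) < \<epsilon> * \<bar>t\<bar>"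
        using tan[OF \<open>0 < \<epsilon>\<close>] by blast
      have near_r1: "x \<in> ball x0 r1" if "near 20 x" for x
        using F.near_imp_ball[OF that] small(1) by simp
      then show "\<exists>\<delta>>0. \<forall>x t. near 20 x \<and> 0 < \<bar>t\<bar> \<and> \<bar>t\<bar> < \<delta> \<longrightarrow>
          dist (bracket (flow_field \<alpha>F \<beta>F F) (flow_field \<alpha>G \<beta>G G) x t)
            (add_field (scale_field a X) (scale_field b Y) x t) < \<epsilon> * \<bar>t\<bar>"
        by (intro exI[of _ \<delta>'] conjI allI impI \<delta>' near_r1) auto
    qed
    show "\<bar>s\<bar> + \<bar>t\<bar> \<le> 2 / \<delta> * dist (F x s) (G x t)" if x: "near 20 x" and st: "\<bar>s\<bar> < T" "\<bar>t\<bar> < T" for x s t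
    proof -
      have quad: "2 * L * z\<^sup>2 \<le> \<delta> / 2 * \<bar>z\<bar>" if "\<bar>z\<bar> < T" for z
      proof -
        have "2 * L * z\<^sup>2 = 2 * L * \<bar>z\<bar> * \<bar>z\<bar>"
          by (simp add: power2_eq_square flip: abs_mult)
        also have "\<dots> \<le> 2 * L * T * \<bar>z\<bar>"
          using that F.box_pos by (intro mult_right_mono mult_left_mono) auto
        also have "\<dots> \<le> \<delta> / 2 * \<bar>z\<bar>"
          using small(3) by (intro mult_right_mono) auto
        finally show ?thesis .
      qed
      have "\<delta> * (\<bar>s\<bar> + \<bar>t\<bar>) \<le> dist (X x s) (Y x t)"
        using F.near_imp_ball[OF x] small st by (intro \<delta>) auto
      also have "\<dots> \<le> dist (F x s) (G x t) + \<delta> / 2 * \<bar>s\<bar> + \<delta> / 2 * \<bar>t\<bar>"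
        using near_X[OF x st(1)] near_Y[OF x st(2)] quad[OF st(1)] quad[OF st(2)]
          dist_triangle[of "X x s" "Y x t" "F x s"] dist_triangle[of "F x s" "Y x t" "G x t"]
        by (simp add: dist_commute)
      finally have "\<delta> / 2 * (\<bar>s\<bar> + \<bar>t\<bar>) \<le> dist (F x s) (G x t)"
        by (simp add: algebra_simps)
      then have "2 / \<delta> * (\<delta> / 2 * (\<bar>s\<bar> + \<bar>t\<bar>)) \<le> 2 / \<delta> * dist (F x s) (G x t)"
        using \<delta>(1) by (intro mult_left_mono) auto
      then show ?thesis
        using \<delta>(1) by simp
    qed
  qed
  have "integral_surface X Y (chart ` square)"
    unfolding integral_surface_def
  proof (intro conjI allI impI ballI surface_chart)
    fix a b :: "'a \<Rightarrow> real" and p assume ab: "lipschitz_function a \<and> lipschitz_function b" and p: "p \<in> chart ` square"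
    obtain B where "0 < B" "\<And>x. near 20 x \<Longrightarrow> \<bar>a x\<bar> \<le> B" "\<And>x. near 20 x \<Longrightarrow> \<bar>b x\<bar> \<le> B"
      using bound[of a b] ab by blast
    then show "\<exists>r>0. \<forall>\<epsilon>>0. \<exists>\<delta>>0. \<forall>x\<in>chart ` square \<inter> ball p r. \<forall>t. 0 < \<bar>t\<bar> \<and> \<bar>t\<bar> < \<delta> \<longrightarrow>
        infdist (add_field (scale_field a X) (scale_field b Y) x t) (chart ` square) < \<epsilon> * \<bar>t\<bar>"
      using p by (intro infdist_combination) auto
  qed
  then show ?thesis
    using base_in_surface by blast
qed

end
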